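(* There is no matrix $W\in\mathbb{R}^{6\times n}$ such that $rk_t(W)=3$, $rk_K(W)>3$, every row of $\mathcal P(W)$ contains at least one $0$, every column of $\mathcal P(W)$ has support among $\{1,2\}$, $\{4,5,6\}$, $\{3,4,6\}$, $\{3,5,6\}$, $\{3,4,5\}$, $\{3,4,5,6\}$, some column has support $\{1,2\}$, and some column has support in $\{\{4,5,6\},\{3,4,6\},\{3,5,6\},\{3,4,5\}\}$.
   Context: Tropical rank $rk_t$: largest $r$ such that the matrix has an $r\times r$ submatrix $S$ for which $\min_{\sigma}\sum_i s_{i\sigma(i)}$ is attained by exactly one permutation. Kapranov rank $rk_K(B)$: minimal rank over $\mathbf K$ of a matrix $A\in\mathbf K^{m\times n}$ with $\deg a_{ij}=b_{ij}$, where $\mathbf K$ is the field of formal sums $\sum_{e\in\mathbb{R}}a_et^e$ ($a_e\in\mathbb{C}$) with well-ordered support and $\deg$ is the minimal exponent ($\deg 0=\infty$). The pattern $\mathcal P(A)\in\{0,\infty\}^{m\times n}$ has $(u,v)$ entry $0$ if $a_{uv}=\min_i a_{iv}$ and $\infty$ otherwise; the support of a column of $\mathcal P(A)$ is the set of row indices where it is $0$. *)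

theory Defs
  imports "HOL-Analysis.Analysis"
begin

section \<open>Well-ordered sets of real exponents\<close>

text \<open>Since \<open><\<close> is total on the reals, well-foundedness of \<open><\<close> on \<open>S\<close> says that \<open>S\<close> is well-ordered.\<close>

abbreviation well_ordered :: "real set \<Rightarrow> bool" where
  "well_ordered S \<equiv> wfp_on S (<)"

lemma well_ordered_iff:
  "well_ordered S \<longleftrightarrow> (\<forall>T\<subseteq>S. T \<noteq> {} \<longrightarrow> (\<exists>m\<in>T. \<forall>t\<in>T. m \<le> t))"
  unfolding wfp_on_iff_ex_minimal by (meson not_le)

lemma well_ordered_min:
  assumes "well_ordered S" "T \<subseteq> S" "T \<noteq> {}"
  obtains m where "m \<in> T" "\<And>t. t \<in> T \<Longrightarrow> m \<le> t"
proof -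
  have "\<exists>m\<in>T. \<forall>t\<in>T. m \<le> t"
    using assms(1)[unfolded well_ordered_iff, rule_format, OF assms(2,3)] .
  then show thesis using that by blast
qed

lemma well_ordered_subset: "well_ordered S \<Longrightarrow> T \<subseteq> S \<Longrightarrow> well_ordered T"
  unfolding well_ordered_iff by blast

lemma well_ordered_Un:
  assumes "well_ordered S" "well_ordered T"
  shows "well_ordered (S \<union> T)"
  unfolding well_ordered_iff
proof (intro allI impI)
  fix U assume U: "U \<subseteq> S \<union> T" "U \<noteq> {}"
  show "\<exists>m\<in>U. \<forall>t\<in>U. m \<le> t"
  proof (cases "U \<inter> S = {} \<or> U \<inter> T = {}")
    case True
    then have "U \<subseteq> S \<or> U \<subseteq> T" using U by blast
    then show ?thesis using assms U unfolding well_ordered_iff by blast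
  next
    case False
    obtain a where a: "a \<in> U \<inter> S" "\<And>t. t \<in> U \<inter> S \<Longrightarrow> a \<le> t"
      using well_ordered_min[OF assms(1), of "U \<inter> S"] False by blast
    obtain b where b: "b \<in> U \<inter> T" "\<And>t. t \<in> U \<inter> T \<Longrightarrow> b \<le> t"
      using well_ordered_min[OF assms(2), of "U \<inter> T"] False by blast
    show ?thesis
    proof (rule bexI[of _ "min a b"])
      show "\<forall>t\<in>U. min a b \<le> t" using a(2) b(2) U(1) by (auto simp: min_le_iff_disj)
      show "min a b \<in> U" using a b by (auto simp: min_def)
    qed
  qed
qed

lemma well_ordered_bounded:
  assumes "\<And>b. well_ordered {s\<in>S. s \<le> b}"
  shows "well_ordered S"
  unfolding well_ordered_iff
proof (intro allI impI)
  fix T assume T: "T \<subseteq> S" "T \<noteq> {}"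
  then obtain b where b: "b \<in> T" by blast
  obtain m where m: "m \<in> {t\<in>T. t \<le> b}" "\<And>t. t \<in> {t\<in>T. t \<le> b} \<Longrightarrow> m \<le> t"
    using well_ordered_min[OF assms[of b], of "{t\<in>T. t \<le> b}"] T b by blast
  show "\<exists>m\<in>T. \<forall>t\<in>T. m \<le> t"
  proof (rule bexI[of _ m])
    show "\<forall>t\<in>T. m \<le> t"
    proof
      fix t assume "t \<in> T"
      then show "m \<le> t" using m by (cases "t \<le> b") auto
    qed
    show "m \<in> T" using m by simp
  qed
qed

lemma well_ordered_no_descent:
  assumes "well_ordered S" "\<And>n. f n \<in> S" "\<And>n. f (Suc n) < f n"
  shows False
proof -
  obtain m where m: "m \<in> range f" "\<And>t. t \<in> range f \<Longrightarrow> m \<le> t"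
    using well_ordered_min[OF assms(1), of "range f"] assms(2) by blast
  then obtain n where "m = f n" by blast
  then show False using assms(3)[of n] m(2)[of "f (Suc n)"] by simp
qed

lemma well_ordered_plus:
  assumes A: "well_ordered A" and B: "well_ordered B"
  shows "well_ordered {a + b |a b. a \<in> A \<and> b \<in> B}"
proof (rule ccontr)
  assume "\<not> ?thesis"
  then obtain T where T: "T \<subseteq> {a + b |a b. a \<in> A \<and> b \<in> B}" "T \<noteq> {}"
    and desc: "\<And>m. m \<in> T \<Longrightarrow> \<exists>t\<in>T. t < m"
    unfolding well_ordered_iff by (meson not_le)
  have "\<exists>f. \<forall>n. f n \<in> T \<and> f (Suc n) < f n"
  proof (rule dependent_nat_choice[of "\<lambda>_ t. t \<in> T" "\<lambda>_ s t. t < s"])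
    show "\<exists>x. x \<in> T" using T by blast
    show "\<exists>y. y \<in> T \<and> y < x" if "x \<in> T" for x and n :: nat using desc[OF that] by blast
  qed
  then obtain f where f: "\<And>n. f n \<in> T" "\<And>n. f (Suc n) < f n" by blast
  have "\<forall>n. \<exists>a b. f n = a + b \<and> a \<in> A \<and> b \<in> B" using f(1) T(1) by blast
  then obtain a b where ab: "\<And>n. f n = a n + b n" "\<And>n. a n \<in> A" "\<And>n. b n \<in> B" by metis
  have fdec: "f m < f n" if "n < m" for m n
    using that by (induction rule: strict_inc_induct) (auto intro: f(2) less_trans)
  obtain g :: "nat \<Rightarrow> nat" where g: "strict_mono g" "monoseq (\<lambda>n. a (g n))"
    using seq_monosub[of a] by blast
  obtain k where k: "\<And>n. n \<ge> k \<Longrightarrow> a (g k) \<le> a (g n) \<and> a (g n) \<le> a (g (Suc n))"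
  proof (cases "\<forall>m n. m \<le> n \<longrightarrow> a (g m) \<le> a (g n)")
    case True
    then show thesis using that[of 0] by simp
  next
    case False
    then have dec: "\<And>m n. m \<le> n \<Longrightarrow> a (g n) \<le> a (g m)"
      using g(2) unfolding monoseq_def by blast
    obtain m where m: "m \<in> range (a \<circ> g)" "\<And>t. t \<in> range (a \<circ> g) \<Longrightarrow> m \<le> t"
      using well_ordered_min[OF A, of "range (a \<circ> g)"] ab(2) by auto
    then obtain k where mk: "m = a (g k)" by auto
    have "a (g n) = m" if "n \<ge> k" for n
      using dec[OF that] m(2)[of "a (g n)"] mk by auto
    then have "a (g k) \<le> a (g n) \<and> a (g n) \<le> a (g (Suc n))" if "n \<ge> k" for n
      using that le_SucI by (metis order_refl)
    then show thesis by (rule that)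
  qed
  show False
  proof (rule well_ordered_no_descent[OF B, of "\<lambda>n. b (g (n + k))"])
    show "b (g (n + k)) \<in> B" for n by (rule ab(3))
    show "b (g (Suc n + k)) < b (g (n + k))" for n
      using k[of "n + k"] fdec[of "g (n + k)" "g (Suc n + k)"] g(1)
      by (auto simp: ab(1) strict_mono_def)
  qed
qed

lemma finite_of_two_sided:
  assumes lo: "well_ordered A" and hi: "well_ordered (uminus ` A)"
  shows "finite A"
proof -
  have max: "\<exists>M\<in>T. \<forall>t\<in>T. t \<le> M" if "T \<subseteq> A" "T \<noteq> {}" for T
  proof -
    obtain m where m: "m \<in> uminus ` T" "\<And>t. t \<in> uminus ` T \<Longrightarrow> m \<le> t"
      using well_ordered_min[OF hi, of "uminus ` T"] \<open>T \<subseteq> A\<close> \<open>T \<noteq> {}\<close> by blast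
    obtain M where M: "M \<in> T" "m = - M" using m(1) by blast
    have "t \<le> M" if "t \<in> T" for t using m(2)[of "- t"] that M by auto
    with M show ?thesis by blast
  qed
  have step: "finite T" if T: "T \<subseteq> A" and fin: "\<And>c. c \<in> T \<Longrightarrow> finite {x\<in>T. x < c}" for T
  proof (cases "T = {}")
    case False
    then obtain M where M: "M \<in> T" "\<And>t. t \<in> T \<Longrightarrow> t \<le> M" using max[OF T] by blast
    have "T \<subseteq> insert M {x\<in>T. x < M}" using M by force
    then show ?thesis using fin[OF M(1)] by (meson finite.insertI finite_subset)
  qed simp
  have "{a\<in>A. infinite {x\<in>A. x < a}} = {}"
  proof (rule ccontr)
    assume "{a\<in>A. infinite {x\<in>A. x < a}} \<noteq> {}"
    then obtain b where b: "b \<in> {a\<in>A. infinite {x\<in>A. x < a}}"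
      "\<And>t. t \<in> {a\<in>A. infinite {x\<in>A. x < a}} \<Longrightarrow> b \<le> t"
      using well_ordered_min[OF lo, of "{a\<in>A. infinite {x\<in>A. x < a}}"] by blast
    have "finite {x\<in>A. x < b}"
    proof (rule step)
      fix c assume c: "c \<in> {x\<in>A. x < b}"
      then have "finite {x\<in>A. x < c}" using b(2)[of c] by fastforce
      then show "finite {x \<in> {x\<in>A. x < b}. x < c}" by (rule rev_finite_subset) auto
    qed auto
    then show False using b(1) by simp
  qed
  then have "finite {x\<in>A. x < c}" if "c \<in> A" for c using that by blast
  then show ?thesis by (rule step[OF subset_refl])
qed

lemma finite_antidiagonal:
  assumes "well_ordered A" "well_ordered B"
  shows "finite {a\<in>A. e - a \<in> B}"
proof (rule finite_of_two_sided)
  show "well_ordered {a\<in>A. e - a \<in> B}"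
    using assms(1) by (rule well_ordered_subset) blast
  show "well_ordered (uminus ` {a\<in>A. e - a \<in> B})"
    unfolding well_ordered_iff
  proof (intro allI impI)
    fix T assume T: "T \<subseteq> uminus ` {a\<in>A. e - a \<in> B}" "T \<noteq> {}"
    have "(+) e ` T \<subseteq> B" using T(1) by fastforce
    moreover have "(+) e ` T \<noteq> {}" using T(2) by simp
    ultimately obtain m where m: "m \<in> (+) e ` T" "\<And>t. t \<in> (+) e ` T \<Longrightarrow> m \<le> t"
      using well_ordered_min[OF assms(2)] by blast
    obtain m' where m': "m' \<in> T" "m = e + m'" using m(1) by blast
    have "m' \<le> t" if "t \<in> T" for t using m(2)[of "e + t"] that m'(2) by simp
    with m'(1) show "\<exists>m\<in>T. \<forall>t\<in>T. m \<le> t" by blast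
  qed
qed


section \<open>The field of Hahn series over the complex numbers with real exponents\<close>

typedef hahn = "{f :: real \<Rightarrow> complex. well_ordered {e. f e \<noteq> 0}}"
  morphisms coeff Abs_hahn
proof
  show "(\<lambda>_. 0) \<in> {f :: real \<Rightarrow> complex. well_ordered {e. f e \<noteq> 0}}"
    by (simp add: well_ordered_iff)
qed

setup_lifting type_definition_hahn

definition supp :: "hahn \<Rightarrow> real set" where
  "supp x = {e. coeff x e \<noteq> 0}"

lemma well_ordered_supp: "well_ordered (supp x)"
  using coeff[of x] by (simp add: supp_def)

lemma hahn_eqI: "(\<And>e. coeff x e = coeff y e) \<Longrightarrow> x = y"
  by (simp add: coeff_inject[symmetric] ext)

instantiation hahn :: comm_ring_1
begin

lift_definition zero_hahn :: hahn is "\<lambda>_. 0"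
  by (simp add: well_ordered_iff)

lift_definition one_hahn :: hahn is "\<lambda>e. if e = 0 then 1 else 0"
  by (auto simp: well_ordered_iff)

lift_definition plus_hahn :: "hahn \<Rightarrow> hahn \<Rightarrow> hahn" is "\<lambda>f g e. f e + g e"
proof -
  fix f g :: "real \<Rightarrow> complex"
  assume "well_ordered {e. f e \<noteq> 0}" "well_ordered {e. g e \<noteq> 0}"
  from well_ordered_Un[OF this] show "well_ordered {e. f e + g e \<noteq> 0}"
    by (rule well_ordered_subset) auto
qed

lift_definition uminus_hahn :: "hahn \<Rightarrow> hahn" is "\<lambda>f e. - f e"
  by simp

lift_definition minus_hahn :: "hahn \<Rightarrow> hahn \<Rightarrow> hahn" is "\<lambda>f g e. f e - g e"
proof -
  fix f g :: "real \<Rightarrow> complex"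
  assume "well_ordered {e. f e \<noteq> 0}" "well_ordered {e. g e \<noteq> 0}"
  from well_ordered_Un[OF this] show "well_ordered {e. f e - g e \<noteq> 0}"
    by (rule well_ordered_subset) auto
qed

lift_definition times_hahn :: "hahn \<Rightarrow> hahn \<Rightarrow> hahn" is
  "\<lambda>f g e. \<Sum>a | f a \<noteq> 0 \<and> g (e - a) \<noteq> 0. f a * g (e - a)"
proof -
  fix f g :: "real \<Rightarrow> complex"
  assume fg: "well_ordered {e. f e \<noteq> 0}" "well_ordered {e. g e \<noteq> 0}"
  show "well_ordered {e. (\<Sum>a | f a \<noteq> 0 \<and> g (e - a) \<noteq> 0. f a * g (e - a)) \<noteq> 0}"
  proof (rule well_ordered_subset[OF well_ordered_plus[OF fg]], rule)
    fix e assume "e \<in> {e. (\<Sum>a | f a \<noteq> 0 \<and> g (e - a) \<noteq> 0. f a * g (e - a)) \<noteq> 0}"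
    then have "(\<Sum>a | f a \<noteq> 0 \<and> g (e - a) \<noteq> 0. f a * g (e - a)) \<noteq> 0" by simp
    then obtain a where "f a \<noteq> 0" "g (e - a) \<noteq> 0"
      by (rule sum.not_neutral_contains_not_neutral) blast
    then show "e \<in> {a + b |a b. a \<in> {e. f e \<noteq> 0} \<and> b \<in> {e. g e \<noteq> 0}}"
      by - (rule CollectI, rule exI[of _ a], rule exI[of _ "e - a"], simp)
  qed
qed

lemma coeff_times:
  "coeff (x * y) e = (\<Sum>a | a \<in> supp x \<and> e - a \<in> supp y. coeff x a * coeff y (e - a))"
  by (simp add: times_hahn.rep_eq supp_def)

lemma coeff_times_superset:
  assumes "finite X" "{a. a \<in> supp x \<and> e - a \<in> supp y} \<subseteq> X"
  shows "coeff (x * y) e = (\<Sum>a\<in>X. coeff x a * coeff y (e - a))"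
  unfolding coeff_times
  by (rule sum.mono_neutral_left) (use assms in \<open>auto simp: supp_def\<close>)

lemma finite_supp_pairs: "finite {a. a \<in> supp x \<and> e - a \<in> supp y}"
  using finite_antidiagonal[OF well_ordered_supp well_ordered_supp] by simp

lemma supp_times: "supp (x * y) \<subseteq> {a + b |a b. a \<in> supp x \<and> b \<in> supp y}"
proof
  fix e assume "e \<in> supp (x * y)"
  then have "coeff (x * y) e \<noteq> 0" by (simp add: supp_def)
  then obtain a where "a \<in> supp x" "e - a \<in> supp y"
    unfolding coeff_times by (rule sum.not_neutral_contains_not_neutral) blast
  then show "e \<in> {a + b |a b. a \<in> supp x \<and> b \<in> supp y}"
    by - (rule CollectI, rule exI[of _ a], rule exI[of _ "e - a"], simp)
qed

lemma hahn_times_commute: "x * y = y * (x :: hahn)"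
proof (rule hahn_eqI)
  fix e
  show "coeff (x * y) e = coeff (y * x) e"
    unfolding coeff_times
    by (rule sum.reindex_bij_witness[of _ "\<lambda>a. e - a" "\<lambda>a. e - a"]) auto
qed

lemma coeff_times3:
  "coeff (x * y * z) e =
     (\<Sum>(a, b) | a \<in> supp x \<and> b \<in> supp y \<and> e - a - b \<in> supp z.
        coeff x a * coeff y b * coeff z (e - a - b))"
proof -
  define C where "C = {c. c \<in> {a + b |a b. a \<in> supp x \<and> b \<in> supp y} \<and> e - c \<in> supp z}"
  have finC: "finite C"
    using finite_antidiagonal[OF well_ordered_plus[OF well_ordered_supp well_ordered_supp]
        well_ordered_supp, of x y e z] unfolding C_def by simp
  have "coeff (x * y * z) e = (\<Sum>c\<in>C. coeff (x * y) c * coeff z (e - c))"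
    by (rule coeff_times_superset[OF finC]) (use supp_times[of x y] in \<open>auto simp: C_def\<close>)
  also have "\<dots> = (\<Sum>c\<in>C. \<Sum>a | a \<in> supp x \<and> c - a \<in> supp y.
                     coeff x a * coeff y (c - a) * coeff z (e - c))"
    by (simp add: coeff_times sum_distrib_right)
  also have "\<dots> = (\<Sum>(c, a) \<in> (SIGMA c:C. {a. a \<in> supp x \<and> c - a \<in> supp y}).
                     coeff x a * coeff y (c - a) * coeff z (e - c))"
    by (rule sum.Sigma) (use finC finite_supp_pairs in auto)
  also have "\<dots> = (\<Sum>(a, b) | a \<in> supp x \<and> b \<in> supp y \<and> e - a - b \<in> supp z.
        coeff x a * coeff y b * coeff z (e - a - b))"
    by (rule sum.reindex_bij_witness[of _ "\<lambda>(a, b). (a + b, a)" "\<lambda>(c, a). (a, c - a)"])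
       (auto simp: C_def algebra_simps)
  finally show ?thesis .
qed

instance
proof
  fix x y z :: hahn
  show "x + y + z = x + (y + z)" by transfer (simp add: add.assoc)
  show "x + y = y + x" by transfer (simp add: add.commute)
  show "0 + x = x" by transfer simp
  show "- x + x = 0" by transfer simp
  show "x - y = x + - y" by transfer simp
  show "(0::hahn) \<noteq> 1" by transfer (metis zero_neq_one)
  show "x * y = y * x" by (rule hahn_times_commute)
  have "x * y * z = y * z * x"
  proof (rule hahn_eqI)
    fix e
    show "coeff (x * y * z) e = coeff (y * z * x) e"
      unfolding coeff_times3
      by (rule sum.reindex_bij_witness[of _ "\<lambda>(b, c). (e - b - c, b)" "\<lambda>(a, b). (b, e - a - b)"])
         auto
  qed
  then show "x * y * z = x * (y * z)" by (metis hahn_times_commute)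
  show "1 * x = x"
  proof (rule hahn_eqI)
    fix e
    have "coeff (1 * x) e = (\<Sum>a\<in>{0}. coeff 1 a * coeff x (e - a))"
      by (rule coeff_times_superset) (auto simp: supp_def one_hahn.rep_eq)
    then show "coeff (1 * x) e = coeff x e" by (simp add: one_hahn.rep_eq)
  qed
  show "(x + y) * z = x * z + y * z"
  proof (rule hahn_eqI)
    fix e
    define X where "X = {a. a \<in> supp x \<and> e - a \<in> supp z} \<union> {a. a \<in> supp y \<and> e - a \<in> supp z}"
    have fin: "finite X" unfolding X_def using finite_supp_pairs by blast
    have 1: "coeff ((x + y) * z) e = (\<Sum>a\<in>X. coeff (x + y) a * coeff z (e - a))"
      by (rule coeff_times_superset[OF fin]) (auto simp: X_def supp_def plus_hahn.rep_eq)
    have 2: "coeff (x * z) e = (\<Sum>a\<in>X. coeff x a * coeff z (e - a))"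
      by (rule coeff_times_superset[OF fin]) (auto simp: X_def)
    have 3: "coeff (y * z) e = (\<Sum>a\<in>X. coeff y a * coeff z (e - a))"
      by (rule coeff_times_superset[OF fin]) (auto simp: X_def)
    show "coeff ((x + y) * z) e = coeff (x * z + y * z) e"
      by (simp add: 1 2 3 plus_hahn.rep_eq ring_distribs sum.distrib)
  qed
qed

end

lift_definition monomial :: "complex \<Rightarrow> real \<Rightarrow> hahn" is "\<lambda>c r e. if e = r then c else 0"
  by (auto simp: well_ordered_iff)

lemma coeff_monomial_times: "coeff (monomial c r * x) e = c * coeff x (e - r)"
proof -
  have "coeff (monomial c r * x) e = (\<Sum>a\<in>{r}. coeff (monomial c r) a * coeff x (e - a))"
    by (rule coeff_times_superset) (auto simp: supp_def monomial.rep_eq split: if_splits)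
  then show ?thesis by (simp add: monomial.rep_eq)
qed

lemma coeff_sum: "coeff (\<Sum>i\<in>A. f i) e = (\<Sum>i\<in>A. coeff (f i) e)"
  by (induction A rule: infinite_finite_induct) (auto simp: zero_hahn.rep_eq plus_hahn.rep_eq)

lemma supp_power:
  assumes "\<And>e. e \<in> supp u \<Longrightarrow> d \<le> e" "e \<in> supp (u ^ n)"
  shows "real n * d \<le> e"
  using assms(2)
proof (induction n arbitrary: e)
  case 0
  then show ?case by (auto simp: supp_def one_hahn.rep_eq split: if_splits)
next
  case (Suc n)
  then obtain a b where "a \<in> supp u" "b \<in> supp (u ^ n)" "e = a + b"
    using supp_times[of u "u ^ n"] by auto
  then show ?case using assms(1)[of a] Suc.IH[of b] by (simp add: algebra_simps)
qed

lemma geometric_inverse: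
  assumes pos: "\<And>e. e \<in> supp u \<Longrightarrow> 0 < e"
  shows "\<exists>s. (1 - u) * s = (1 :: hahn)"
proof -
  obtain d where d: "d > 0" "\<And>e. e \<in> supp u \<Longrightarrow> d \<le> e"
  proof (cases "supp u = {}")
    case True
    then show thesis using that[of 1] by simp
  next
    case False
    then obtain m where "m \<in> supp u" "\<And>t. t \<in> supp u \<Longrightarrow> m \<le> t"
      using well_ordered_min[OF well_ordered_supp, of "supp u" u] by blast
    then show thesis using that[of m] pos by blast
  qed
  define N where "N e = nat \<lceil>e / d\<rceil>" for e
  define P where "P k = (\<Sum>n\<le>k. u ^ n)" for k
  have vanish: "coeff (u ^ n) e = 0" if "n > N e" for n e
  proof (rule ccontr)
    assume "coeff (u ^ n) e \<noteq> 0"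
    then have "real n * d \<le> e" using supp_power[OF d(2), of u e n] by (simp add: supp_def)
    then have "real n \<le> e / d" using d(1) by (simp add: field_simps)
    then show False using that unfolding N_def by linarith
  qed
  have stable: "coeff (P k) e = coeff (P (N e)) e" if "k \<ge> N e" for k e
    unfolding P_def coeff_sum
    by (rule sum.mono_neutral_right) (use that vanish in auto)
  have N_mono: "N a \<le> N b" if "a \<le> b" for a b
    unfolding N_def using that d(1) by (intro nat_mono ceiling_mono divide_right_mono) auto
  have wo: "well_ordered {e. coeff (P (N e)) e \<noteq> 0}"
  proof (rule well_ordered_bounded)
    fix b
    show "well_ordered {s \<in> {e. coeff (P (N e)) e \<noteq> 0}. s \<le> b}"
    proof (rule well_ordered_subset[OF well_ordered_supp[of "P (N b)"]], rule)
      fix s assume "s \<in> {s \<in> {e. coeff (P (N e)) e \<noteq> 0}. s \<le> b}"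
      then show "s \<in> supp (P (N b))" using stable[OF N_mono, of s b] by (simp add: supp_def)
    qed
  qed
  define s where "s = Abs_hahn (\<lambda>e. coeff (P (N e)) e)"
  have cs: "coeff s e = coeff (P (N e)) e" for e
    unfolding s_def using wo by (simp add: Abs_hahn_inverse)
  have "(1 - u) * s = 1"
  proof (rule hahn_eqI)
    fix e
    define k where "k = N e"
    have s_eq: "coeff s a = coeff (P k) a" if "a \<le> e" for a
      unfolding cs k_def using stable[OF N_mono[OF that]] by simp
    define X where "X = {a. a \<in> supp u \<and> e - a \<in> supp s} \<union> {a. a \<in> supp u \<and> e - a \<in> supp (P k)}"
    have fin: "finite X" unfolding X_def using finite_supp_pairs by blast
    have "coeff (u * s) e = (\<Sum>a\<in>X. coeff u a * coeff s (e - a))"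
      by (rule coeff_times_superset[OF fin]) (auto simp: X_def)
    also have "\<dots> = (\<Sum>a\<in>X. coeff u a * coeff (P k) (e - a))"
    proof (rule sum.cong[OF refl])
      fix a assume "a \<in> X"
      then have "0 < a" using pos by (auto simp: X_def)
      then show "coeff u a * coeff s (e - a) = coeff u a * coeff (P k) (e - a)"
        using s_eq[of "e - a"] by simp
    qed
    also have "\<dots> = coeff (u * P k) e"
      by (rule coeff_times_superset[OF fin, symmetric]) (auto simp: X_def)
    finally have us: "coeff (u * s) e = coeff (u * P k) e" .
    have "coeff ((1 - u) * s) e = coeff s e - coeff (u * s) e"
      by (simp add: left_diff_distrib minus_hahn.rep_eq)
    also have "\<dots> = coeff ((1 - u) * P k) e"
      using us s_eq[of e] by (simp add: left_diff_distrib minus_hahn.rep_eq)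
    also have "(1 - u) * P k = 1 - u ^ Suc k"
      unfolding P_def by (metis one_diff_power_eq lessThan_Suc_atMost)
    also have "coeff (1 - u ^ Suc k) e = coeff 1 e"
      using vanish[of e "Suc k"] by (simp add: minus_hahn.rep_eq k_def del: power_Suc)
    finally show "coeff ((1 - u) * s) e = coeff 1 e" .
  qed
  then show ?thesis by blast
qed

lemma hahn_inverse_exists:
  assumes "x \<noteq> (0 :: hahn)"
  shows "\<exists>y. x * y = 1"
proof -
  have "supp x \<noteq> {}"
    using assms hahn_eqI[of x 0] by (auto simp: supp_def zero_hahn.rep_eq)
  then obtain m where m: "m \<in> supp x" "\<And>t. t \<in> supp x \<Longrightarrow> m \<le> t"
    using well_ordered_min[OF well_ordered_supp, of "supp x" x] by blast
  define c where "c = coeff x m"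
  have c: "c \<noteq> 0" using m(1) by (simp add: c_def supp_def)
  define w where "w = monomial (1 / c) (- m)"
  have cw: "coeff (w * x) e = coeff x (e + m) / c" for e
    by (simp add: w_def coeff_monomial_times)
  define u where "u = 1 - w * x"
  have "0 < e" if "e \<in> supp u" for e
  proof (rule ccontr)
    assume "\<not> 0 < e"
    then consider "e = 0" | "e < 0" by linarith
    then have "coeff u e = 0"
    proof cases
      case 1
      then show ?thesis using c by (simp add: u_def minus_hahn.rep_eq one_hahn.rep_eq cw c_def)
    next
      case 2
      then have "e + m \<notin> supp x" using m(2)[of "e + m"] by auto
      then show ?thesis using 2 by (simp add: u_def minus_hahn.rep_eq one_hahn.rep_eq cw supp_def)
    qed
    then show False using that by (simp add: supp_def)
  qed
  then obtain s where "(1 - u) * s = 1" using geometric_inverse by blast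
  then have "x * (w * s) = 1" by (simp add: u_def ac_simps)
  then show ?thesis by blast
qed

instantiation hahn :: field
begin

definition inverse_hahn :: "hahn \<Rightarrow> hahn" where
  "inverse_hahn x = (if x = 0 then 0 else SOME y. x * y = 1)"

definition divide_hahn :: "hahn \<Rightarrow> hahn \<Rightarrow> hahn" where
  "divide_hahn x y = x * inverse y"

instance
proof
  fix x y :: hahn
  show "inverse x * x = 1" if "x \<noteq> 0"
    using someI_ex[OF hahn_inverse_exists[OF that]] that
    by (simp add: inverse_hahn_def mult.commute)
  show "x div y = x * inverse y" by (rule divide_hahn_def)
  show "inverse (0 :: hahn) = 0" by (simp add: inverse_hahn_def)
qed

end

text \<open>For nonzero \<open>x\<close> the least exponent exists because the support is well-ordered.\<close>

definition hahn_deg :: "hahn \<Rightarrow> ereal" where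
  "hahn_deg x = (if x = 0 then \<infinity> else ereal (LEAST e. coeff x e \<noteq> 0))"

lemma hahn_deg_eqI:
  assumes "coeff x r \<noteq> 0" "\<And>e. coeff x e \<noteq> 0 \<Longrightarrow> r \<le> e"
  shows "hahn_deg x = ereal r"
proof -
  have "x \<noteq> 0" using assms(1) by (auto simp: zero_hahn.rep_eq)
  moreover have "(LEAST e. coeff x e \<noteq> 0) = r" using assms by (intro Least_equality)
  ultimately show ?thesis by (simp add: hahn_deg_def)
qed

lemma hahn_deg_monomial: "c \<noteq> 0 \<Longrightarrow> hahn_deg (monomial c r) = ereal r"
  by (rule hahn_deg_eqI) (auto simp: monomial.rep_eq split: if_splits)


section \<open>Tropical rank, Kapranov rank, pattern\<close>

text \<open>An \<open>r \<times> r\<close> matrix is given by its entries at indices below \<open>r\<close>.\<close>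

definition tropically_nonsingular :: "nat \<Rightarrow> (nat \<Rightarrow> nat \<Rightarrow> real) \<Rightarrow> bool" where
  "tropically_nonsingular r S \<longleftrightarrow>
     (\<exists>!\<sigma>. \<sigma> permutes {..<r} \<and>
        (\<forall>\<tau>. \<tau> permutes {..<r} \<longrightarrow> (\<Sum>i<r. S i (\<sigma> i)) \<le> (\<Sum>i<r. S i (\<tau> i))))"

text \<open>A submatrix is selected by enumerating its rows and columns injectively; the order of
  enumeration does not affect tropical nonsingularity.\<close>

definition has_nonsingular_submatrix :: "real^'n^'m \<Rightarrow> nat \<Rightarrow> bool" where
  "has_nonsingular_submatrix B r \<longleftrightarrow>
     (\<exists>(\<rho> :: nat \<Rightarrow> 'm) (\<kappa> :: nat \<Rightarrow> 'n). inj_on \<rho> {..<r} \<and> inj_on \<kappa> {..<r} \<and>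
        tropically_nonsingular r (\<lambda>i j. B $ \<rho> i $ \<kappa> j))"

definition tropical_rank :: "real^'n^'m \<Rightarrow> nat" where
  "tropical_rank B = (GREATEST r. has_nonsingular_submatrix B r)"

definition is_lift :: "real^'n^'m \<Rightarrow> hahn^'n^'m \<Rightarrow> bool" where
  "is_lift B A \<longleftrightarrow> (\<forall>i j. hahn_deg (A $ i $ j) = ereal (B $ i $ j))"

definition kapranov_rank :: "real^'n^'m \<Rightarrow> nat" where
  "kapranov_rank B = (LEAST r. \<exists>A. is_lift B A \<and> rank A = r)"

definition pattern :: "real^'n^'m \<Rightarrow> ereal^'n^'m" where
  "pattern A = (\<chi> u v. if A $ u $ v = Min (range (\<lambda>i. A $ i $ v)) then 0 else \<infinity>)"

definition column_support :: "ereal^'n^'m \<Rightarrow> 'n \<Rightarrow> 'm set" where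
  "column_support P v = {u. P $ u $ v = 0}"

text \<open>The minimum and the maximum in the two definitions of rank are attained.\<close>

lemma has_nonsingular_submatrix_bound:
  fixes B :: "real^'n^'m"
  assumes "has_nonsingular_submatrix B r"
  shows "r \<le> CARD('m)"
proof -
  obtain \<rho> :: "nat \<Rightarrow> 'm" where "inj_on \<rho> {..<r}"
    using assms unfolding has_nonsingular_submatrix_def by blast
  then have "card {..<r} \<le> CARD('m)" by (intro card_inj_on_le) auto
  then show ?thesis by simp
qed

lemma has_nonsingular_submatrix_tropical_rank:
  "has_nonsingular_submatrix B (tropical_rank B)"
  unfolding tropical_rank_def
proof (rule GreatestI_nat[where k = 0])
  show "has_nonsingular_submatrix B 0"
    unfolding has_nonsingular_submatrix_def tropically_nonsingular_def by simp
qed (rule has_nonsingular_submatrix_bound)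

lemma le_tropical_rank:
  fixes B :: "real^'n^'m"
  shows "has_nonsingular_submatrix B r \<Longrightarrow> r \<le> tropical_rank B"
  unfolding tropical_rank_def
  by (rule Greatest_le_nat[where b = "CARD('m)"]) (use has_nonsingular_submatrix_bound in blast)+

lemma kapranov_rank_attained: "\<exists>A. is_lift B A \<and> rank A = kapranov_rank B"
  unfolding kapranov_rank_def
proof (rule LeastI_ex)
  have "is_lift B (\<chi> i j. monomial 1 (B $ i $ j))"
    by (simp add: is_lift_def hahn_deg_monomial)
  then show "\<exists>r A. is_lift B A \<and> rank A = r" by blast
qed

lemma kapranov_rank_le: "is_lift B A \<Longrightarrow> kapranov_rank B \<le> rank A"
  unfolding kapranov_rank_def by (rule Least_le) blast

text \<open>Rows of a matrix with six rows are indexed by the numeral type \<open>6\<close>, whose elements are the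
  pairwise distinct \<open>1, 2, 3, 4, 5, 6\<close>; since arithmetic on that type is modulo 6, the element
  \<open>6\<close> is also called \<open>0\<close>.\<close>

lemma UNIV_6: "(UNIV :: 6 set) = {1, 2, 3, 4, 5, 6}"
proof (rule sym, rule card_subset_eq)
  show "card {1, 2, 3, 4, 5, 6 :: 6} = CARD(6)" by simp
qed auto

end

theory Submission
  imports Defs
begin

text \<open>After subtracting its minimum from every column, \<open>W\<close> splits into columns that are zero in the rows
  \<open>1, 2\<close> and positive below, and columns that are positive in the rows \<open>1, 2\<close> and have at most one positive
  entry below. A lift of rank three amounts to a three-dimensional subspace of \<open>K^6\<close> that meets the prescribed
  valuations in every column. It is described by three linear relations: one expresses row \<open>2\<close> through row \<open>1\<close>
  and two of the lower rows, and the other two relate the rows \<open>1, 3, 4, 5, 6\<close>. Which valuations the coefficients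
  of such a relation may have is the question of finding a tropical line through points on a star: once
  two rows of the matrix are compared with three or four others, every column is a point on one of the
  rays, and the \<open>4 \<times> 4\<close> minors bound the distances. An extremal choice of the line works, because a
  column violating it yields a tropically nonsingular \<open>4 \<times> 4\<close> minor. The rows \<open>1, 3, 4, 5, 6\<close> require a
  distinction between two shapes of the tree dual to the plane: after a suitable labelling either
  \<open>5\<close> and \<open>6\<close> can be compared with \<open>1, 3, 4\<close>, or \<open>{3, 4}\<close> and \<open>{1, 6}\<close> are the cherries of a caterpillar.\<close>

section \<open>Valuations of Hahn series\<close>

text \<open>The two halves of the lift can be built almost independently. On \<open>C1\<close> the
  rows \<open>p1\<close>, \<open>p2\<close> have valuation 0 and the lower rows positive valuation,
  so the relation \<open>p2 = p1 + t^h r3 + 5 t^(h+\<tau>) r4\<close> gives the right valuation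
  whatever \<open>h\<close> and \<tau> are. On \<open>C2\<close> the row \<open>p1\<close> is
  positive, so \<open>r5\<close> and \<open>r6\<close> see only the leading coefficients
  \<open>a0\<close>, \<open>a1\<close> of \<open>r3\<close> and \<open>c0\<close>, \<open>c1\<close>
  of \<open>r4\<close> at exponent 0. The halves meet only in the inequalities
  \<open>c0 \<noteq> 5 * a0\<close>, \<open>c1 \<noteq> 5 * a1\<close> and, if \<open>r5\<close> or
  \<open>r6\<close> is positive somewhere on \<open>C2\<close>,
  \<open>c0 * a1 \<noteq> c1 * a0\<close>. The factors 2 and 5 serve these: up to sign the
  constructed \<open>c0\<close>, \<open>c1\<close> are among 1, 2, 3 and \<open>a0\<close>,
  \<open>a1\<close> among 0, 1, 2, which 5 avoids. An obstruction to an extremal choice involves two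
  or three columns, whereas the hypothesis speaks of minors of size 4. Auxiliary columns fill them
  up: \<open>v3\<close>, where only \<open>r3\<close> is positive among the lower rows (it exists
  because some support has three elements); \<open>v0\<close>, where \<open>r3\<close> vanishes
  (every row of the pattern has a zero); and columns at which an extremal value is attained.\<close>

definition hge :: "hahn \<Rightarrow> real \<Rightarrow> bool" where
  "hge x r \<longleftrightarrow> (\<forall>e<r. coeff x e = 0)"

abbreviation mon :: "real \<Rightarrow> hahn" where "mon r \<equiv> monomial 1 r"

lemma hge_mono: "hge x r \<Longrightarrow> s \<le> r \<Longrightarrow> hge x s"
  unfolding hge_def by auto

lemma hge_zero [simp]: "hge 0 r"
  unfolding hge_def by (simp add: zero_hahn.rep_eq)

lemma hge_add: "hge x r \<Longrightarrow> hge y r \<Longrightarrow> hge (x + y) r"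
  unfolding hge_def by (simp add: plus_hahn.rep_eq)

lemma hge_diff: "hge x r \<Longrightarrow> hge y r \<Longrightarrow> hge (x - y) r"
  unfolding hge_def by (simp add: minus_hahn.rep_eq)

lemma hge_uminus: "hge x r \<Longrightarrow> hge (- x) r"
  unfolding hge_def by (simp add: uminus_hahn.rep_eq)

lemma hge_mon: "s \<le> r \<Longrightarrow> hge (monomial c r) s"
  unfolding hge_def by (auto simp: monomial.rep_eq)

lemma hge_coeff_zero: "hge x r \<Longrightarrow> s < r \<Longrightarrow> coeff x s = 0"
  unfolding hge_def by auto

lemma hge_supp: "hge x r \<Longrightarrow> e \<in> supp x \<Longrightarrow> r \<le> e"
  unfolding hge_def supp_def by (metis (mono_tags, lifting) mem_Collect_eq not_le)

lemma hge_mult: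
  assumes "hge x r" "hge y s" shows "hge (x * y) (r + s)"
  unfolding hge_def
proof (intro allI impI)
  fix e assume e: "e < r + s"
  show "coeff (x * y) e = 0"
  proof (rule ccontr)
    assume "coeff (x * y) e \<noteq> 0"
    then obtain a b where "a \<in> supp x" "b \<in> supp y" "e = a + b"
      using supp_times[of x y] by (auto simp: supp_def)
    then show False using hge_supp[OF assms(1)] hge_supp[OF assms(2)] e by fastforce
  qed
qed

lemma hge_mult': "hge x r \<Longrightarrow> hge y s \<Longrightarrow> t \<le> r + s \<Longrightarrow> hge (x * y) t"
  using hge_mono[OF hge_mult] .

lemma coeff_mult_lead:
  assumes "hge x r" "hge y s" shows "coeff (x * y) (r + s) = coeff x r * coeff y s"
proof -
  have "coeff (x * y) (r + s) = (\<Sum>a\<in>{r}. coeff x a * coeff y (r + s - a))"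
  proof (rule coeff_times_superset)
    show "{a. a \<in> supp x \<and> r + s - a \<in> supp y} \<subseteq> {r}"
    proof
      fix a assume "a \<in> {a. a \<in> supp x \<and> r + s - a \<in> supp y}"
      then have "r \<le> a" "s \<le> r + s - a" using hge_supp assms by blast+
      then show "a \<in> {r}" by simp
    qed
  qed simp
  then show ?thesis by simp
qed

lemma hahn_deg_if: "hge x r \<Longrightarrow> coeff x r \<noteq> 0 \<Longrightarrow> hahn_deg x = ereal r"
  by (rule hahn_deg_eqI) (auto simp: hge_def not_less[symmetric])

text \<open>A generic complex combination of the witnesses for the single coordinates attains all valuations at once.\<close>

lemma generic_lift:
  fixes P :: "('k \<Rightarrow> hahn) \<Rightarrow> bool" and w :: "'k \<Rightarrow> real"
  assumes add: "\<And>f g c. P f \<Longrightarrow> P g \<Longrightarrow> P (\<lambda>k. f k + monomial c 0 * g k)"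
    and zero: "P (\<lambda>_. 0)"
    and fin: "finite S"
    and witness: "\<And>k. k \<in> S \<Longrightarrow> \<exists>f. P f \<and> (\<forall>l\<in>S. hge (f l) (w l)) \<and> coeff (f k) (w k) \<noteq> 0"
  shows "\<exists>f. P f \<and> (\<forall>l\<in>S. hahn_deg (f l) = ereal (w l))"
proof -
  have "\<exists>f. P f \<and> (\<forall>l\<in>S. hge (f l) (w l)) \<and> (\<forall>l\<in>T. coeff (f l) (w l) \<noteq> 0)"
    if "T \<subseteq> S" for T
    using finite_subset[OF that fin] that
  proof (induction T rule: finite_induct)
    case empty
    show ?case using zero by (intro exI[of _ "\<lambda>_. 0"]) simp
  next
    case (insert k T)
    then obtain f where f: "P f" "\<forall>l\<in>S. hge (f l) (w l)" "\<forall>l\<in>T. coeff (f l) (w l) \<noteq> 0"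
      by auto
    obtain g where g: "P g" "\<forall>l\<in>S. hge (g l) (w l)" "coeff (g k) (w k) \<noteq> 0"
      using witness[of k] insert.prems by auto
    \<comment> \<open>The finitely many multipliers for which some leading coefficient would
      cancel.\<close>
    define bad where "bad = (\<lambda>l. - coeff (f l) (w l) / coeff (g l) (w l)) ` insert k T"
    have "finite (insert 0 bad)" using insert.hyps by (simp add: bad_def)
    then obtain c where c: "c \<notin> insert 0 bad"
      using ex_new_if_finite[OF infinite_UNIV_char_0] by blast
    let ?h = "\<lambda>l. f l + monomial c 0 * g l"
    have co: "coeff (?h l) e = coeff (f l) e + c * coeff (g l) e" for l e
      by (simp add: plus_hahn.rep_eq coeff_monomial_times)
    have "coeff (?h l) (w l) \<noteq> 0" if l: "l \<in> insert k T" for l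
    proof
      assume 0: "coeff (?h l) (w l) = 0"
      show False
      proof (cases "coeff (g l) (w l) = 0")
        case True
        then have "l \<noteq> k" "coeff (f l) (w l) = 0" using 0 g(3) by (auto simp: co)
        then show False using l f(3) by auto
      next
        case False
        moreover have "coeff (f l) (w l) + c * coeff (g l) (w l) = 0" using 0 co by metis
        ultimately have "c = - coeff (f l) (w l) / coeff (g l) (w l)"
          by (simp add: field_simps add_eq_0_iff)
        then show False using c l by (auto simp: bad_def)
      qed
    qed
    moreover have "\<forall>l\<in>S. hge (?h l) (w l)"
      using f(2) g(2) unfolding hge_def by (simp add: co)
    ultimately show ?case using add[OF f(1) g(1), of c] by blast
  qed
  from this[OF subset_refl] obtain f where f: "P f" "\<forall>l\<in>S. hge (f l) (w l)"
      "\<forall>l\<in>S. coeff (f l) (w l) \<noteq> 0" by blast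
  then show ?thesis by (intro exI[of _ f]) (auto intro: hahn_deg_if)
qed

text \<open>Membership in a tropical hyperplane: Hahn series with these valuations can be chosen to
  sum to zero.\<close>

definition min_twice3 :: "real \<Rightarrow> real \<Rightarrow> real \<Rightarrow> bool" where
  "min_twice3 a b c \<longleftrightarrow> (a = b \<and> a \<le> c) \<or> (a = c \<and> a \<le> b) \<or> (b = c \<and> b \<le> a)"

definition min_twice4 :: "real \<Rightarrow> real \<Rightarrow> real \<Rightarrow> real \<Rightarrow> bool" where
  "min_twice4 a b c d \<longleftrightarrow> (a = b \<and> a \<le> c \<and> a \<le> d) \<or> (a = c \<and> a \<le> b \<and> a \<le> d) \<or> (a = d \<and> a \<le> b \<and> a \<le> c)
     \<or> (b = c \<and> b \<le> a \<and> b \<le> d) \<or> (b = d \<and> b \<le> a \<and> b \<le> c) \<or> (c = d \<and> c \<le> a \<and> c \<le> b)"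

section \<open>Lifting points of tropical planes\<close>

lemmas coeff_rules = plus_hahn.rep_eq minus_hahn.rep_eq uminus_hahn.rep_eq zero_hahn.rep_eq
  monomial.rep_eq coeff_monomial_times

text \<open>The coefficient \<open>2\<close> (and \<open>5\<close> below) only keeps leading coefficients from cancelling accidentally.\<close>

lemma plane_lift:
  fixes fi fj fk d1 d2 h \<tau> :: real
  assumes h: "h \<ge> 0" and t: "\<tau> \<ge> 0"
    and c: "(d1 = d2 \<and> d1 \<le> fi \<and> d1 \<le> fj \<and> d1 \<le> fk \<and> (d1 = fi \<or> d1 = fj \<or> d1 = fk)) \<or>
      (fk \<le> fi \<and> fk \<le> fj \<and> fk \<le> d1 \<and> fk \<le> d2 \<and> (fi = fk \<or> fj = fk) \<and> min_twice4 d1 d2 (h + fi) (h + \<tau> + fj)) \<or>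
      (fi = fj \<and> fi < fk \<and> fi \<le> d1 \<and> fi \<le> d2 \<and> min_twice3 d1 d2 (h + fi))"
  shows "\<exists>Zi Zj Zk. hahn_deg Zi = ereal fi \<and> hahn_deg Zj = ereal fj \<and> hahn_deg Zk = ereal fk \<and>
    hahn_deg (Zi + Zj + Zk) = ereal d1 \<and>
    hahn_deg (Zi + Zj + Zk + mon h * Zi + monomial 2 (h + \<tau>) * Zj) = ereal d2"
proof -
  define P where "P f \<longleftrightarrow> f 3 = f 0 + f 1 + f 2 \<and> f 4 = f 3 + mon h * f 0 + monomial 2 (h + \<tau>) * f 1"
    for f :: "nat \<Rightarrow> hahn"
  define w where "w n = (if n = 0 then fi else if n = 1 then fj else if n = 2 then fk
    else if n = 3 then d1 else d2 :: real)" for n :: nat 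
  have w: "w 0 = fi" "w 1 = fj" "w (Suc 0) = fj" "w 2 = fk" "w 3 = d1" "w 4 = d2" by (simp_all add: w_def)
  define S where "S = {0, 1, 2, 3, 4 :: nat}"
  define g where "g Zi Zj Zk n = (if n = 0 then Zi else if n = 1 then Zj else if n = 2 then Zk
    else if n = 3 then Zi + Zj + Zk else Zi + Zj + Zk + mon h * Zi + monomial 2 (h + \<tau>) * Zj :: hahn)"
    for Zi Zj Zk and n :: nat
  define ok where "ok Zi Zj Zk \<longleftrightarrow> hge Zi fi \<and> hge Zj fj \<and> hge Zk fk \<and> hge (Zi + Zj + Zk) d1 \<and>
    hge (Zi + Zj + Zk + mon h * Zi + monomial 2 (h + \<tau>) * Zj) d2" for Zi Zj Zk
  define Q where "Q k \<longleftrightarrow> (\<exists>f. P f \<and> (\<forall>l\<in>S. hge (f l) (w l)) \<and> coeff (f k) (w k) \<noteq> 0)" for k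
  have W: "Q k"
    if "ok Zi Zj Zk" "coeff (g Zi Zj Zk k) (w k) \<noteq> 0" for Zi Zj Zk and k :: nat
    unfolding Q_def using that by (intro exI[of _ "g Zi Zj Zk"]) (simp add: P_def S_def ok_def w g_def)
  have W0: "Q 0"
    if "ok Zi Zj Zk" "coeff Zi fi \<noteq> 0" for Zi Zj Zk
    using that by (intro W[of Zi Zj Zk]) (auto simp: g_def w)
  have W1: "Q 1"
    if "ok Zi Zj Zk" "coeff Zj fj \<noteq> 0" for Zi Zj Zk
    using that by (intro W[of Zi Zj Zk]) (auto simp: g_def w)
  have W2: "Q 2"
    if "ok Zi Zj Zk" "coeff Zk fk \<noteq> 0" for Zi Zj Zk
    using that by (intro W[of Zi Zj Zk]) (auto simp: g_def w)
  have W3: "Q 3"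
    if "ok Zi Zj Zk" "coeff (Zi + Zj + Zk) d1 \<noteq> 0" for Zi Zj Zk
    using that by (intro W[of Zi Zj Zk]) (auto simp: g_def w)
  have W4: "Q 4"
    if "ok Zi Zj Zk" "coeff (Zi + Zj + Zk + mon h * Zi + monomial 2 (h + \<tau>) * Zj) d2 \<noteq> 0" for Zi Zj Zk
    using that by (intro W[of Zi Zj Zk]) (auto simp: g_def w)
  note D = ok_def hge_def coeff_rules
  have "Q k" if k: "k \<in> S" for k
  proof -
    have rA: "Q k" if A: "d1 = d2" "d1 \<le> fi" "d1 \<le> fj" "d1 \<le> fk" "d1 = fi \<or> d1 = fj \<or> d1 = fk"
    proof -
      have a: "ok (mon fi) 0 0" "ok 0 (mon fj) 0" "ok 0 0 (mon fk)"
        using A h t by (auto simp: D)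
      have k3: "Q 3"
        using A(5) W3[OF a(1)] W3[OF a(2)] W3[OF a(3)] by (auto simp: coeff_rules)
      have k4: "Q 4"
        using A(1,5) W4[OF a(1)] W4[OF a(2)] W4[OF a(3)] h t by (auto simp: coeff_rules split: if_splits)
      show ?thesis using k k3 k4 W0[OF a(1)] W1[OF a(2)] W2[OF a(3)] by (auto simp: S_def coeff_rules)
    qed
    \<comment> \<open>Here \<open>d1\<close> is the minimum. \<open>Zk\<close> is solved from the
      last form, so that this form vanishes for the first two triples and the sum starts at
      \<open>h + fi\<close> or \<open>h + \<tau> + fj\<close>.\<close>
    have rB1: "Q k" if B1: "fk \<le> fi" "fk \<le> fj" "fk \<le> d1" "fk \<le> d2" "fi = fk \<or> fj = fk" "d1 \<le> d2" "d1 \<le> h + fi" "d1 \<le> h + \<tau> + fj" "d1 = d2 \<or> d1 = h + fi \<or> d1 = h + \<tau> + fj"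
    proof -
      have a: "ok (mon fi) 0 (- mon (h + fi) - mon fi)"
         "ok 0 (mon fj) (- monomial 2 (h + \<tau> + fj) - mon fj)" "ok 0 0 (mon d2)"
        using B1(1-8) h t by (auto simp: D)
      have q0: "Q 0" using W0[OF a(1)] B1 h t by (auto simp: coeff_rules split: if_splits)
      have q1: "Q 1" using W1[OF a(2)] B1 h t by (auto simp: coeff_rules split: if_splits)
      have q2: "Q 2" using W2[OF a(1)] W2[OF a(2)] B1 h t by (auto simp: coeff_rules split: if_splits)
      have q3: "Q 3" using W3[OF a(1)] W3[OF a(2)] W3[OF a(3)] B1 h t by (auto simp: coeff_rules split: if_splits)
      have q4: "Q 4" using W4[OF a(3)] B1 h t by (auto simp: coeff_rules split: if_splits)
      show ?thesis using k q0 q1 q2 q3 q4 by (auto simp: S_def)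
    qed
    \<comment> \<open>Here \<open>d2\<close> is the minimum, and \<open>Zk\<close> makes the plain
      sum vanish instead.\<close>
    have rB2: "Q k" if B2: "fk \<le> fi" "fk \<le> fj" "fk \<le> d1" "fk \<le> d2" "fi = fk \<or> fj = fk" "d2 \<le> d1" "d2 \<le> h + fi" "d2 \<le> h + \<tau> + fj" "d2 = d1 \<or> d2 = h + fi \<or> d2 = h + \<tau> + fj"
    proof -
      have a: "ok (mon fi) 0 (- mon fi)" "ok 0 (mon fj) (- mon fj)" "ok 0 0 (mon d1)"
        using B2(1-8) h t by (auto simp: D)
      have q0: "Q 0" using W0[OF a(1)] B2 h t by (auto simp: coeff_rules split: if_splits)
      have q1: "Q 1" using W1[OF a(2)] B2 h t by (auto simp: coeff_rules split: if_splits)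
      have q2: "Q 2" using W2[OF a(1)] W2[OF a(2)] B2 h t by (auto simp: coeff_rules split: if_splits)
      have q3: "Q 3" using W3[OF a(3)] B2 h t by (auto simp: coeff_rules split: if_splits)
      have q4: "Q 4" using W4[OF a(1)] W4[OF a(2)] W4[OF a(3)] B2 h t by (auto simp: coeff_rules split: if_splits)
      show ?thesis using k q0 q1 q2 q3 q4 by (auto simp: S_def)
    qed
    have rB3: "Q k" if B3: "fk \<le> fj" "fk \<le> d1" "fk \<le> d2" "fj = fk" "fi = \<tau> + fj" "h + fi \<le> d1" "h + fi \<le> d2"
    proof -
      \<comment> \<open>The two perturbation terms have equal valuation and cancel each other for
        the first triple; the other two triples have \<open>Zj = 0\<close> and make exactly one of
        the two forms nonzero.\<close>
      have a: "ok (- monomial 2 fi) (mon fj) (monomial 2 fi - mon fj)"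
        "ok (- mon (d1 - h)) 0 (mon (d1 - h) + mon d1)" "ok (mon (d2 - h)) 0 (- mon (d2 - h))"
        using B3 h t by (auto simp: D)
      have q0: "Q 0" using W0[OF a(1)] B3 h t by (auto simp: coeff_rules split: if_splits)
      have q1: "Q 1" using W1[OF a(1)] B3 h t by (auto simp: coeff_rules split: if_splits)
      have q2: "Q 2" using W2[OF a(1)] B3 h t by (auto simp: coeff_rules split: if_splits)
      have q3: "Q 3" using W3[OF a(2)] B3 h t by (auto simp: coeff_rules split: if_splits)
      have q4: "Q 4" using W4[OF a(3)] B3 h t by (auto simp: coeff_rules split: if_splits)
      show ?thesis using k q0 q1 q2 q3 q4 by (auto simp: S_def)
    qed
    have rC1: "Q k" if C1: "fi = fj" "fi < fk" "fi \<le> d1" "fi \<le> d2" "d2 \<le> d1" "d2 \<le> h + fi" "d2 = d1 \<or> d2 = h + fi"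
    proof -
      have a: "ok (mon fi) (- mon fi) 0" "ok 0 (mon d1) 0" "ok 0 (- mon fk) (mon fk)"
        using C1 h t by (auto simp: D)
      have q0: "Q 0" using W0[OF a(1)] C1 h t by (auto simp: coeff_rules split: if_splits)
      have q1: "Q 1" using W1[OF a(1)] C1 h t by (auto simp: coeff_rules split: if_splits)
      have q2: "Q 2" using W2[OF a(3)] C1 h t by (auto simp: coeff_rules split: if_splits)
      have q3: "Q 3" using W3[OF a(2)] C1 h t by (auto simp: coeff_rules split: if_splits)
      have q4: "Q 4" using W4[OF a(1)] W4[OF a(2)] C1 h t by (auto simp: coeff_rules split: if_splits)
      show ?thesis using k q0 q1 q2 q3 q4 by (auto simp: S_def)
    qed
    have rC2: "Q k" if C2: "fi = fj" "fi < fk" "fi \<le> d1" "fi \<le> d2" "d1 \<le> d2" "d1 = h + fi"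
    proof -
      \<comment> \<open>The first triple is killed by the last form, and its sum is
        \<open>2 t^(h+\<tau>+fi) - t^(h+fi)\<close>. The factor 2 keeps this of valuation
        \<open>h + fi\<close> even for \<open>\<tau> = 0\<close>.\<close>
      have a: "ok (mon fi + monomial 2 (h + \<tau> + fi)) (- mon fi - mon (h + fi)) 0"
         "ok 0 (- mon fk) (mon fk + monomial 2 (h + \<tau> + fk))" "ok 0 (mon d2) 0"
        using C2 h t by (auto simp: D)
      have q0: "Q 0" using W0[OF a(1)] C2 h t by (auto simp: coeff_rules split: if_splits)
      have q1: "Q 1" using W1[OF a(1)] C2 h t by (auto simp: coeff_rules split: if_splits)
      have q2: "Q 2" using W2[OF a(2)] C2 h t by (auto simp: coeff_rules split: if_splits)
      have q3: "Q 3" using W3[OF a(1)] C2 h t by (auto simp: coeff_rules split: if_splits)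
      have q4: "Q 4" using W4[OF a(3)] C2 h t by (auto simp: coeff_rules split: if_splits)
      show ?thesis using k q0 q1 q2 q3 q4 by (auto simp: S_def)
    qed
    have rB: "Q k" if B: "fk \<le> fi" "fk \<le> fj" "fk \<le> d1" "fk \<le> d2" "fi = fk \<or> fj = fk"
      "min_twice4 d1 d2 (h + fi) (h + \<tau> + fj)"
    proof -
      have "fi = \<tau> + fj \<Longrightarrow> fj = fk" using B(1,2,5) t by auto
      then show ?thesis
        using B(6) unfolding min_twice4_def
        by (elim disjE conjE) ((rule rB1; use B(1-5) in simp; fail)
          | (rule rB2; use B(1-5) in simp; fail) | (rule rB3; use B(1-5) in simp; fail))+
    qed
    have rC: "Q k" if C: "fi = fj" "fi < fk" "fi \<le> d1" "fi \<le> d2" "min_twice3 d1 d2 (h + fi)"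
      using C(5) unfolding min_twice3_def
      by (elim disjE conjE) ((rule rC1; use C(1-4) in simp; fail) | (rule rC2; use C(1-4) in simp; fail))+
    show ?thesis using c rA rB rC by blast
  qed
  moreover have "P (\<lambda>k. f k + monomial x 0 * g k)" if "P f" "P g" for f g x
    using that unfolding P_def by (simp add: algebra_simps)
  moreover have "P (\<lambda>_. 0)" unfolding P_def by simp
  moreover have "finite S" by (simp add: S_def)
  ultimately obtain f where f: "P f" "\<forall>l\<in>S. hahn_deg (f l) = ereal (w l)"
    using generic_lift[of P S w] unfolding Q_def by blast
  then show ?thesis
    unfolding S_def P_def by (intro exI[of _ "f 0"] exI[of _ "f 1"] exI[of _ "f 2"]) (simp add: w)
qed

text \<open>Lifts a column of \<open>C2\<close> on which \<open>r5\<close> and \<open>r6\<close>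
  vanish; \<open>x1\<close>, \<open>y3\<close>, \<open>y4\<close> are its entries in the rows
  \<open>p1\<close>, \<open>r3\<close> and \<open>r4\<close>, and the second form is row
  \<open>p2\<close>. As \<open>x1\<close> has positive valuation, the last two forms are units as
  soon as \<open>y4 * c + y3 * al\<close> and its primed analogue are.\<close>

lemma hyperplane_lift:
  fixes D1 D2 F3 F4 h \<tau> :: real
  assumes h: "h \<ge> 0" and t: "\<tau> \<ge> 0" and D: "D1 > 0" "D2 > 0"
    and F: "(F3 > 0 \<and> F4 = 0) \<or> (F3 = 0 \<and> F4 > 0 \<and> coeff al 0 \<noteq> 0 \<and> coeff al' 0 \<noteq> 0) \<or> (F3 = 0 \<and> F4 = 0)"
    and c: "hge c 0" "coeff c 0 \<noteq> 0" "coeff c 0 \<noteq> 5 * coeff al 0"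
    and c': "hge c' 0" "coeff c' 0 \<noteq> 0" "coeff c' 0 \<noteq> 5 * coeff al' 0"
    and al: "hge al 0" "hge al' 0" and be: "hge be 0" "hge be' 0"
    and tw: "min_twice4 D1 D2 (h + F3) (h + \<tau> + F4)"
  shows "\<exists>x1 y3 y4. hahn_deg x1 = ereal D1 \<and> hahn_deg (x1 + mon h * y3 + monomial 5 (h + \<tau>) * y4) = ereal D2 \<and>
    hahn_deg y3 = ereal F3 \<and> hahn_deg y4 = ereal F4 \<and>
    hahn_deg (y4 * c + y3 * al + x1 * be) = ereal 0 \<and> hahn_deg (y4 * c' + y3 * al' + x1 * be') = ereal 0"
proof -
  define P where "P f \<longleftrightarrow> f 3 = f 0 + mon h * f 1 + monomial 5 (h + \<tau>) * f 2 \<and>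
    f 4 = f 2 * c + f 1 * al + f 0 * be \<and> f 5 = f 2 * c' + f 1 * al' + f 0 * be'"
    for f :: "nat \<Rightarrow> hahn"
  define w where "w n = (if n = 0 then D1 else if n = 1 then F3 else if n = 2 then F4
    else if n = 3 then D2 else 0 :: real)" for n :: nat
  have w: "w 0 = D1" "w 1 = F3" "w (Suc 0) = F3" "w 2 = F4" "w 3 = D2" "w 4 = 0" "w 5 = 0" by (simp_all add: w_def)
  define S where "S = {0, 1, 2, 3, 4, 5 :: nat}"
  define g where "g x1 y3 y4 n = (if n = 0 then x1 else if n = 1 then y3 else if n = 2 then y4
    else if n = 3 then x1 + mon h * y3 + monomial 5 (h + \<tau>) * y4
    else if n = 4 then y4 * c + y3 * al + x1 * be else y4 * c' + y3 * al' + x1 * be' :: hahn)"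
    for x1 y3 y4 and n :: nat
  define ok where "ok x1 y3 y4 \<longleftrightarrow> hge x1 D1 \<and> hge y3 F3 \<and> hge y4 F4 \<and>
    hge (x1 + mon h * y3 + monomial 5 (h + \<tau>) * y4) D2" for x1 y3 y4
  define Q where "Q k \<longleftrightarrow> (\<exists>f. P f \<and> (\<forall>l\<in>S. hge (f l) (w l)) \<and> coeff (f k) (w k) \<noteq> 0)" for k
  have F0: "F3 \<ge> 0" "F4 \<ge> 0" using F by auto
  have W: "Q k" if o: "ok x1 y3 y4" "coeff (g x1 y3 y4 k) (w k) \<noteq> 0" for x1 y3 y4 and k :: nat
  proof -
    have "hge x1 0" "hge y3 0" "hge y4 0" 
      using o(1) D F0 unfolding ok_def by (meson hge_mono less_imp_le)+
    then have "hge (y4 * c + y3 * al + x1 * be) 0" "hge (y4 * c' + y3 * al' + x1 * be') 0"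
      using c c' al be by (auto intro!: hge_add hge_mult'[of _ 0 _ 0])
    then show ?thesis
      unfolding Q_def using o by (intro exI[of _ "g x1 y3 y4"]) (simp add: P_def S_def ok_def w g_def)
  qed
  have W0: "Q 0" if "ok x1 y3 y4" "coeff x1 D1 \<noteq> 0" for x1 y3 y4
    using that by (intro W[of x1 y3 y4]) (auto simp: g_def w)
  have W1: "Q 1" if "ok x1 y3 y4" "coeff y3 F3 \<noteq> 0" for x1 y3 y4
    using that by (intro W[of x1 y3 y4]) (auto simp: g_def w)
  have W2: "Q 2" if "ok x1 y3 y4" "coeff y4 F4 \<noteq> 0" for x1 y3 y4
    using that by (intro W[of x1 y3 y4]) (auto simp: g_def w)
  have W3: "Q 3" if "ok x1 y3 y4" "coeff (x1 + mon h * y3 + monomial 5 (h + \<tau>) * y4) D2 \<noteq> 0" for x1 y3 y4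
    using that by (intro W[of x1 y3 y4]) (auto simp: g_def w)
  have W4: "Q 4" if "ok x1 y3 y4" "coeff (y4 * c + y3 * al + x1 * be) 0 \<noteq> 0" for x1 y3 y4
    using that by (intro W[of x1 y3 y4]) (auto simp: g_def w)
  have W5: "Q 5" if "ok x1 y3 y4" "coeff (y4 * c' + y3 * al' + x1 * be') 0 \<noteq> 0" for x1 y3 y4
    using that by (intro W[of x1 y3 y4]) (auto simp: g_def w)
  note D' = ok_def hge_def coeff_rules
  have z: "e < 0 \<Longrightarrow> coeff x e = 0" if "x \<in> {c, c', al, al', be, be'}" for x e
    using that c c' al be unfolding hge_def by auto
  note F' = h t D F c(2,3) c'(2,3)
  have "Q k" if k: "k \<in> S" for k
  proof -
    have r1: "Q k" if A: "D2 \<le> D1" "D2 \<le> h + F3" "D2 \<le> h + \<tau> + F4" "D2 = D1 \<or> D2 = h + F3 \<or> D2 = h + \<tau> + F4"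
    proof -
      have a: "ok (mon D1) 0 0" "ok 0 (mon F3) 0" "ok 0 0 (mon F4)" using A h t by (auto simp: D')
      have "Q 0" "Q 1" "Q 2" using W0[OF a(1)] W1[OF a(2)] W2[OF a(3)] by (auto simp: coeff_rules)
      moreover have "Q 3" using W3[OF a(1)] W3[OF a(2)] W3[OF a(3)] A by (auto simp: coeff_rules)
      moreover have "Q 4" using W4[OF a(2)] W4[OF a(3)] F' by (auto simp: coeff_rules)
      moreover have "Q 5" using W5[OF a(2)] W5[OF a(3)] F' by (auto simp: coeff_rules)
      ultimately show ?thesis using k by (auto simp: S_def)
    qed
    have r2: "Q k" if A: "D1 \<le> D2" "D1 \<le> h + F3" "D1 \<le> h + \<tau> + F4" "D1 = D2 \<or> D1 = h + F3 \<or> D1 = h + \<tau> + F4"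
    proof -
      have a: "ok (mon D2) 0 0" "ok (monomial (-1) (h + F3)) (mon F3) 0"
         "ok (monomial (-5) (h + \<tau> + F4)) 0 (mon F4)" using A h t by (auto simp: D')
      have "Q 3" "Q 1" "Q 2" using W3[OF a(1)] W1[OF a(2)] W2[OF a(3)] by (auto simp: coeff_rules)
      moreover have "Q 0" using W0[OF a(1)] W0[OF a(2)] W0[OF a(3)] A by (auto simp: coeff_rules)
      moreover have "Q 4" using W4[OF a(2)] W4[OF a(3)] F' A z by (auto simp: coeff_rules)
      moreover have "Q 5" using W5[OF a(2)] W5[OF a(3)] F' A z by (auto simp: coeff_rules)
      ultimately show ?thesis using k by (auto simp: S_def)
    qed
    have r3: "Q k" if A: "F3 = \<tau> + F4" "h + F3 \<le> D1" "h + F3 \<le> D2"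
    proof -
      \<comment> \<open>The first triple cancels the two lower terms in row \<open>p2\<close>. If
        \<open>F3 = F4 = 0\<close>, the row \<open>r5\<close> then starts with
        \<open>c0 - 5 * a0\<close>, where \<open>c0\<close>, \<open>a0\<close> are the leading
        coefficients of \<open>c\<close>, \<open>al\<close>: this is the origin of the inequality
        between them.\<close>
      have a: "ok 0 (monomial (-5) F3) (mon F4)" "ok (mon D1) (monomial (-1) (D1 - h)) 0"
         "ok 0 (mon (D2 - h)) 0" using A h t by (auto simp: D')
      have "Q 0" "Q 1" "Q 2" "Q 3"
        using W0[OF a(2)] W1[OF a(1)] W2[OF a(1)] W3[OF a(3)] by (auto simp: coeff_rules)
      moreover have "Q 4" using W4[OF a(1)] F' A z by (auto simp: coeff_rules)
      moreover have "Q 5" using W5[OF a(1)] F' A z by (auto simp: coeff_rules)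
      ultimately show ?thesis using k by (auto simp: S_def)
    qed
    show ?thesis
      using tw unfolding min_twice4_def
      by (elim disjE conjE) ((rule r1; simp; fail) | (rule r2; simp; fail) | (rule r3; simp; fail))+
  qed
  moreover have "P (\<lambda>k. f k + monomial x 0 * g k)" if "P f" "P g" for f g x
    using that unfolding P_def by (simp add: algebra_simps)
  moreover have "P (\<lambda>_. 0)" unfolding P_def by simp
  moreover have "finite S" by (simp add: S_def)
  ultimately obtain f where f: "P f" "\<forall>l\<in>S. hahn_deg (f l) = ereal (w l)"
    using generic_lift[of P S w] unfolding Q_def by blast
  then show ?thesis
    unfolding S_def P_def by (intro exI[of _ "f 0"] exI[of _ "f 1"] exI[of _ "f 2"]) (simp add: w)
qed

text \<open>The coefficient may be 0, in which case the valuation exceeds \<open>r\<close>. This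
  makes the notion additive and multiplicative without case distinctions.\<close>

definition lead :: "hahn \<Rightarrow> real \<Rightarrow> complex \<Rightarrow> bool" where
  "lead x r c \<longleftrightarrow> hge x r \<and> coeff x r = c"

lemma lead_add: "lead x r a \<Longrightarrow> lead y r b \<Longrightarrow> lead (x + y) r (a + b)"
  by (auto simp: lead_def hge_add plus_hahn.rep_eq)
lemma lead_diff: "lead x r a \<Longrightarrow> lead y r b \<Longrightarrow> lead (x - y) r (a - b)"
  by (auto simp: lead_def hge_diff minus_hahn.rep_eq)
lemma lead_uminus: "lead x r a \<Longrightarrow> lead (- x) r (- a)"
  by (auto simp: lead_def hge_uminus uminus_hahn.rep_eq)
lemma lead_mult: "lead x r a \<Longrightarrow> lead y s b \<Longrightarrow> lead (x * y) (r + s) (a * b)"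
  by (auto simp: lead_def hge_mult coeff_mult_lead)
lemma lead_less: "hge x s \<Longrightarrow> r < s \<Longrightarrow> lead x r 0"
  by (auto simp: lead_def hge_mono hge_coeff_zero)
lemma lead_monomial: "lead (monomial a r) r a"
  by (auto simp: lead_def hge_mon monomial.rep_eq)
lemma lead_hge: "lead x r a \<Longrightarrow> s \<le> r \<Longrightarrow> hge x s"
  by (auto simp: lead_def hge_mono)
lemma lead_coeff: "lead x r a \<Longrightarrow> coeff x r = a"
  by (auto simp: lead_def)

text \<open>Lifts a column of \<open>C2\<close> with a positive entry \<open>s\<close> in
  \<open>r5\<close>; exchanging the primed data gives \<open>r6\<close>. Positivity of
  \<open>s\<close> forces the leading coefficients of \<open>y3\<close>, \<open>y4\<close> to be
  proportional to \<open>c0\<close>, \<open>- a0\<close>, so the other row starts with a multiple of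
  \<open>c0 * a1 - c1 * a0\<close>. Hence this determinant and \<open>a0\<close> must not
  vanish.\<close>

lemma hyperplane_lift':
  fixes D1 D2 s h \<tau> :: real
  assumes h: "h \<ge> 0" and t: "\<tau> \<ge> 0" and D: "D1 > 0" "D2 > 0" and s: "s > 0"
    and c: "lead c 0 c0" "lead al 0 a0" "lead be 0 0" 
    and c': "lead c' 0 c1" "lead al' 0 a1" "lead be' 0 0"
    and nz: "c0 \<noteq> 0" "a0 \<noteq> 0" "c0 * a1 \<noteq> c1 * a0" "c0 \<noteq> 5 * a0"
    and tw: "min_twice3 D1 D2 h"
  shows "\<exists>x1 y3 y4. hahn_deg x1 = ereal D1 \<and> hahn_deg (x1 + mon h * y3 + monomial 5 (h + \<tau>) * y4) = ereal D2 \<and>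
    hahn_deg y3 = ereal 0 \<and> hahn_deg y4 = ereal 0 \<and>
    hahn_deg (y4 * c + y3 * al + x1 * be) = ereal s \<and> hahn_deg (y4 * c' + y3 * al' + x1 * be') = ereal 0"
proof -
  define A where "A = mon h"
  define B where "B = monomial 5 (h + \<tau>)"
  define P where "P f \<longleftrightarrow> f 3 = f 0 + A * f 1 + B * f 2 \<and>
    f 4 = f 2 * c + f 1 * al + f 0 * be \<and> f 5 = f 2 * c' + f 1 * al' + f 0 * be'"
    for f :: "nat \<Rightarrow> hahn"
  define w where "w n = (if n = 0 then D1 else if n = 3 then D2 else if n = 4 then s else 0 :: real)" for n :: nat
  have w: "w 0 = D1" "w 1 = 0" "w (Suc 0) = 0" "w 2 = 0" "w 3 = D2" "w 4 = s" "w 5 = 0" by (simp_all add: w_def)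
  define S where "S = {0, 1, 2, 3, 4, 5 :: nat}"
  define g where "g x1 y3 y4 n = (if n = 0 then x1 else if n = 1 then y3 else if n = 2 then y4
    else if n = 3 then x1 + A * y3 + B * y4
    else if n = 4 then y4 * c + y3 * al + x1 * be else y4 * c' + y3 * al' + x1 * be' :: hahn)"
    for x1 y3 y4 and n :: nat
  define ok where "ok x1 y3 y4 \<longleftrightarrow> hge x1 D1 \<and> hge y3 0 \<and> hge y4 0 \<and>
    hge (x1 + A * y3 + B * y4) D2 \<and> hge (y4 * c + y3 * al + x1 * be) s" for x1 y3 y4
  define Q where "Q k \<longleftrightarrow> (\<exists>f. P f \<and> (\<forall>l\<in>S. hge (f l) (w l)) \<and> coeff (f k) (w k) \<noteq> 0)" for k
  have W: "Q k" if o: "ok x1 y3 y4" "coeff (g x1 y3 y4 k) (w k) \<noteq> 0" for x1 y3 y4 and k :: nat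
  proof -
    have "hge x1 0" "hge y3 0" "hge y4 0" 
      using o(1) D unfolding ok_def by (meson hge_mono less_imp_le)+
    then have "hge (y4 * c' + y3 * al' + x1 * be') 0"
      using c' by (auto intro!: hge_add hge_mult'[of _ 0 _ 0] simp: lead_def)
    then show ?thesis
      unfolding Q_def using o by (intro exI[of _ "g x1 y3 y4"]) (simp add: P_def S_def ok_def w g_def)
  qed
  have W0: "Q 0" if "ok x1 y3 y4" "coeff x1 D1 \<noteq> 0" for x1 y3 y4
    using that by (intro W[of x1 y3 y4]) (auto simp: g_def w)
  have W1: "Q 1" if "ok x1 y3 y4" "coeff y3 0 \<noteq> 0" for x1 y3 y4
    using that by (intro W[of x1 y3 y4]) (auto simp: g_def w)
  have W2: "Q 2" if "ok x1 y3 y4" "coeff y4 0 \<noteq> 0" for x1 y3 y4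
    using that by (intro W[of x1 y3 y4]) (auto simp: g_def w)
  have W3: "Q 3" if "ok x1 y3 y4" "coeff (x1 + A * y3 + B * y4) D2 \<noteq> 0" for x1 y3 y4
    using that by (intro W[of x1 y3 y4]) (auto simp: g_def w)
  have W4: "Q 4" if "ok x1 y3 y4" "coeff (y4 * c + y3 * al + x1 * be) s \<noteq> 0" for x1 y3 y4
    using that by (intro W[of x1 y3 y4]) (auto simp: g_def w)
  have W5: "Q 5" if "ok x1 y3 y4" "coeff (y4 * c' + y3 * al' + x1 * be') 0 \<noteq> 0" for x1 y3 y4
    using that by (intro W[of x1 y3 y4]) (auto simp: g_def w)
  \<comment> \<open>The coefficient of \<open>B\<close> at exponent \<open>h\<close>: the term of
    \<open>B\<close> reaches this order only if \<open>\<tau> = 0\<close>.\<close>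
  define b0 :: complex where "b0 = (if \<tau> = 0 then 5 else 0)"
  have lA: "lead A h 1" unfolding A_def by (rule lead_monomial)
  have lB: "lead B h b0"
  proof (cases "\<tau> = 0")
    case True then show ?thesis unfolding B_def b0_def using lead_monomial[of 5 h] by simp
  next
    case False then show ?thesis unfolding B_def b0_def using t by (auto intro!: lead_less hge_mon)
  qed
  have nzb: "c0 - b0 * a0 \<noteq> 0" using nz by (auto simp: b0_def)
  have lbeB: "lead (be * B) 0 0"
    using lead_mult[OF c(3) lB] h by (cases "h = 0") (auto intro: lead_less lead_hge)
  have lbeA: "lead (be * A) 0 0"
    using lead_mult[OF c(3) lA] h by (cases "h = 0") (auto intro: lead_less lead_hge)
  have u: "lead (c - B * be) 0 c0" using lead_diff[OF c(1) lbeB] by (simp add: mult.commute)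
  define X where "X = (\<lambda>r. (monomial 1 r * c, 0 :: hahn, - (monomial 1 r * be)))"
  have x2X: "monomial 1 r * c + A * 0 + B * (- (monomial 1 r * be)) = monomial 1 r * (c - B * be)" for r
    by (simp add: algebra_simps)
  have lX: "lead (monomial 1 r * c) r c0" "lead (monomial 1 r * c + A * 0 + B * (- (monomial 1 r * be))) r c0" for r
    unfolding x2X using lead_mult[OF lead_monomial[of 1 r] c(1)] lead_mult[OF lead_monomial[of 1 r] u] by auto
  \<comment> \<open>With \<open>y3 = 0\<close> these entries annihilate the form for row
    \<open>r5\<close>, leaving \<open>x1\<close> and row \<open>p2\<close> both of valuation
    \<open>r\<close>.\<close>
  have okX: "ok (monomial 1 r * c) 0 (- (monomial 1 r * be))" if "r \<ge> D1" "r \<ge> D2" for r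
    unfolding ok_def
    using that lead_hge[OF lX(1), of D1 r] lead_hge[OF lX(2), of D2 r] D lead_mult[OF lead_monomial[of 1 r] c(3)]
    by (auto intro!: hge_uminus simp: algebra_simps intro: lead_hge)
  have "Q k" if k: "k \<in> S" for k
  proof -
    have r1: "Q k" if a: "D2 \<le> D1" "D2 \<le> h" "D2 = D1 \<or> D2 = h"
    proof -
      have l1: "lead (0 + A * c + B * (- al)) h (c0 - b0 * a0)"
        using lead_diff[OF lead_mult[OF lA c(1)] lead_mult[OF lB c(2)]] by (simp add: algebra_simps)
      have o1: "ok 0 c (- al)"
        unfolding ok_def using lead_hge[OF l1 a(2)] c by (auto simp: lead_def algebra_simps hge_uminus)
      have l2: "lead ((- al) * c' + c * al' + 0 * be') 0 (- a0 * c1 + c0 * a1)"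
        using lead_add[OF lead_mult[OF lead_uminus[OF c(2)] c'(1)] lead_mult[OF c(1) c'(2)]] by simp
      have l3: "lead (mon s * c) s c0" using lead_mult[OF lead_monomial[of 1 s] c(1)] by simp
      have o2: "ok 0 0 (mon s)"
      proof -
        have "hge (B * mon s) D2" 
          by (rule hge_mult'[of _ h _ s]) (use lB a s in \<open>auto simp: lead_def hge_mon\<close>)
        then show ?thesis unfolding ok_def using s lead_hge[OF l3, of s] by (auto simp: hge_mon)
      qed
      have "Q 0" using W0[OF okX[of D1]] a lead_coeff[OF lX(1)[of D1]] nz by auto
      moreover have "Q 1" using W1[OF o1] lead_coeff[OF c(1)] nz by auto
      moreover have "Q 2" using W2[OF o1] lead_coeff[OF lead_uminus[OF c(2)]] nz by auto
      moreover have "Q 3"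
        using W3[OF o1] lead_coeff[OF l1] nzb W3[OF okX[of D1]] lead_coeff[OF lX(2)[of D1]] nz a by auto
      moreover have "Q 4" using W4[OF o2] lead_coeff[OF l3] nz by simp
      moreover have "Q 5" using W5[OF o1] lead_coeff[OF l2] nz by (simp add: mult.commute)
      ultimately show ?thesis using k by (auto simp: S_def)
    qed
    have r2: "Q k" if a: "D1 \<le> D2" "D1 = h"
    proof -
      \<comment> \<open>Up to sign the cross product of the coefficient vectors of \<open>p2\<close>
        and \<open>r5\<close>, so both rows vanish on it.\<close>
      define x1 y3 y4 where "x1 = al * B - c * A" and "y3 = c - be * B" and "y4 = be * A - al"
      have lx: "lead x1 h (a0 * b0 - c0)"
        unfolding x1_def using lead_diff[OF lead_mult[OF c(2) lB] lead_mult[OF c(1) lA]] by simp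
      have ly3: "lead y3 0 c0" unfolding y3_def using lead_diff[OF c(1) lbeB] by simp
      have ly4: "lead y4 0 (- a0)" unfolding y4_def using lead_diff[OF lbeA c(2)] by simp
      have z: "x1 + A * y3 + B * y4 = 0" "y4 * c + y3 * al + x1 * be = 0"
        unfolding x1_def y3_def y4_def by (simp_all add: algebra_simps)
      have o: "ok x1 y3 y4" unfolding ok_def z using lx ly3 ly4 a by (auto simp: lead_def)
      have lx0: "lead (x1 * be') 0 0"
        by (rule lead_less[of _ h]) (use lx c'(3) a D in \<open>auto intro!: hge_mult'[of _ h _ 0] simp: lead_def\<close>)
      have l5: "lead (y4 * c' + y3 * al' + x1 * be') 0 (- a0 * c1 + c0 * a1 + 0)"
        using lead_add[OF lead_add[OF lead_mult[OF ly4 c'(1)] lead_mult[OF ly3 c'(2)]], of "x1 * be'" 0] lx0 by simp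
      have l4: "lead (mon s * c + 0 * al + - (B * mon s) * be) s c0"
        using lead_mult[OF lead_monomial[of 1 s] u] by (simp add: algebra_simps)
      have o4: "ok (- (B * mon s)) 0 (mon s)"
      proof -
        have "hge (B * mon s) D1" 
          by (rule hge_mult'[of _ h _ s]) (use lB a s in \<open>auto simp: lead_def hge_mon\<close>)
        then show ?thesis unfolding ok_def using s lead_hge[OF l4, of s] by (auto simp: hge_mon hge_uminus)
      qed
      have "Q 0" using W0[OF o] lead_coeff[OF lx] nzb a by (auto simp: mult.commute)
      moreover have "Q 1" using W1[OF o] lead_coeff[OF ly3] nz by auto
      moreover have "Q 2" using W2[OF o] lead_coeff[OF ly4] nz by auto
      moreover have "Q 3" using W3[OF okX[of D2]] lead_coeff[OF lX(2)[of D2]] nz a by auto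
      moreover have "Q 4" using W4[OF o4] lead_coeff[OF l4] nz by simp
      moreover have "Q 5" using W5[OF o] lead_coeff[OF l5] nz by (simp add: mult.commute)
      ultimately show ?thesis using k by (auto simp: S_def)
    qed
    show ?thesis
      using tw unfolding min_twice3_def
      by (elim disjE conjE) ((rule r1; simp; fail) | (rule r2; simp; fail))+
  qed
  moreover have "P (\<lambda>k. f k + monomial x 0 * g k)" if "P f" "P g" for f g x
    using that unfolding P_def by (simp add: algebra_simps)
  moreover have "P (\<lambda>_. 0)" unfolding P_def by simp
  moreover have "finite S" by (simp add: S_def)
  ultimately obtain f where f: "P f" "\<forall>l\<in>S. hahn_deg (f l) = ereal (w l)"
    using generic_lift[of P S w] unfolding Q_def by blast
  then show ?thesis
    unfolding S_def P_def A_def B_def by (intro exI[of _ "f 0"] exI[of _ "f 1"] exI[of _ "f 2"]) (simp add: w)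
qed

section \<open>Tropical lines through star configurations\<close>

text \<open>Each point bounds \<tau> from below by \<open>min (d - h) f\<close> with
  \<open>d = min d1 d2\<close>, and \<tau> is the least value allowed. Then
  \<open>h + \<tau>\<close> is never the unique minimum of the four numbers. If another entry is the
  unique minimum at \<open>u\<close>, then \<open>u\<close> together with a point attaining \<tau>
  is one of the excluded pairs.\<close>

lemma leg_fit:
  fixes f d1 d2 :: "'u \<Rightarrow> real"
  assumes fin: "finite G" "G \<noteq> {}"
    and a: "\<And>u u'. \<lbrakk>u \<in> G; u' \<in> G; d1 u \<noteq> d2 u; min (d1 u) (d2 u) < h + f u; min (d1 u) (d2 u) < h + f u';
        min (d1 u) (d2 u) < min (d1 u') (d2 u')\<rbrakk> \<Longrightarrow> False"
    and b: "\<And>u u'. \<lbrakk>u \<in> G; u' \<in> G; f u < f u'; h + f u < min (d1 u) (d2 u); h + f u < min (d1 u') (d2 u')\<rbrakk> \<Longrightarrow> False"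
    and \<tau>: "\<tau> = Max ((\<lambda>u. min (min (d1 u) (d2 u) - h) (f u)) ` G)"
    and u: "u \<in> G"
  shows "min_twice4 (d1 u) (d2 u) (h + f u) (h + \<tau>)"
proof -
  have L: "min (min (d1 u) (d2 u) - h) (f u) \<le> \<tau>"
    unfolding \<tau> using fin u by simp
  obtain v where v: "v \<in> G" "\<tau> = min (min (d1 v) (d2 v) - h) (f v)"
    using Max_in[of "(\<lambda>u. min (min (d1 u) (d2 u) - h) (f u)) ` G"] fin unfolding \<tau> by blast
  show ?thesis
    using a[OF u v(1)] b[OF u v(1)] L v(2) unfolding min_twice4_def by (smt (verit))
qed

text \<open>The point \<open>u\<close> lies on the ray \<open>i\<close> at distance \<open>f i u > 0\<close> from the centre, or at the centre; \<open>d1 u\<close>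
  and \<open>d2 u\<close> are its entries in the two rows that are compared, and their minimum \<open>d u\<close> is a lower bound for the height
  of the point on a line that is still to be found, exact unless \<open>d1 u = d2 u\<close>. The line leaves the star at distance
  \<open>\<tau>\<close> on some ray, or at the centre, and has height \<open>h\<close> at the centre.\<close>

lemma star_fit:
  fixes f :: "'i \<Rightarrow> 'u \<Rightarrow> real" and d d1 d2 :: "'u \<Rightarrow> real"
  assumes d: "\<And>u. d u = min (d1 u) (d2 u)"
    and fin: "finite U"
    and nn: "\<And>u. u \<in> U \<Longrightarrow> d u \<ge> 0"
    and one: "\<And>u i j. u \<in> U \<Longrightarrow> i \<in> I \<Longrightarrow> j \<in> I \<Longrightarrow> f i u > 0 \<Longrightarrow> f j u > 0 \<Longrightarrow> i = j"
    and H1: "\<And>i v w x. \<lbrakk>i \<in> I; v \<in> U; w \<in> U; x \<in> U; d1 v \<noteq> d2 v; \<not> f i v > 0; f i w > 0; \<not> f i x > 0;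
        d v < d w; d v < d x\<rbrakk> \<Longrightarrow> False"
    and H2a: "\<And>i v u u'. \<lbrakk>i \<in> I; v \<in> U; u \<in> U; u' \<in> U; \<not> f i v > 0; f i u > 0; f i u' > 0; d1 u \<noteq> d2 u;
        d u < d v + f i u; d u < d v + f i u'; d u < d u'\<rbrakk> \<Longrightarrow> False"
    and H2b: "\<And>i v u u'. \<lbrakk>i \<in> I; v \<in> U; u \<in> U; u' \<in> U; \<not> f i v > 0; d1 v \<noteq> d2 v; f i u > 0; f i u < f i u';
        d v + f i u < d u; d v + f i u < d u'\<rbrakk> \<Longrightarrow> False"
    and H5: "\<And>i u x y. \<lbrakk>i \<in> I; u \<in> U; x \<in> U; y \<in> U; u \<noteq> x; u \<noteq> y; x \<noteq> y; f i u > 0; f i x > 0; f i y > 0; d1 u \<noteq> d2 u;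
        d u + f i x < d u + f i y; d u + f i x < d x + f i u; d u + f i x < d x + f i y;
        d u + f i x < d y + f i x; d u + f i x < d y + f i u;
        d u + f i x < d u + d x; d u + f i x < d u + d y; d u + f i x < d x + d y\<rbrakk> \<Longrightarrow> False"
    and H6: "\<And>i u u'. \<lbrakk>i \<in> I; u \<in> U; u' \<in> U; f i u > 0; f i u' > 0; d1 u \<noteq> d2 u;
        d u < d u'; d u < f i u; d u < f i u'\<rbrakk> \<Longrightarrow> False"
  shows "\<exists>h\<ge>0. (\<forall>u\<in>U. if \<exists>i\<in>I. f i u > 0 then (d1 u \<noteq> d2 u \<longrightarrow> d u = h) \<and> (d1 u = d2 u \<longrightarrow> d u \<le> h)
        else (d1 u \<noteq> d2 u \<longrightarrow> h \<le> d u)) \<or>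
    (\<exists>i\<in>I. (\<exists>u\<in>U. f i u > 0) \<and> (\<exists>\<tau>>0. \<forall>u\<in>U. if f i u > 0 then min_twice4 (d1 u) (d2 u) (h + f i u) (h + \<tau>)
        else (d1 u \<noteq> d2 u \<longrightarrow> d u = h) \<and> (d1 u = d2 u \<longrightarrow> d u \<le> h)))"
    (is "\<exists>h\<ge>0. ?cen h \<or> ?leg h")
proof (cases "\<exists>v\<in>U. d1 v \<noteq> d2 v")
  case False
  define h where "h = Max (insert 0 (d ` U))"
  have "h \<ge> 0" "\<And>u. u \<in> U \<Longrightarrow> d u \<le> h" using fin by (auto simp: h_def)
  then show ?thesis using False by (intro exI[of _ h]) auto
next
  case True
  define Str where "Str = {v \<in> U. d1 v \<noteq> d2 v}"
  have Str: "finite Str" "Str \<noteq> {}" using True fin by (auto simp: Str_def)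
  \<comment> \<open>The height is exact at points with \<open>d1 \<noteq> d2\<close>, so the lowest
    of them suggests the height of the centre. This is enough unless a point on some ray is
    higher.\<close>
  define m where "m = Min (d ` Str)"
  have m_le: "m \<le> d v" if "v \<in> U" "d1 v \<noteq> d2 v" for v using that Str by (auto simp: m_def Str_def)
  obtain v0 where v0: "v0 \<in> U" "d1 v0 \<noteq> d2 v0" "d v0 = m"
  proof -
    have "m \<in> d ` Str" unfolding m_def using Str by simp
    then show ?thesis using that unfolding Str_def by auto
  qed
  have m0: "m \<ge> 0" using nn v0 by force
  show ?thesis
  proof (cases "\<exists>w\<in>U. \<exists>i\<in>I. f i w > 0 \<and> m < d w")
    case False
    then have "?cen m" using m_le by (smt (verit, best))
    then show ?thesis using m0 by blast
  next
    case True
    have fits: ?thesis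
      if h: "h \<ge> 0" and i: "i \<in> I" and w: "w \<in> U" "f i w > 0" "h < d w"
        and off: "\<And>u. u \<in> U \<Longrightarrow> \<not> f i u > 0 \<Longrightarrow> (d1 u \<noteq> d2 u \<longrightarrow> d u = h) \<and> (d1 u = d2 u \<longrightarrow> d u \<le> h)"
        and a: "\<And>u u'. \<lbrakk>u \<in> U; u' \<in> U; f i u > 0; f i u' > 0; d1 u \<noteq> d2 u; d u < h + f i u; d u < h + f i u'; d u < d u'\<rbrakk> \<Longrightarrow> False"
        and b: "\<And>u u'. \<lbrakk>u \<in> U; u' \<in> U; f i u > 0; f i u < f i u'; h + f i u < d u; h + f i u < d u'\<rbrakk> \<Longrightarrow> False"
      for h i w
    proof -
      define G where "G = {u \<in> U. f i u > 0}"
      define \<tau> where "\<tau> = Max ((\<lambda>u. min (min (d1 u) (d2 u) - h) (f i u)) ` G)"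
      have G: "finite G" "G \<noteq> {}" "w \<in> G" using fin w by (auto simp: G_def)
      have "min (min (d1 w) (d2 w) - h) (f i w) \<le> \<tau>" unfolding \<tau>_def using G by simp
      then have t: "\<tau> > 0" using w d[of w] by (simp split: if_splits add: min_def)
      have "min_twice4 (d1 u) (d2 u) (h + f i u) (h + \<tau>)" if "u \<in> G" for u
        by (rule leg_fit[OF G(1,2) _ _ \<tau>_def that]) (use a b in \<open>auto simp: G_def d\<close>)
      then have "?leg h" using off i w t unfolding G_def by (intro bexI[of _ i] conjI exI[of _ \<tau>]) auto
      then show ?thesis using h by blast
    qed
    from True obtain w i where w: "w \<in> U" "i \<in> I" "f i w > 0" "m < d w" by blast
    show ?thesis
    \<comment> \<open>If some lowest exact point lies off the ray of a higher point, it fixes the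
      height of the centre to be \<open>m\<close>. Otherwise all lowest exact points lie on one ray,
      and the height of the centre has to be found from the points on that ray.\<close>
    proof (cases "\<exists>w v i. w \<in> U \<and> i \<in> I \<and> f i w > 0 \<and> m < d w \<and> v \<in> U \<and> d1 v \<noteq> d2 v \<and> d v = m \<and> \<not> f i v > 0")
      case True
      then obtain w v i where w: "w \<in> U" "i \<in> I" "f i w > 0" "m < d w" "v \<in> U" "d1 v \<noteq> d2 v" "d v = m" "\<not> f i v > 0"
        by blast
      show ?thesis
      proof (rule fits[OF m0 w(2,1,3,4)])
        show "(d1 u \<noteq> d2 u \<longrightarrow> d u = m) \<and> (d1 u = d2 u \<longrightarrow> d u \<le> m)" if "u \<in> U" "\<not> f i u > 0" for u
          using H1[OF w(2,5,1) that(1) w(6,8,3) that(2)] w m_le[OF that(1)] by fastforce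
      qed (use H2a[OF w(2,5)] H2b[OF w(2,5)] w in auto)
    next
      case False
      then have leg: "f i v > 0" if "v \<in> U" "d1 v \<noteq> d2 v" "d v = m" for v using w that by blast
      have v0i: "f i v0 > 0" using leg v0 by blast
      have tie: "d1 v = d2 v" if v: "v \<in> U" "\<not> f i v > 0" for v
      proof (rule ccontr)
        assume s: "d1 v \<noteq> d2 v"
        then have "m < d v" using leg m_le v by force
        then show False
          using H2a[OF w(2) v(1) v0(1) w(1) v(2) v0i w(3) v0(2)] v0 v0i w by simp
      qed
      define O' where "O' = {v \<in> U. \<not> f i v > 0}"
      \<comment> \<open>Off the ray only upper bounds remain, so every height from \<open>h0\<close>
        on is admissible there. The value 0 inserted here belongs to no point; this is why
        \<open>H6\<close>, the analogue of \<open>H2a\<close> for height 0, is needed.\<close>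
      define h0 where "h0 = Max (insert 0 (d ` O'))"
      have h0: "h0 \<ge> 0" "\<And>v. v \<in> O' \<Longrightarrow> d v \<le> h0" using fin by (auto simp: h0_def O'_def)
      have c1: False if "u \<in> U" "u' \<in> U" "f i u > 0" "f i u' > 0" "d1 u \<noteq> d2 u" "d u < h0 + f i u" "d u < h0 + f i u'" "d u < d u'"
        for u u'
      proof (cases "h0 = 0")
        case True
        then show ?thesis using H6[OF w(2) that(1-5)] that by simp
      next
        case False
        then have "h0 \<in> d ` O'" using Max_in[of "insert 0 (d ` O')"] fin by (auto simp: h0_def O'_def)
        then obtain v where "v \<in> U" "\<not> f i v > 0" "h0 = d v" by (auto simp: O'_def)
        then show ?thesis using H2a[OF w(2) _ that(1,2) _ that(3-5)] that by simp
      qed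
      \<comment> \<open>The largest height satisfying condition \<open>a\<close> is taken. The pair
        attaining it supplies the third point with which a violation of condition \<open>b\<close>
        contradicts \<open>H5\<close>.\<close>
      define S where "S = {(u, u'). u \<in> U \<and> u' \<in> U \<and> f i u > 0 \<and> f i u' > 0 \<and> d1 u \<noteq> d2 u \<and> d u < d u'}"
      have S: "finite S" "(v0, w) \<in> S"
        using fin v0 v0i w finite_subset[of S "U \<times> U"] by (auto simp: S_def)
      define e where "e = (\<lambda>(u, u'). d u - min (f i u) (f i u'))"
      define h1 where "h1 = Min (e ` S)"
      have h1: "h1 \<le> e p" if "p \<in> S" for p using that S by (simp add: h1_def)
      obtain p where p: "p \<in> S" "h1 = e p" using Min_in[of "e ` S"] S unfolding h1_def by blast
      obtain u u' where uu: "p = (u, u')" by fastforce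
      have u: "u \<in> U" "u' \<in> U" "f i u > 0" "f i u' > 0" "d1 u \<noteq> d2 u" "d u < d u'" "d u = h1 + min (f i u) (f i u')"
        using p by (auto simp: S_def uu e_def)
      have h01: "h0 \<le> h1"
        using c1[OF u(1-5)] u by (smt (verit))
      have c2: "d x \<ge> h1 + min (f i x) (f i y)"
        if "x \<in> U" "y \<in> U" "f i x > 0" "f i y > 0" "d1 x \<noteq> d2 x" "d x < d y" for x y
        using h1[of "(x, y)"] that by (auto simp: S_def e_def)
      show ?thesis
      proof (rule fits[of h1 i w])
        show "h1 < d w" using u w m_le[OF u(1,5)] v0 h1[OF S(2)] v0i by (auto simp: e_def min_def split: if_splits)
        show "(d1 x \<noteq> d2 x \<longrightarrow> d x = h1) \<and> (d1 x = d2 x \<longrightarrow> d x \<le> h1)" if "x \<in> U" "\<not> f i x > 0" for x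
          using tie[OF that] h0(2)[of x] h01 that by (auto simp: O'_def)
        show False if "x \<in> U" "y \<in> U" "f i x > 0" "f i y > 0" "d1 x \<noteq> d2 x" "d x < h1 + f i x" "d x < h1 + f i y" "d x < d y" for x y
          using c2[OF that(1-5,8)] that by linarith
        show False if a: "a \<in> U" and b: "b \<in> U" and ab: "f i a > 0" "f i a < f i b" "h1 + f i a < d a" "h1 + f i a < d b" for a b
        proof -
          have fb: "f i b > 0" using ab by simp
          have h1n: "h1 \<ge> 0" using h01 h0 by simp
          have key: False
            if "u \<noteq> x" "u \<noteq> y" "x \<noteq> y" "x \<in> U" "y \<in> U" "f i x > 0" "f i y > 0"
              "f i x < f i y" "h1 + f i x < d x" "h1 + f i x < d y"
              "d u + f i x < d x + f i u" "d u + f i x < d x + f i y" "d u < d y" "d u + f i x < d y + f i u" 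
              "d u + f i x < d x + d y"
            for x y
            using that H5[OF w(2) u(1) that(4,5,1-3) u(3) that(6,7) u(5)] h1n by linarith
          show False
          proof (cases "f i u \<le> f i u'")
            case True
            then have du: "d u = h1 + f i u" using u by simp
            show False
            proof (cases "f i u \<le> f i a")
              case True
              have "d u < d b" using ab True du by linarith
              then show False using key[of a b] a b ab fb True du h1n u(3) by force
            next
              case False
              then have "f i a < f i u'" using \<open>f i u \<le> f i u'\<close> by simp
              then show False using key[of a u'] a u ab du False h1n by force
            qed
          next
            case False
            then have du: "d u = h1 + f i u'" "f i u' < f i u" using u by auto
            have "f i a \<le> f i u'"
            proof (rule ccontr)
              assume "\<not> f i a \<le> f i u'"
              then have "d u < d a" "d u < h1 + min (f i u) (f i a)" using du ab by auto
              then show False using c2[OF u(1) a u(3) ab(1) u(5)] by linarith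
            qed
            show False
            proof (cases "f i a = f i u'")
              case True
              have "d u < d b" "u \<noteq> b" using ab True du by auto
              then show False using key[of a b] a b ab fb True du h1n u(3) by force
            next
              case False
              then have "f i a < f i u'" using \<open>f i a \<le> f i u'\<close> by simp
              then show False using key[of a u'] a u ab du h1n by force
            qed
          qed
        qed
      qed (use h01 h0 w in auto)
    qed
  qed
qed

section \<open>Matrices without tropically nonsingular minors of size four\<close>

text \<open>The identity is the unique optimal permutation. The 23 comparisons are written out so
  that each is a linear inequality.\<close>

definition dominant4 :: "('r \<Rightarrow> 'c \<Rightarrow> real) \<Rightarrow> 'r \<Rightarrow> 'r \<Rightarrow> 'r \<Rightarrow> 'r \<Rightarrow> 'c \<Rightarrow> 'c \<Rightarrow> 'c \<Rightarrow> 'c \<Rightarrow> bool" where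
  "dominant4 M r1 r2 r3 r4 c1 c2 c3 c4 \<longleftrightarrow>
     M r1 c1 + M r2 c2 + M r3 c3 + M r4 c4 < M r1 c1 + M r2 c2 + M r3 c4 + M r4 c3 \<and>
     M r1 c1 + M r2 c2 + M r3 c3 + M r4 c4 < M r1 c1 + M r2 c3 + M r3 c2 + M r4 c4 \<and>
     M r1 c1 + M r2 c2 + M r3 c3 + M r4 c4 < M r1 c1 + M r2 c3 + M r3 c4 + M r4 c2 \<and>
     M r1 c1 + M r2 c2 + M r3 c3 + M r4 c4 < M r1 c1 + M r2 c4 + M r3 c2 + M r4 c3 \<and>
     M r1 c1 + M r2 c2 + M r3 c3 + M r4 c4 < M r1 c1 + M r2 c4 + M r3 c3 + M r4 c2 \<and>
     M r1 c1 + M r2 c2 + M r3 c3 + M r4 c4 < M r1 c2 + M r2 c1 + M r3 c3 + M r4 c4 \<and>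
     M r1 c1 + M r2 c2 + M r3 c3 + M r4 c4 < M r1 c2 + M r2 c1 + M r3 c4 + M r4 c3 \<and>
     M r1 c1 + M r2 c2 + M r3 c3 + M r4 c4 < M r1 c2 + M r2 c3 + M r3 c1 + M r4 c4 \<and>
     M r1 c1 + M r2 c2 + M r3 c3 + M r4 c4 < M r1 c2 + M r2 c3 + M r3 c4 + M r4 c1 \<and>
     M r1 c1 + M r2 c2 + M r3 c3 + M r4 c4 < M r1 c2 + M r2 c4 + M r3 c1 + M r4 c3 \<and>
     M r1 c1 + M r2 c2 + M r3 c3 + M r4 c4 < M r1 c2 + M r2 c4 + M r3 c3 + M r4 c1 \<and>
     M r1 c1 + M r2 c2 + M r3 c3 + M r4 c4 < M r1 c3 + M r2 c1 + M r3 c2 + M r4 c4 \<and>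
     M r1 c1 + M r2 c2 + M r3 c3 + M r4 c4 < M r1 c3 + M r2 c1 + M r3 c4 + M r4 c2 \<and>
     M r1 c1 + M r2 c2 + M r3 c3 + M r4 c4 < M r1 c3 + M r2 c2 + M r3 c1 + M r4 c4 \<and>
     M r1 c1 + M r2 c2 + M r3 c3 + M r4 c4 < M r1 c3 + M r2 c2 + M r3 c4 + M r4 c1 \<and>
     M r1 c1 + M r2 c2 + M r3 c3 + M r4 c4 < M r1 c3 + M r2 c4 + M r3 c1 + M r4 c2 \<and>
     M r1 c1 + M r2 c2 + M r3 c3 + M r4 c4 < M r1 c3 + M r2 c4 + M r3 c2 + M r4 c1 \<and>
     M r1 c1 + M r2 c2 + M r3 c3 + M r4 c4 < M r1 c4 + M r2 c1 + M r3 c2 + M r4 c3 \<and>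
     M r1 c1 + M r2 c2 + M r3 c3 + M r4 c4 < M r1 c4 + M r2 c1 + M r3 c3 + M r4 c2 \<and>
     M r1 c1 + M r2 c2 + M r3 c3 + M r4 c4 < M r1 c4 + M r2 c2 + M r3 c1 + M r4 c3 \<and>
     M r1 c1 + M r2 c2 + M r3 c3 + M r4 c4 < M r1 c4 + M r2 c2 + M r3 c3 + M r4 c1 \<and>
     M r1 c1 + M r2 c2 + M r3 c3 + M r4 c4 < M r1 c4 + M r2 c3 + M r3 c1 + M r4 c2 \<and>
     M r1 c1 + M r2 c2 + M r3 c3 + M r4 c4 < M r1 c4 + M r2 c3 + M r3 c2 + M r4 c1"

definition no_dominant_minor :: "('r \<Rightarrow> 'c \<Rightarrow> real) \<Rightarrow> bool" where
  "no_dominant_minor M \<longleftrightarrow> (\<forall>r1 r2 r3 r4 c1 c2 c3 c4. distinct [r1, r2, r3, r4] \<longrightarrow> distinct [c1, c2, c3, c4] \<longrightarrow>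
     \<not> dominant4 M r1 r2 r3 r4 c1 c2 c3 c4)"

lemma no_dominant_minorD:
  "no_dominant_minor M \<Longrightarrow> distinct [r1, r2, r3, r4] \<Longrightarrow> distinct [c1, c2, c3, c4] \<Longrightarrow> dominant4 M r1 r2 r3 r4 c1 c2 c3 c4 \<Longrightarrow> False"
  unfolding no_dominant_minor_def by blast

text \<open>A row or column shift changes all 24 permutation sums of a minor by the same
  amount.\<close>

lemma no_dominant_minor_shift:
  assumes "no_dominant_minor M" shows "no_dominant_minor (\<lambda>r c. M r c + f r - g c)"
proof -
  have "dominant4 (\<lambda>r c. M r c + f r - g c) r1 r2 r3 r4 c1 c2 c3 c4 \<longleftrightarrow> dominant4 M r1 r2 r3 r4 c1 c2 c3 c4"
    for r1 r2 r3 r4 c1 c2 c3 c4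
    unfolding dominant4_def by (intro arg_cong2[where f="(\<and>)"]; linarith)
  then show ?thesis using assms unfolding no_dominant_minor_def by blast
qed

text \<open>Every obstruction in \<open>star_fit\<close> except \<open>H6\<close> becomes a minor on
  the rows \<open>p\<close>, \<open>q\<close>, the ray \<open>i\<close> and a further ray
  \<open>j\<close>, with the obstructing columns and \<open>z\<close>. The row among
  \<open>p\<close>, \<open>q\<close> with the smaller entry takes the point whose height is exact,
  and the other row takes \<open>z\<close> at cost 0. \<open>H6\<close> remains an assumption
  because it needs a column that depends on the application.\<close>

lemma star_minors:
  fixes M :: "'r \<Rightarrow> 'c \<Rightarrow> real" and U :: "'c set" and d :: "'c \<Rightarrow> real"
  assumes M: "no_dominant_minor M" and fin: "finite U" and d: "\<And>u. d u = min (M p u) (M q u)"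
    and pq: "p \<noteq> q" "p \<notin> I" "q \<notin> I"
    and third: "\<And>i k. i \<in> I \<Longrightarrow> \<exists>j\<in>I. j \<noteq> i \<and> j \<noteq> k"
    and nn: "\<And>u i. u \<in> U \<Longrightarrow> i \<in> I \<Longrightarrow> M i u \<ge> 0" "\<And>u. u \<in> U \<Longrightarrow> M p u \<ge> 0" "\<And>u. u \<in> U \<Longrightarrow> M q u \<ge> 0"
    and one: "\<And>u i j. u \<in> U \<Longrightarrow> i \<in> I \<Longrightarrow> j \<in> I \<Longrightarrow> M i u > 0 \<Longrightarrow> M j u > 0 \<Longrightarrow> i = j"
    and z: "z \<notin> U" "M p z = 0" "M q z = 0" "\<And>i. i \<in> I \<Longrightarrow> M i z \<ge> 0"
    and H6: "\<And>i u u'. \<lbrakk>i \<in> I; u \<in> U; u' \<in> U; M i u > 0; M i u' > 0; M p u \<noteq> M q u;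
        d u < d u'; d u < M i u; d u < M i u'\<rbrakk> \<Longrightarrow> False"
  shows "\<exists>h\<ge>0. (\<forall>u\<in>U. if \<exists>i\<in>I. M i u > 0 then (M p u \<noteq> M q u \<longrightarrow> d u = h) \<and> (M p u = M q u \<longrightarrow> d u \<le> h)
        else (M p u \<noteq> M q u \<longrightarrow> h \<le> d u)) \<or>
    (\<exists>i\<in>I. (\<exists>u\<in>U. M i u > 0) \<and> (\<exists>\<tau>>0. \<forall>u\<in>U. if M i u > 0 then min_twice4 (M p u) (M q u) (h + M i u) (h + \<tau>)
        else (M p u \<noteq> M q u \<longrightarrow> d u = h) \<and> (M p u = M q u \<longrightarrow> d u \<le> h)))"
proof (rule star_fit[OF d fin])
  show "d u \<ge> 0" if "u \<in> U" for u using nn that d by simp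
  have zero: "M j u = 0" if "u \<in> U" "i \<in> I" "j \<in> I" "i \<noteq> j" "M i u > 0" for u i j
    using one[OF that(1-3)] that nn(1)[of u j] by force
  have dd: "d u \<le> M p u" "d u \<le> M q u" for u using d[of u] by auto
  show False if i: "i \<in> I" and U: "v \<in> U" "w \<in> U" "x \<in> U" and a: "M p v \<noteq> M q v" "\<not> 0 < M i v" "0 < M i w"
      "\<not> 0 < M i x" "d v < d w" "d v < d x" for i v w x
  proof -
    obtain j where j: "j \<in> I" "j \<noteq> i" using third[OF i, of i] by blast
    have e: "M i v = 0" "M i x = 0" "M j w = 0"
      using a nn(1)[OF U(1) i] nn(1)[OF U(3) i] zero[OF U(2) i j(1) _ a(3)] j by auto
    have ne: "v \<noteq> w" "v \<noteq> x" "w \<noteq> x" "v \<noteq> z" "w \<noteq> z" "x \<noteq> z" "p \<noteq> i" "p \<noteq> j" "q \<noteq> i" "q \<noteq> j" using a U z i j pq by auto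
    note F = e a(3,5,6) dd[of v] dd[of w] dd[of x] z(2,3) z(4)[OF i] z(4)[OF j(1)] nn(1)[OF U(1) j(1)] nn(1)[OF U(3) j(1)]
       nn(2)[OF U(1)] nn(3)[OF U(1)] d[of v]
    show False
    proof (cases "M p v < M q v")
      case True
      then have "M p v = d v" using d[of v] by simp
      note F = F this True
      have "dominant4 M p j i q v w x z" unfolding dominant4_def using F by (intro conjI; linarith)
      then show False by (rule no_dominant_minorD[OF M, rotated 2]) (use ne pq j in auto)
    next
      case False
      then have "M q v = d v" "M q v < M p v" using d[of v] a by simp_all
      note F = F this
      have "dominant4 M q j i p v w x z" unfolding dominant4_def using F by (intro conjI; linarith)
      then show False by (rule no_dominant_minorD[OF M, rotated 2]) (use ne pq j in auto)
    qed
  qed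
  show False if i: "i \<in> I" and U: "v \<in> U" "u \<in> U" "u' \<in> U" and a: "\<not> 0 < M i v" "0 < M i u" "0 < M i u'"
      "M p u \<noteq> M q u" "d u < d v + M i u" "d u < d v + M i u'" "d u < d u'" for i v u u'
  proof (cases "d v = 0")
    case True
    then show False using H6[OF i U(2,3) a(2-4,7)] a by simp
  next
    case dv: False
    obtain k where k: "k \<in> I" "k \<noteq> i" using third[OF i, of i] by blast
    \<comment> \<open>The ray \<open>j\<close> must avoid the one on which \<open>v\<close> itself
      may lie.\<close>
    obtain j where j: "j \<in> I" "j \<noteq> i" "M j v = 0"
    proof (cases "M k v = 0")
      case False
      then have kv: "M k v > 0" using nn(1)[OF U(1) k(1)] by simp
      obtain j where "j \<in> I" "j \<noteq> i" "j \<noteq> k" using third[OF i, of k] by blast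
      then show thesis using that zero[OF U(1) k(1) _ _ kv] by metis
    qed (use k that in blast)
    have e: "M i v = 0" "M j u = 0" "M j u' = 0" "d v > 0"
      using a nn(1)[OF U(1) i] zero[OF U(2) i j(1) _ a(2)] zero[OF U(3) i j(1) _ a(3)] j dv nn(2,3)[OF U(1)] d[of v] by auto
    have ne: "v \<noteq> u" "v \<noteq> u'" "u \<noteq> u'" "v \<noteq> z" "u \<noteq> z" "u' \<noteq> z" "p \<noteq> i" "p \<noteq> j" "q \<noteq> i" "q \<noteq> j" using a U z i j pq by auto
    note F = e a(2,3,5-7) j(3) dd[of v] dd[of u] dd[of u'] z(2,3) z(4)[OF i] z(4)[OF j(1)]
       nn(2)[OF U(2)] nn(3)[OF U(2)]
    show False
    proof (cases "M p u < M q u")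
      case True
      then have "M p u = d u" using d[of u] by simp
      note F = F this True
      have "dominant4 M p i j q u v u' z" unfolding dominant4_def using F by (intro conjI; linarith)
      then show False by (rule no_dominant_minorD[OF M, rotated 2]) (use ne pq j in auto)
    next
      case False
      then have "M q u = d u" "M q u < M p u" using d[of u] a by simp_all
      note F = F this
      have "dominant4 M q i j p u v u' z" unfolding dominant4_def using F by (intro conjI; linarith)
      then show False by (rule no_dominant_minorD[OF M, rotated 2]) (use ne pq j in auto)
    qed
  qed
  show False if i: "i \<in> I" and U: "v \<in> U" "u \<in> U" "u' \<in> U" and a: "\<not> 0 < M i v" "M p v \<noteq> M q v" "0 < M i u" "M i u < M i u'"
      "d v + M i u < d u" "d v + M i u < d u'" for i v u u'
  proof -
    obtain j where j: "j \<in> I" "j \<noteq> i" using third[OF i, of i] by blast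
    have e: "M i v = 0" "M j u = 0" "M j u' = 0"
      using a nn(1)[OF U(1) i] zero[OF U(2) i j(1) _ a(3)] zero[OF U(3) i j(1)] j by auto
    have ne: "v \<noteq> u" "v \<noteq> u'" "u \<noteq> u'" "v \<noteq> z" "u \<noteq> z" "u' \<noteq> z" "p \<noteq> i" "p \<noteq> j" "q \<noteq> i" "q \<noteq> j" using a U z i j pq by auto
    note F = e a(3-6) dd[of v] dd[of u] dd[of u'] z(2,3) z(4)[OF i] z(4)[OF j(1)] nn(1)[OF U(1) j(1)]
       nn(2)[OF U(1)] nn(3)[OF U(1)]
    show False
    proof (cases "M p v < M q v")
      case True
      then have "M p v = d v" using d[of v] by simp
      note F = F this True
      have "dominant4 M p i j q v u u' z" unfolding dominant4_def using F by (intro conjI; linarith)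
      then show False by (rule no_dominant_minorD[OF M, rotated 2]) (use ne pq j in auto)
    next
      case False
      then have "M q v = d v" "M q v < M p v" using d[of v] a by simp_all
      note F = F this
      have "dominant4 M q i j p v u u' z" unfolding dominant4_def using F by (intro conjI; linarith)
      then show False by (rule no_dominant_minorD[OF M, rotated 2]) (use ne pq j in auto)
    qed
  qed
  show False if i: "i \<in> I" and U: "u \<in> U" "x \<in> U" "y \<in> U" and a: "u \<noteq> x" "u \<noteq> y" "x \<noteq> y"
      "0 < M i u" "0 < M i x" "0 < M i y" "M p u \<noteq> M q u"
      "d u + M i x < d u + M i y" "d u + M i x < d x + M i u" "d u + M i x < d x + M i y"
      "d u + M i x < d y + M i x" "d u + M i x < d y + M i u"
      "d u + M i x < d u + d x" "d u + M i x < d u + d y" "d u + M i x < d x + d y" for i u x y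
  proof -
    obtain j where j: "j \<in> I" "j \<noteq> i" using third[OF i, of i] by blast
    have e: "M j u = 0" "M j x = 0" "M j y = 0"
      using zero[OF U(1) i j(1) _ a(4)] zero[OF U(2) i j(1) _ a(5)] zero[OF U(3) i j(1) _ a(6)] j by auto
    have ne: "u \<noteq> z" "x \<noteq> z" "y \<noteq> z" "p \<noteq> i" "p \<noteq> j" "q \<noteq> i" "q \<noteq> j" using U z i j pq by auto
    note ne = ne a(1-3)
    note F = e a(4-6,8-15) dd[of u] dd[of x] dd[of y] z(2,3) z(4)[OF i] z(4)[OF j(1)]
       nn(2)[OF U(1)] nn(3)[OF U(1)]
    show False
    proof (cases "M p u < M q u")
      case True
      then have "M p u = d u" using d[of u] by simp
      note F = F this True
      have "dominant4 M p i j q u x y z" unfolding dominant4_def using F by (intro conjI; linarith)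
      then show False by (rule no_dominant_minorD[OF M, rotated 2]) (use ne pq j in auto)
    next
      case False
      then have "M q u = d u" "M q u < M p u" using d[of u] a by simp_all
      note F = F this
      have "dominant4 M q i j p u x y z" unfolding dominant4_def using F by (intro conjI; linarith)
      then show False by (rule no_dominant_minorD[OF M, rotated 2]) (use ne pq j in auto)
    qed
  qed
qed (use one H6 in auto)

text \<open>The least \<open>\<kappa>\<close> satisfying the last condition also satisfies the one before it; if it is positive, it is attained
  by a pair of points, which serves as a witness in later minors.\<close>

lemma tropical_line_through_points:
  fixes a m :: "'c \<Rightarrow> real"
  assumes fin: "finite C"
    and P: "\<And>u u'. \<lbrakk>u \<in> C; u' \<in> C; str u; m u < a u; m u < a u'; m u < m u'\<rbrakk> \<Longrightarrow> False"
    and T: "\<And>x y z. \<lbrakk>x \<in> C; y \<in> C; z \<in> C; x \<noteq> y; x \<noteq> z; y \<noteq> z; str x; a y < a z; m x + a y < a x + m y;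
        m x + a y < a x + m z; m x + a y < a z + m y; m x + a y < a y + m z;
        m x + a y < m x + m y; m x + a y < m x + m z; m x + a y < m y + m z\<rbrakk> \<Longrightarrow> False"
  shows "\<exists>\<kappa>\<ge>0. (\<kappa> = 0 \<or> (\<exists>w\<in>C. \<exists>w'\<in>C. \<kappa> + a w = min (m w) (m w') \<and> a w < a w')) \<and>
    (\<forall>u\<in>C. \<forall>u'\<in>C. str u \<longrightarrow> m u < \<kappa> + a u \<longrightarrow> m u < \<kappa> + a u' \<longrightarrow> m u < m u' \<longrightarrow> False) \<and>
    (\<forall>u\<in>C. \<forall>u'\<in>C. \<kappa> + a u < m u \<longrightarrow> a u < a u' \<longrightarrow> \<kappa> + a u < m u' \<longrightarrow> False)"
proof -
  define S where "S = {(w, w'). w \<in> C \<and> w' \<in> C \<and> a w < a w'}"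
  define e where "e = (\<lambda>(w, w'). min (m w) (m w') - a w)"
  define \<kappa> where "\<kappa> = Max (insert 0 (e ` S))"
  have S: "finite S" using fin finite_subset[of S "C \<times> C"] by (auto simp: S_def)
  have k0: "\<kappa> \<ge> 0" using S by (simp add: \<kappa>_def)
  have kS: "min (m w) (m w') - a w \<le> \<kappa>" if "w \<in> C" "w' \<in> C" "a w < a w'" for w w'
  proof -
    have "e (w, w') \<le> \<kappa>" unfolding \<kappa>_def using S that by (intro Max_ge) (auto simp: S_def)
    then show ?thesis by (simp add: e_def)
  qed
  have "\<kappa> \<in> insert 0 (e ` S)" unfolding \<kappa>_def using S by (intro Max_in) auto
  then have witness: "\<kappa> = 0 \<or> (\<exists>w\<in>C. \<exists>w'\<in>C. \<kappa> + a w = min (m w) (m w') \<and> a w < a w')"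
    by (force simp: S_def e_def)
  have f1: False if u: "u \<in> C" "u' \<in> C" "str u" "m u < \<kappa> + a u" "m u < \<kappa> + a u'" "m u < m u'" for u u'
  proof (cases "\<kappa> = 0")
    case True
    then show False using P[OF u(1-3)] u by simp
  next
    case False
    then obtain w w' where w: "w \<in> C" "w' \<in> C" "\<kappa> + a w = min (m w) (m w')" "a w < a w'" using witness by blast
    have kp: "\<kappa> > 0" using k0 False by simp
    show False
    \<comment> \<open>Below the height attained by the pair \<open>w\<close>, \<open>w'\<close> that
      pair completes \<open>u\<close> to an excluded triple; above it \<open>u'\<close> takes the
      place of \<open>w'\<close>.\<close>
    proof (cases "m u < \<kappa> + a w")
      case True
      have "u \<noteq> w" "u \<noteq> w'" "w \<noteq> w'" using True w by auto
      moreover have "\<kappa> + a w \<le> m w" "\<kappa> + a w \<le> m w'" using w(3) by auto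
      ultimately show False
        using T[OF u(1) w(1,2) _ _ _ u(3) w(4)] True kp u w(4) by (smt (verit))
    next
      case False
      have "u \<noteq> w" "u' \<noteq> w" "u \<noteq> u'" using False u by auto
      moreover have "\<kappa> + a w \<le> m w" using w(3) by auto
      ultimately show False using T[OF u(1) w(1) u(2) _ _ _ u(3)] False kp u w(4) by (smt (verit))
    qed
  qed
  have f2: False if "u \<in> C" "u' \<in> C" "\<kappa> + a u < m u" "a u < a u'" "\<kappa> + a u < m u'" for u u'
    using kS[OF that(1,2,4)] that by linarith
  show ?thesis using k0 witness f1 f2 by blast
qed

section \<open>Normalizing the rows\<close>

text \<open>\<open>C1\<close> consists of the columns supported on the two rows \<open>p1, p2\<close>, and \<open>C2\<close> of those supported on at least three of
  \<open>r3, r4, r5, r6\<close>. The row \<open>r3\<close> is distinguished by the relation for row \<open>p2\<close>.\<close>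

locale block =
  fixes W :: "'r \<Rightarrow> 'c::finite \<Rightarrow> real" and p1 p2 r3 r4 r5 r6 :: 'r and C1 C2 :: "'c set" and v3 v0 :: 'c
  assumes rows: "distinct [p1, p2, r3, r4, r5, r6]"
    and W: "no_dominant_minor W"
    and cols: "C1 \<inter> C2 = {}" "C1 \<noteq> {}"
    and c1: "c \<in> C1 \<Longrightarrow> W p1 c = 0" "c \<in> C1 \<Longrightarrow> W p2 c = 0"
      "c \<in> C1 \<Longrightarrow> W r3 c > 0" "c \<in> C1 \<Longrightarrow> W r4 c > 0" "c \<in> C1 \<Longrightarrow> W r5 c > 0" "c \<in> C1 \<Longrightarrow> W r6 c > 0"
    and c2: "v \<in> C2 \<Longrightarrow> W p1 v > 0" "v \<in> C2 \<Longrightarrow> W p2 v > 0"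
      "v \<in> C2 \<Longrightarrow> W r3 v \<ge> 0" "v \<in> C2 \<Longrightarrow> W r4 v \<ge> 0" "v \<in> C2 \<Longrightarrow> W r5 v \<ge> 0" "v \<in> C2 \<Longrightarrow> W r6 v \<ge> 0"
      "v \<in> C2 \<Longrightarrow> W r3 v = 0 \<or> W r4 v = 0" "v \<in> C2 \<Longrightarrow> W r3 v = 0 \<or> W r5 v = 0" "v \<in> C2 \<Longrightarrow> W r3 v = 0 \<or> W r6 v = 0"
      "v \<in> C2 \<Longrightarrow> W r4 v = 0 \<or> W r5 v = 0" "v \<in> C2 \<Longrightarrow> W r4 v = 0 \<or> W r6 v = 0" "v \<in> C2 \<Longrightarrow> W r5 v = 0 \<or> W r6 v = 0"
    and v3: "v3 \<in> C2" "W r3 v3 > 0" and v0: "v0 \<in> C2" "W r3 v0 = 0"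
begin

definition m :: "'c \<Rightarrow> real" where "m c = min (W r4 c) (min (W r5 c) (W r6 c))"

text \<open>A flat column only bounds the height from above, since its leading terms may cancel; a
  column that is not flat determines it.\<close>

definition flat :: "'c \<Rightarrow> bool" where "flat c \<longleftrightarrow> W r4 c = W r5 c \<and> W r5 c = W r6 c"

lemma v3z: "W r4 v3 = 0" "W r5 v3 = 0" "W r6 v3 = 0" "W p1 v3 > 0"
  using c2[OF v3(1)] v3 by auto

lemma v0z: "W r4 v0 \<ge> 0" "W r5 v0 \<ge> 0" "W r6 v0 \<ge> 0" "W p1 v0 > 0"
  using c2[OF v0(1)] by auto

lemma vne: "v3 \<noteq> v0" using v3 v0 by auto

lemma cne: "c \<in> C1 \<Longrightarrow> v \<in> C2 \<Longrightarrow> c \<noteq> v" "c \<in> C1 \<Longrightarrow> v \<in> C2 \<Longrightarrow> v \<noteq> c" using cols by auto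

lemma block_swap45: "block W p1 p2 r3 r5 r4 r6 C1 C2 v3 v0"
  using block_axioms unfolding block_def by (simp; blast)

lemma block_swap46: "block W p1 p2 r3 r6 r5 r4 C1 C2 v3 v0"
  using block_axioms unfolding block_def by (simp; blast)

lemma weak_pair:
  assumes u: "u \<in> C1" "u' \<in> C1" and "W r5 u < W r6 u" "W r5 u < W r3 u" "W r5 u < W r3 u'" "W r5 u < W r5 u'" "W r5 u < W r6 u'"
  shows False
proof -
  have "dominant4 W r5 p1 r3 r6 u u' v0 v3"
    unfolding dominant4_def using assms c1[OF u(1)] c1[OF u(2)] v3 v3z v0 v0z by (intro conjI; linarith)
  then show False
    by (rule no_dominant_minorD[OF W, rotated 2]) (use rows assms cne[OF _ v0(1)] cne[OF _ v3(1)] vne in auto)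
qed

lemma strong_pair:
  assumes u: "u \<in> C1" "u' \<in> C1" and v: "v \<in> C2" "W r5 v > 0"
    and "W r3 u < W r5 u" "W r3 u < W r6 u" "W r3 u < W r3 u'" "W r3 u < W r5 u'" "W r3 u < W r6 u'"
  shows False
proof -
  have z: "W r3 v = 0" "W r6 v = 0" using c2[OF v(1)] v by auto
  have "dominant4 W r3 p1 r5 r6 u u' v3 v"
    unfolding dominant4_def using assms c1[OF u(1)] c1[OF u(2)] v3 v3z c2[OF v(1)] z by (intro conjI; linarith)
  then show False
    by (rule no_dominant_minorD[OF W, rotated 2]) (use rows assms cne[OF _ v(1)] cne[OF _ v3(1)] v3z v in auto)
qed

lemma triple_a:
  assumes C: "x \<in> C1" "y \<in> C1" "z \<in> C1" and ne: "x \<noteq> y" "x \<noteq> z" "y \<noteq> z" and "W r5 x < W r6 x" "W r3 y < W r3 z"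
    and "W r5 x + W r3 y < W r3 x + W r5 y" "W r5 x + W r3 y < W r3 x + W r6 y"
      "W r5 x + W r3 y < W r3 x + W r5 z" "W r5 x + W r3 y < W r3 x + W r6 z"
      "W r5 x + W r3 y < W r3 z + W r5 y" "W r5 x + W r3 y < W r3 z + W r6 y"
      "W r5 x + W r3 y < W r3 y + W r5 z" "W r5 x + W r3 y < W r3 y + W r6 z"
      "W r3 y < W r5 y" "W r3 y < W r6 y" "W r3 y < W r5 z" "W r3 y < W r6 z"
      "W r5 x + W r3 y < W r5 y + W r6 z" "W r5 x + W r3 y < W r6 y + W r5 z"
  shows False
proof -
  have "dominant4 W r5 r3 p1 r6 x y z v3"
    unfolding dominant4_def using assms c1[OF C(1)] c1[OF C(2)] c1[OF C(3)] v3 v3z by (intro conjI; linarith)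
  then show False
    by (rule no_dominant_minorD[OF W, rotated 2]) (use rows assms cne[OF _ v3(1)] in auto)
qed

lemma m_le: "m c \<le> W r4 c" "m c \<le> W r5 c" "m c \<le> W r6 c" unfolding m_def by auto

lemma m_le': "r \<in> {r4, r5, r6} \<Longrightarrow> m c \<le> W r c" unfolding m_def by auto

text \<open>The six alternatives correspond to the six labellings in
  \<open>all_perms\<close>.\<close>

lemma nonflat_strict: "\<not> flat c \<Longrightarrow> (W r5 c < W r6 c \<and> W r5 c = m c) \<or> (W r6 c < W r5 c \<and> W r6 c = m c) \<or>
   (W r4 c < W r6 c \<and> W r4 c = m c) \<or> (W r6 c < W r4 c \<and> W r6 c = m c) \<or>
   (W r4 c < W r5 c \<and> W r4 c = m c) \<or> (W r5 c < W r4 c \<and> W r5 c = m c)"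
  unfolding flat_def m_def by (smt (verit))

lemma m_pos: "c \<in> C1 \<Longrightarrow> m c > 0" unfolding m_def using c1 by auto

text \<open>The three rows \<open>r4\<close>, \<open>r5\<close>, \<open>r6\<close> play the same role, so each argument is carried out for one
  labelling and transported along the permutations below.\<close>

lemma all_perms:
  assumes "\<forall>a b c. block W p1 p2 r3 a b c C1 C2 v3 v0 \<longrightarrow> {a, b, c} \<subseteq> {r4, r5, r6} \<longrightarrow> P a b c"
  shows "P r4 r5 r6" "P r4 r6 r5" "P r5 r4 r6" "P r5 r6 r4" "P r6 r4 r5" "P r6 r5 r4"
proof -
  note c = block_axioms block_swap45 block_swap46 block.block_swap46[OF block_swap45] block.block_swap45[OF block_swap46] block.block_swap45[OF block.block_swap46[OF block_swap45]]
  show "P r4 r5 r6" "P r4 r6 r5" "P r5 r4 r6" "P r5 r6 r4" "P r6 r4 r5" "P r6 r5 r4"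
    by (rule assms[rule_format]; (rule c)?; auto)+
qed

text \<open>This and \<open>triple_impossible\<close> are the two premises of
  \<open>tropical_line_through_points\<close>, applied to the comparison of \<open>r3\<close> with
  the minimum \<open>m\<close> of the other lower rows.\<close>

lemma low_point_impossible:
  assumes "u \<in> C1" "u' \<in> C1" "\<not> flat u" "m u < W r3 u" "m u < W r3 u'" "m u < m u'"
  shows False
proof -
  have w: "\<not> (W b u < W c u \<and> W b u = m u)" if "block W p1 p2 r3 a b c C1 C2 v3 v0" "{a, b, c} \<subseteq> {r4, r5, r6}" for a b c
  proof -
    have "m u' \<le> W b u'" "m u' \<le> W c u'" using that(2) m_le' by simp_all
    then show ?thesis using block.weak_pair[OF that(1) assms(1,2)] assms by auto
  qed
  have "\<forall>a b c. block W p1 p2 r3 a b c C1 C2 v3 v0 \<longrightarrow> {a, b, c} \<subseteq> {r4, r5, r6} \<longrightarrow> \<not> (W b u < W c u \<and> W b u = m u)"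
    using w by blast
  note q = all_perms[OF this]
  show False using nonflat_strict[OF assms(3)] by (elim disjE) (insert q, simp_all)
qed

lemma triple_impossible:
  assumes "x \<in> C1" "y \<in> C1" "z \<in> C1" "x \<noteq> y" "x \<noteq> z" "y \<noteq> z" "\<not> flat x" "W r3 y < W r3 z" "m x + W r3 y < W r3 x + m y"
        "m x + W r3 y < W r3 x + m z" "m x + W r3 y < W r3 z + m y" "m x + W r3 y < W r3 y + m z"
        "m x + W r3 y < m x + m y" "m x + W r3 y < m x + m z" "m x + W r3 y < m y + m z"
  shows False
proof -
  have w: "\<not> (W b x < W c x \<and> W b x = m x)" if "block W p1 p2 r3 a b c C1 C2 v3 v0" "{a, b, c} \<subseteq> {r4, r5, r6}" for a b c
  proof
    assume x: "W b x < W c x \<and> W b x = m x"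
    have M: "m v \<le> W b v" "m v \<le> W c v" for v using that(2) m_le' by simp_all
    show False
      by (rule block.triple_a[OF that(1) assms(1-6)]; use x assms(8-) M[of y] M[of z] in linarith)
  qed
  have "\<forall>a b c. block W p1 p2 r3 a b c C1 C2 v3 v0 \<longrightarrow> {a, b, c} \<subseteq> {r4, r5, r6} \<longrightarrow> \<not> (W b x < W c x \<and> W b x = m x)"
    using w by blast
  note q = all_perms[OF this]
  show False using nonflat_strict[OF assms(7)] by (elim disjE) (insert q, simp_all)
qed

text \<open>A positive \<kappa> is attained by a pair of columns that this excludes. So \<kappa> is
  0 as soon as \<open>C2\<close> has a positive entry outside \<open>r3\<close>.\<close>

lemma high_point_impossible:
  assumes "v \<in> C2" "W r4 v > 0 \<or> W r5 v > 0 \<or> W r6 v > 0" "u \<in> C1" "u' \<in> C1"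
    "W r3 u < m u" "W r3 u < W r3 u'" "W r3 u < m u'"
  shows False
proof -
  have w: "\<not> (W b v > 0)" if "block W p1 p2 r3 a b c C1 C2 v3 v0" "{a, b, c} \<subseteq> {r4, r5, r6}" for a b c
  proof
    assume x: "W b v > 0"
    have M: "m v \<le> W b v" "m v \<le> W c v" for v using that(2) m_le' by simp_all
    show False
      by (rule block.strong_pair[OF that(1) assms(3,4,1) x]; use assms(5-) M[of u] M[of u'] in linarith)
  qed
  have "\<forall>a b c. block W p1 p2 r3 a b c C1 C2 v3 v0 \<longrightarrow> {a, b, c} \<subseteq> {r4, r5, r6} \<longrightarrow> \<not> (W b v > 0)"
    using w by blast
  note q = all_perms[OF this]
  show False using assms(2) by (elim disjE) (insert q, simp_all)
qed

end

text \<open>The row \<open>r3\<close> is raised by \<open>\<kappa>\<close> and the row \<open>p1\<close> by \<open>\<eta>\<close>. The conditions \<open>N\<close> say that the columns of \<open>C1\<close> whose entries in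
  \<open>r4, r5, r6\<close> are not all equal have there the minimum that a vector \<open>y3 P3 + x1 P1\<close> with \<open>P3, P1\<close> of valuation
  \<open>\<kappa>, \<eta>\<close> prescribes.\<close>

locale block_normed = block W p1 p2 r3 r4 r5 r6 C1 C2 v3 v0
  for W :: "'r \<Rightarrow> 'c::finite \<Rightarrow> real" and p1 p2 r3 r4 r5 r6 C1 C2 v3 v0 +
  fixes \<kappa> \<eta> :: real
  assumes kappa_nonneg: "\<kappa> \<ge> 0"
    and witness: "\<kappa> = 0 \<or> (\<exists>w\<in>C1. \<kappa> + W r3 w \<le> \<eta> \<and> \<kappa> + W r3 w \<le> W r4 w \<and> \<kappa> + W r3 w \<le> W r5 w \<and> \<kappa> + W r3 w \<le> W r6 w)"
    and groups: "v \<in> C2 \<Longrightarrow> W r4 v > 0 \<or> W r5 v > 0 \<or> W r6 v > 0 \<Longrightarrow> \<kappa> = 0"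
    and eta_pos: "\<eta> > 0"
    and eta_attained: "\<exists>c\<in>C1. \<eta> \<le> \<kappa> + W r3 c \<and> \<eta> \<le> W r4 c \<and> \<eta> \<le> W r5 c \<and> \<eta> \<le> W r6 c"
    and N: "c \<in> C1 \<Longrightarrow> \<not> (W r4 c = W r5 c \<and> W r5 c = W r6 c) \<Longrightarrow>
        min (W r4 c) (min (W r5 c) (W r6 c)) = min (\<kappa> + W r3 c) \<eta> \<or> \<kappa> + W r3 c = \<eta> \<and> \<eta> \<le> min (W r4 c) (min (W r5 c) (W r6 c))"
      "c \<in> C1 \<Longrightarrow> W r4 c = W r5 c \<Longrightarrow> W r5 c = W r6 c \<Longrightarrow> W r4 c \<le> min (\<kappa> + W r3 c) \<eta> \<or> \<kappa> + W r3 c = \<eta>"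
begin

lemma block_normed_swaps: "block_normed W p1 p2 r3 r5 r4 r6 C1 C2 v3 v0 \<kappa> \<eta>" "block_normed W p1 p2 r3 r6 r5 r4 C1 C2 v3 v0 \<kappa> \<eta>"
proof -
  have "min (W r5 c) (min (W r4 c) (W r6 c)) = min (W r4 c) (min (W r5 c) (W r6 c))"
    "min (W r6 c) (min (W r5 c) (W r4 c)) = min (W r4 c) (min (W r5 c) (W r6 c))" for c by auto
  note e = this
  show "block_normed W p1 p2 r3 r5 r4 r6 C1 C2 v3 v0 \<kappa> \<eta>"
  proof (rule block_normed.intro[OF block_swap45], rule block_normed_axioms.intro, unfold e)
    show "\<kappa> \<ge> 0" "\<eta> > 0" by (rule kappa_nonneg, rule eta_pos)
    show "\<kappa> = 0 \<or> (\<exists>w\<in>C1. \<kappa> + W r3 w \<le> \<eta> \<and> \<kappa> + W r3 w \<le> W r5 w \<and> \<kappa> + W r3 w \<le> W r4 w \<and> \<kappa> + W r3 w \<le> W r6 w)"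
      using witness by blast
    show "v \<in> C2 \<Longrightarrow> W r5 v > 0 \<or> W r4 v > 0 \<or> W r6 v > 0 \<Longrightarrow> \<kappa> = 0" for v using groups by blast
    show "\<exists>c\<in>C1. \<eta> \<le> \<kappa> + W r3 c \<and> \<eta> \<le> W r5 c \<and> \<eta> \<le> W r4 c \<and> \<eta> \<le> W r6 c" using eta_attained by blast
    fix c assume c: "c \<in> C1"
    show "min (W r4 c) (min (W r5 c) (W r6 c)) = min (\<kappa> + W r3 c) \<eta> \<or> \<kappa> + W r3 c = \<eta> \<and> \<eta> \<le> min (W r4 c) (min (W r5 c) (W r6 c))"
      if "\<not> (W r5 c = W r4 c \<and> W r4 c = W r6 c)" using N(1)[OF c] that by metis
    show "W r5 c \<le> min (\<kappa> + W r3 c) \<eta> \<or> \<kappa> + W r3 c = \<eta>" if "W r5 c = W r4 c" "W r4 c = W r6 c"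
      using N(2)[OF c] that by metis
  qed
  show "block_normed W p1 p2 r3 r6 r5 r4 C1 C2 v3 v0 \<kappa> \<eta>"
  proof (rule block_normed.intro[OF block_swap46], rule block_normed_axioms.intro, unfold e)
    show "\<kappa> \<ge> 0" "\<eta> > 0" by (rule kappa_nonneg, rule eta_pos)
    show "\<kappa> = 0 \<or> (\<exists>w\<in>C1. \<kappa> + W r3 w \<le> \<eta> \<and> \<kappa> + W r3 w \<le> W r6 w \<and> \<kappa> + W r3 w \<le> W r5 w \<and> \<kappa> + W r3 w \<le> W r4 w)"
      using witness by blast
    show "v \<in> C2 \<Longrightarrow> W r6 v > 0 \<or> W r5 v > 0 \<or> W r4 v > 0 \<Longrightarrow> \<kappa> = 0" for v using groups by blast
    show "\<exists>c\<in>C1. \<eta> \<le> \<kappa> + W r3 c \<and> \<eta> \<le> W r6 c \<and> \<eta> \<le> W r5 c \<and> \<eta> \<le> W r4 c" using eta_attained by blast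
    fix c assume c: "c \<in> C1"
    show "min (W r4 c) (min (W r5 c) (W r6 c)) = min (\<kappa> + W r3 c) \<eta> \<or> \<kappa> + W r3 c = \<eta> \<and> \<eta> \<le> min (W r4 c) (min (W r5 c) (W r6 c))"
      if "\<not> (W r6 c = W r5 c \<and> W r5 c = W r4 c)" using N(1)[OF c] that by metis
    show "W r6 c \<le> min (\<kappa> + W r3 c) \<eta> \<or> \<kappa> + W r3 c = \<eta>" if "W r6 c = W r5 c" "W r5 c = W r4 c"
      using N(2)[OF c] that by metis
  qed
qed

lemma all_perms_normed:
  assumes "\<forall>a b c. block_normed W p1 p2 r3 a b c C1 C2 v3 v0 \<kappa> \<eta> \<longrightarrow> {a, b, c} \<subseteq> {r4, r5, r6} \<longrightarrow> P a b c"
  shows "P r4 r5 r6" "P r4 r6 r5" "P r5 r4 r6" "P r5 r6 r4" "P r6 r4 r5" "P r6 r5 r4"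
proof -
  note c = block_normed_axioms block_normed_swaps(1) block_normed_swaps(2) block_normed.block_normed_swaps(2)[OF block_normed_swaps(1)] block_normed.block_normed_swaps(1)[OF block_normed_swaps(2)] 
    block_normed.block_normed_swaps(1)[OF block_normed.block_normed_swaps(2)[OF block_normed_swaps(1)]]
  show "P r4 r5 r6" "P r4 r6 r5" "P r5 r4 r6" "P r5 r6 r4" "P r6 r4 r5" "P r6 r5 r4"
    by (rule assms[rule_format]; (rule c)?; auto)+
qed

text \<open>Strict minima below the top level can occur in only one of the rows \<open>r4\<close>,
  \<open>r5\<close>, \<open>r6\<close>: that row forms a cherry with \<open>r3\<close>.\<close>

lemma sharp_low_same:
  assumes C: "u \<in> C1" "u' \<in> C1" "c \<in> C1" and u: "W r4 u < W r5 u" "W r4 u < W r6 u" and u': "W r5 u' < W r4 u'" "W r5 u' < W r6 u'"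
    and c: "W r4 u < m c" "W r5 u' < m c"
  shows False
proof -
  have "dominant4 W r4 r5 p1 r6 u u' c v3"
    unfolding dominant4_def using assms c1[OF C(1)] c1[OF C(2)] c1[OF C(3)] v3z m_le[of c] by (intro conjI; linarith)
  then show False
    by (rule no_dominant_minorD[OF W, rotated 2]) (use rows assms m_le[of u] m_le[of u'] cne[OF _ v3(1)] in auto)
qed

text \<open>The counterpart on the side where \<open>p1\<close> attains the minimum: only one row
  can form a cherry with \<open>p1\<close>. If the two distinguished rows coincide the star arises,
  otherwise the caterpillar. The column needed besides \<open>u\<close>, \<open>u'\<close>,
  \<open>v3\<close> is \<open>v0\<close> if \<open>\<kappa> = 0\<close>, and else the column at
  which \<kappa> is attained.\<close>

lemma sharp_high_same:
  assumes C: "u \<in> C1" "u' \<in> C1" and u: "W r4 u < W r5 u" "W r4 u < W r6 u" and u': "W r5 u' < W r4 u'" "W r5 u' < W r6 u'"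
    and c: "\<eta> < \<kappa> + W r3 u" "\<eta> < \<kappa> + W r3 u'"
  shows False
proof -
  have e: "W r4 u = \<eta>" "W r5 u' = \<eta>" using N(1)[OF C(1)] N(1)[OF C(2)] u u' c by (auto simp: min_def split: if_splits)
  show False
  proof (cases "\<kappa> = 0")
    case True
    have "dominant4 W r4 p1 r3 r6 u u' v0 v3"
      unfolding dominant4_def using assms e True c1[OF C(1)] c1[OF C(2)] v3 v3z v0 v0z by (intro conjI; linarith)
    then show False
      by (rule no_dominant_minorD[OF W, rotated 2]) (use rows assms cne[OF _ v3(1)] cne[OF _ v0(1)] vne in auto)
  next
    case False
    then obtain w where w: "w \<in> C1" "\<kappa> + W r3 w \<le> \<eta>" "\<kappa> + W r3 w \<le> W r4 w" "\<kappa> + W r3 w \<le> W r5 w" "\<kappa> + W r3 w \<le> W r6 w"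
      using witness by blast
    have "dominant4 W r3 r4 r5 r6 w u u' v3"
      unfolding dominant4_def using assms e w c1[OF C(1)] c1[OF C(2)] v3 v3z kappa_nonneg by (intro conjI; linarith)
    then show False
      by (rule no_dominant_minorD[OF W, rotated 2]) (use rows assms w cne[OF _ v3(1)] in auto)
  qed
qed

end

lemma (in block) block_normed_exists: "\<exists>\<kappa> \<eta>. block_normed W p1 p2 r3 r4 r5 r6 C1 C2 v3 v0 \<kappa> \<eta>"
proof -
  have fin: "finite C1" by simp
  have "\<exists>\<kappa>\<ge>0. (\<kappa> = 0 \<or> (\<exists>w\<in>C1. \<exists>w'\<in>C1. \<kappa> + W r3 w = min (m w) (m w') \<and> W r3 w < W r3 w')) \<and>
    (\<forall>u\<in>C1. \<forall>u'\<in>C1. \<not> flat u \<longrightarrow> m u < \<kappa> + W r3 u \<longrightarrow> m u < \<kappa> + W r3 u' \<longrightarrow> m u < m u' \<longrightarrow> False) \<and>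
    (\<forall>u\<in>C1. \<forall>u'\<in>C1. \<kappa> + W r3 u < m u \<longrightarrow> W r3 u < W r3 u' \<longrightarrow> \<kappa> + W r3 u < m u' \<longrightarrow> False)"
    by (rule tropical_line_through_points[where str = "\<lambda>u. \<not> flat u" and m = m and a = "W r3" and C = C1])
      (rule fin, rule low_point_impossible, assumption+, rule triple_impossible, assumption+)
  then obtain \<kappa> where k: "\<kappa> \<ge> 0" "\<kappa> = 0 \<or> (\<exists>w\<in>C1. \<exists>w'\<in>C1. \<kappa> + W r3 w = min (m w) (m w') \<and> W r3 w < W r3 w')"
    and f1': "\<forall>u\<in>C1. \<forall>u'\<in>C1. \<not> flat u \<longrightarrow> m u < \<kappa> + W r3 u \<longrightarrow> m u < \<kappa> + W r3 u' \<longrightarrow> m u < m u' \<longrightarrow> False"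
    and f2': "\<forall>u\<in>C1. \<forall>u'\<in>C1. \<kappa> + W r3 u < m u \<longrightarrow> W r3 u < W r3 u' \<longrightarrow> \<kappa> + W r3 u < m u' \<longrightarrow> False"
    by (elim exE conjE)
  note f1 = f1'[rule_format] and f2 = f2'[rule_format]
  \<comment> \<open>The least level that is never the unique minimum of \<eta>,
    \<open>\<kappa> + W r3 c\<close> and \<open>m c\<close>; the column \<open>h\<close> attaining
    it turns any other violation into one excluded by \<open>f1\<close> or
    \<open>f2\<close>.\<close>
  define \<eta> where "\<eta> = Max ((\<lambda>c. min (\<kappa> + W r3 c) (m c)) ` C1)"
  have le: "min (\<kappa> + W r3 c) (m c) \<le> \<eta>" if "c \<in> C1" for c unfolding \<eta>_def using fin that by simp
  have "\<eta> \<in> (\<lambda>c. min (\<kappa> + W r3 c) (m c)) ` C1" unfolding \<eta>_def using fin cols by (intro Max_in) auto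
  then obtain h where h: "h \<in> C1" "\<eta> = min (\<kappa> + W r3 h) (m h)" by blast
  have eta_pos: "\<eta> > 0" using h m_pos[OF h(1)] c1(3)[OF h(1)] k(1) by simp
  have N1: "m c = min (\<kappa> + W r3 c) \<eta> \<or> \<kappa> + W r3 c = \<eta> \<and> \<eta> \<le> m c" if "c \<in> C1" "\<not> flat c" for c
    using f1[OF that(1) h(1) that(2)] f2[OF that(1) h(1)] le[OF that(1)] h(2) by (smt (verit))
  have N2: "m c \<le> min (\<kappa> + W r3 c) \<eta> \<or> \<kappa> + W r3 c = \<eta>" if "c \<in> C1" for c
    using f2[OF that(1) h(1)] le[OF that(1)] h(2) by (smt (verit))
  have "block_normed W p1 p2 r3 r4 r5 r6 C1 C2 v3 v0 \<kappa> \<eta>"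
  proof (unfold_locales)
    show "\<kappa> \<ge> 0" "\<eta> > 0" by fact+
    show "\<kappa> = 0 \<or> (\<exists>w\<in>C1. \<kappa> + W r3 w \<le> \<eta> \<and> \<kappa> + W r3 w \<le> W r4 w \<and> \<kappa> + W r3 w \<le> W r5 w \<and> \<kappa> + W r3 w \<le> W r6 w)"
    proof (cases "\<kappa> = 0")
      case False
      then obtain w w' where w: "w \<in> C1" "\<kappa> + W r3 w = min (m w) (m w')" using k by blast
      then have "\<kappa> + W r3 w \<le> m w" by simp
      then show ?thesis using w(1) le[OF w(1)] m_le[of w] by (intro disjI2 bexI[of _ w]) auto
    qed simp
    show "\<kappa> = 0" if "v \<in> C2" "W r4 v > 0 \<or> W r5 v > 0 \<or> W r6 v > 0" for v
    proof (rule ccontr)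
      assume "\<kappa> \<noteq> 0"
      then obtain w w' where w: "w \<in> C1" "w' \<in> C1" "\<kappa> + W r3 w = min (m w) (m w')" "W r3 w < W r3 w'" using k by blast
      then have "W r3 w < m w" "W r3 w < m w'" using k(1) \<open>\<kappa> \<noteq> 0\<close> by auto
      then show False using high_point_impossible[OF that w(1,2)] w by blast
    qed
    show "\<exists>c\<in>C1. \<eta> \<le> \<kappa> + W r3 c \<and> \<eta> \<le> W r4 c \<and> \<eta> \<le> W r5 c \<and> \<eta> \<le> W r6 c"
      using h m_le[of h] by (intro bexI[of _ h]) auto
    fix c assume c: "c \<in> C1"
    show "min (W r4 c) (min (W r5 c) (W r6 c)) = min (\<kappa> + W r3 c) \<eta> \<or>
        \<kappa> + W r3 c = \<eta> \<and> \<eta> \<le> min (W r4 c) (min (W r5 c) (W r6 c))"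
      if "\<not> (W r4 c = W r5 c \<and> W r5 c = W r6 c)" using N1[OF c] that unfolding m_def flat_def .
    show "W r4 c \<le> min (\<kappa> + W r3 c) \<eta> \<or> \<kappa> + W r3 c = \<eta>" if "W r4 c = W r5 c" "W r5 c = W r6 c"
      using N2[OF c] that unfolding m_def by simp
  qed
  then show ?thesis by blast
qed

section \<open>The case of a star\<close>

text \<open>Translates the position on the star into the alternatives of \<open>plane_lift\<close>.
  If the minimum of \<open>fi\<close>, \<open>fj\<close>, \<open>fk\<close> is attained only once,
  both compared entries are forced to equal it and nothing is required of the line; hence
  \<open>on\<close> concerns only points of the star.\<close>

lemma plane_condition_leg:
  assumes "min_twice4 fi fj fk d1" "min_twice4 fi fj fk d2" "h \<ge> 0" "\<tau> > 0" and N: "N = min fi (min fj fk)"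
    and on: "(fi = N \<and> fj = N) \<or> (fi = N \<and> fk = N) \<or> (fj = N \<and> fk = N) \<Longrightarrow>
      if fi - N > 0 then min_twice4 (d1 - N) (d2 - N) (h + (fi - N)) (h + \<tau>)
      else (d1 - N \<noteq> d2 - N \<longrightarrow> min (d1 - N) (d2 - N) = h) \<and> (d1 - N = d2 - N \<longrightarrow> min (d1 - N) (d2 - N) \<le> h)"
  shows "(d1 = d2 \<and> d1 \<le> fi \<and> d1 \<le> fj \<and> d1 \<le> fk \<and> (d1 = fi \<or> d1 = fj \<or> d1 = fk)) \<or>
      (fk \<le> fi \<and> fk \<le> fj \<and> fk \<le> d1 \<and> fk \<le> d2 \<and> (fi = fk \<or> fj = fk) \<and> min_twice4 d1 d2 (h + fi) (h + \<tau> + fj)) \<or>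
      (fi = fj \<and> fi < fk \<and> fi \<le> d1 \<and> fi \<le> d2 \<and> min_twice3 d1 d2 (h + fi))"
proof (cases "(fi = N \<and> fj = N) \<or> (fi = N \<and> fk = N) \<or> (fj = N \<and> fk = N)")
  case True
  have "N \<le> fi" "N \<le> fj" "N \<le> fk" using N by auto
  then show ?thesis using assms(1-4) on[OF True] True unfolding min_twice4_def min_twice3_def by (smt (verit))
next
  case False
  then show ?thesis using assms(1-4) N unfolding min_twice4_def min_twice3_def by (smt (verit))
qed

lemma plane_condition_center:
  assumes "min_twice4 fi fj fk d1" "min_twice4 fi fj fk d2" "h \<ge> 0" and N: "N = min fi (min fj fk)"
    and on: "(fi = N \<and> fj = N) \<or> (fi = N \<and> fk = N) \<or> (fj = N \<and> fk = N) \<Longrightarrow>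
      if fi - N > 0 \<or> fj - N > 0 \<or> fk - N > 0
      then (d1 - N \<noteq> d2 - N \<longrightarrow> min (d1 - N) (d2 - N) = h) \<and> (d1 - N = d2 - N \<longrightarrow> min (d1 - N) (d2 - N) \<le> h)
      else (d1 - N \<noteq> d2 - N \<longrightarrow> h \<le> min (d1 - N) (d2 - N))"
  shows "(d1 = d2 \<and> d1 \<le> fi \<and> d1 \<le> fj \<and> d1 \<le> fk \<and> (d1 = fi \<or> d1 = fj \<or> d1 = fk)) \<or>
      (fk \<le> fi \<and> fk \<le> fj \<and> fk \<le> d1 \<and> fk \<le> d2 \<and> (fi = fk \<or> fj = fk) \<and> min_twice4 d1 d2 (h + fi) (h + 0 + fj)) \<or>
      (fi = fj \<and> fi < fk \<and> fi \<le> d1 \<and> fi \<le> d2 \<and> min_twice3 d1 d2 (h + fi))"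
proof (cases "(fi = N \<and> fj = N) \<or> (fi = N \<and> fk = N) \<or> (fj = N \<and> fk = N)")
  case True
  have "N \<le> fi" "N \<le> fj" "N \<le> fk" using N by auto
  then show ?thesis using assms(1-3) on[OF True] True unfolding min_twice4_def min_twice3_def by (smt (verit))
next
  case False
  then show ?thesis using assms(1-3) N unfolding min_twice4_def min_twice3_def by (smt (verit))
qed

lemma mon_mult: "mon a * mon b = mon (a + b)"
  by (rule hahn_eqI) (auto simp: coeff_monomial_times monomial.rep_eq)

lemma mon_0: "mon 0 = 1"
  by (rule hahn_eqI) (simp add: monomial.rep_eq one_hahn.rep_eq)

lemma hahn_deg_lead: "hahn_deg x = ereal r \<longleftrightarrow> (\<exists>c. c \<noteq> 0 \<and> lead x r c)"
proof
  assume d: "hahn_deg x = ereal r"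
  then have x: "x \<noteq> 0" by (auto simp: hahn_deg_def)
  have "supp x \<noteq> {}" using x hahn_eqI[of x 0] by (auto simp: supp_def zero_hahn.rep_eq)
  then obtain e where e: "e \<in> supp x" "\<And>t. t \<in> supp x \<Longrightarrow> e \<le> t"
    using well_ordered_min[OF well_ordered_supp, of "supp x" x] by blast
  then have "hahn_deg x = ereal e" by (intro hahn_deg_eqI) (auto simp: supp_def)
  then have "e = r" using d by simp
  have "coeff x r \<noteq> 0" using e(1) \<open>e = r\<close> by (simp add: supp_def)
  moreover have "hge x r"
    unfolding hge_def
  proof (intro allI impI)
    fix t assume "t < r"
    then show "coeff x t = 0" using e(2)[of t] \<open>e = r\<close> by (auto simp: supp_def)
  qed
  ultimately show "\<exists>c. c \<noteq> 0 \<and> lead x r c" by (auto simp: lead_def)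
qed (auto simp: lead_def hahn_deg_if)

lemma hahn_deg_mon_mult: "hahn_deg x = ereal r \<Longrightarrow> hahn_deg (mon s * x) = ereal (s + r)"
  unfolding hahn_deg_lead using lead_mult[OF lead_monomial[of 1 s]] by fastforce

text \<open>The rows \<open>r5, r6\<close> are linear combinations of \<open>r4, r3\<close> and the first row. The conditions on the leading coefficients make
  the columns of \<open>C2\<close> liftable together with the relation for row \<open>p2\<close>, whatever that relation is.\<close>

definition good_lift :: "('r \<Rightarrow> 'c \<Rightarrow> real) \<Rightarrow> 'r \<Rightarrow> 'r \<Rightarrow> 'r \<Rightarrow> 'r \<Rightarrow> 'c set \<Rightarrow> 'c set \<Rightarrow> bool" where
  "good_lift W r3 r4 r5 r6 C1 C2 \<longleftrightarrow> (\<exists>c al be c' al' be' c0 a0 c1 a1.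
     lead c 0 c0 \<and> lead al 0 a0 \<and> lead be 0 0 \<and> lead c' 0 c1 \<and> lead al' 0 a1 \<and> lead be' 0 0 \<and>
     c0 \<noteq> 0 \<and> c1 \<noteq> 0 \<and> c0 \<noteq> 5 * a0 \<and> c1 \<noteq> 5 * a1 \<and>
     ((\<exists>v\<in>C2. W r4 v > 0 \<or> W r5 v > 0 \<or> W r6 v > 0) \<longrightarrow> a0 \<noteq> 0 \<and> a1 \<noteq> 0) \<and>
     ((\<exists>v\<in>C2. W r5 v > 0 \<or> W r6 v > 0) \<longrightarrow> c0 * a1 \<noteq> c1 * a0) \<and>
     (\<forall>k\<in>C1. \<exists>x1 y3 y4. hahn_deg x1 = ereal 0 \<and> hahn_deg y3 = ereal (W r3 k) \<and> hahn_deg y4 = ereal (W r4 k) \<and>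
        hahn_deg (y4 * c + y3 * al + x1 * be) = ereal (W r5 k) \<and> hahn_deg (y4 * c' + y3 * al' + x1 * be') = ereal (W r6 k)))"

section \<open>Lifts of \<open>r5\<close> and \<open>r6\<close> near the sum of the shifted rows
  \<open>p1\<close>, \<open>r3\<close>, \<open>r4\<close>, and coordinates on the star\<close>

context block_normed begin

text \<open>The row \<open>r5\<close> is the sum of \<open>Z4\<close>,
  \<open>Z3 = t^\<kappa> y3\<close> and \<open>Z1 = t^\<eta> x1\<close>, and \<open>r6\<close>
  perturbs this sum by \<open>e1\<close>, \<open>e3\<close>, \<open>e4\<close>. The determinant
  required by \<open>good_lift\<close> reduces to \<open>\<epsilon>3 \<noteq> \<epsilon>4\<close>,
  since a positive entry outside \<open>r3\<close> forces \<open>\<kappa> = 0\<close>.\<close>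

lemma good_liftI:
  assumes e: "lead e1 0 \<epsilon>1" "lead e3 0 \<epsilon>3" "lead e4 0 \<epsilon>4" and nz: "1 + \<epsilon>4 \<noteq> 0" "1 + \<epsilon>3 \<noteq> 0" "1 + \<epsilon>4 \<noteq> 5 * (1 + \<epsilon>3)"
    and g: "\<And>v. v \<in> C2 \<Longrightarrow> W r5 v > 0 \<or> W r6 v > 0 \<Longrightarrow> \<epsilon>3 \<noteq> \<epsilon>4"
    and l: "\<And>k. k \<in> C1 \<Longrightarrow> \<exists>Z1 Z3 Z4. hahn_deg Z1 = ereal \<eta> \<and> hahn_deg Z3 = ereal (\<kappa> + W r3 k) \<and> hahn_deg Z4 = ereal (W r4 k) \<and>
       hahn_deg (Z1 + Z3 + Z4) = ereal (W r5 k) \<and> hahn_deg (Z1 + Z3 + Z4 + (e1 * Z1 + e3 * Z3 + e4 * Z4)) = ereal (W r6 k)"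
  shows "good_lift W r3 r4 r5 r6 C1 C2"
proof -
  have one: "lead 1 0 1" using lead_monomial[of 1 0] by (simp add: mon_0)
  \<comment> \<open>The leading coefficient of \<open>mon \<kappa>\<close> at exponent 0; it
    vanishes for \<open>\<kappa> > 0\<close>.\<close>
  define \<alpha> :: complex where "\<alpha> = (if \<kappa> = 0 then 1 else 0)"
  have lk: "lead (mon \<kappa>) 0 \<alpha>"
    using lead_monomial[of 1 \<kappa>] lead_less[OF hge_mon[of \<kappa> \<kappa> 1], of 0] kappa_nonneg by (auto simp: \<alpha>_def)
  have le: "lead (mon \<eta>) 0 0" using lead_less[OF hge_mon[of \<eta> \<eta> 1], of 0] eta_pos by simp
  have k: "\<exists>x1 y3 y4. hahn_deg x1 = ereal 0 \<and> hahn_deg y3 = ereal (W r3 k) \<and> hahn_deg y4 = ereal (W r4 k) \<and>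
        hahn_deg (y4 * 1 + y3 * mon \<kappa> + x1 * mon \<eta>) = ereal (W r5 k) \<and>
        hahn_deg (y4 * (1 + e4) + y3 * (mon \<kappa> * (1 + e3)) + x1 * (mon \<eta> * (1 + e1))) = ereal (W r6 k)" if kC: "k \<in> C1" for k
  proof -
    obtain Z1 Z3 Z4 where Z: "hahn_deg Z1 = ereal \<eta>" "hahn_deg Z3 = ereal (\<kappa> + W r3 k)" "hahn_deg Z4 = ereal (W r4 k)"
       "hahn_deg (Z1 + Z3 + Z4) = ereal (W r5 k)" "hahn_deg (Z1 + Z3 + Z4 + (e1 * Z1 + e3 * Z3 + e4 * Z4)) = ereal (W r6 k)"
      using l[OF kC] by blast
    have 1: "mon (- \<eta>) * Z1 * mon \<eta> = Z1" using mon_mult[of "- \<eta>" \<eta>] by (simp add: mon_0 algebra_simps)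
    have 3: "mon (- \<kappa>) * Z3 * mon \<kappa> = Z3" using mon_mult[of "- \<kappa>" \<kappa>] by (simp add: mon_0 algebra_simps)
    have s5: "Z4 * 1 + mon (- \<kappa>) * Z3 * mon \<kappa> + mon (- \<eta>) * Z1 * mon \<eta> = Z1 + Z3 + Z4" unfolding 1 3 by simp
    have s6: "Z4 * (1 + e4) + mon (- \<kappa>) * Z3 * (mon \<kappa> * (1 + e3)) + mon (- \<eta>) * Z1 * (mon \<eta> * (1 + e1))
      = Z1 + Z3 + Z4 + (e1 * Z1 + e3 * Z3 + e4 * Z4)"
      unfolding mult.assoc[symmetric] 1 3 by (simp add: algebra_simps)
    show ?thesis
      using hahn_deg_mon_mult[OF Z(1), of "- \<eta>"] hahn_deg_mon_mult[OF Z(2), of "- \<kappa>"] Z(3-5)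
      by (intro exI[of _ "mon (- \<eta>) * Z1"] exI[of _ "mon (- \<kappa>) * Z3"] exI[of _ Z4]) (simp only: s5 s6, simp)
  qed
  have L: "lead (1 + e4) 0 (1 + \<epsilon>4)" "lead (mon \<kappa> * (1 + e3)) 0 (\<alpha> * (1 + \<epsilon>3))" "lead (mon \<eta> * (1 + e1)) 0 0"
    using lead_add[OF one e(3)] lead_mult[OF lk lead_add[OF one e(2)]] lead_mult[OF le lead_add[OF one e(1)]] by simp_all
  show ?thesis
    unfolding good_lift_def
    apply (rule exI[of _ 1], rule exI[of _ "mon \<kappa>"], rule exI[of _ "mon \<eta>"])
    apply (rule exI[of _ "1 + e4"], rule exI[of _ "mon \<kappa> * (1 + e3)"], rule exI[of _ "mon \<eta> * (1 + e1)"])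
    apply (rule exI[of _ 1], rule exI[of _ \<alpha>], rule exI[of _ "1 + \<epsilon>4"], rule exI[of _ "\<alpha> * (1 + \<epsilon>3)"])
    using one lk le L k nz g groups by (auto simp: \<alpha>_def)
qed

text \<open>Subtracting \<open>N\<close> makes the least of the three ray coordinates 0, which
  places the centre of the star at the origin.\<close>

definition N :: "'c \<Rightarrow> real" where "N c = min (\<eta> + W p1 c) (min (\<kappa> + W r3 c) (W r4 c))"

definition M :: "'r \<Rightarrow> 'c \<Rightarrow> real" where
  "M r c = W r c + (if r = p1 then \<eta> else if r = r3 then \<kappa> else 0) - N c"

lemma M_no_dominant_minor: "no_dominant_minor M"
  unfolding M_def[abs_def] by (rule no_dominant_minor_shift[OF W])

lemma M_simps: "M p1 c = \<eta> + W p1 c - N c" "M r3 c = \<kappa> + W r3 c - N c" "M r4 c = W r4 c - N c"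
  "M r5 c = W r5 c - N c" "M r6 c = W r6 c - N c"
  using rows by (auto simp: M_def)

lemma N_C2: "v \<in> C2 \<Longrightarrow> N v = 0"
  using c2[of v] groups[of v] kappa_nonneg eta_pos unfolding N_def by (smt (verit))

end

text \<open>Up to the exceptional columns with \<open>\<kappa> + W r3 c = \<eta>\<close>, a strictly least entry among \<open>r4, r5, r6\<close> occurs in row \<open>r4\<close> only,
  so that all columns lie on the star with rays \<open>p1, r3, r4\<close>.\<close>

locale block_star = block_normed W p1 p2 r3 r4 r5 r6 C1 C2 v3 v0 \<kappa> \<eta>
  for W :: "'r \<Rightarrow> 'c::finite \<Rightarrow> real" and p1 p2 r3 r4 r5 r6 C1 C2 v3 v0 \<kappa> \<eta> +
  assumes XL: "c \<in> C1 \<Longrightarrow> (W r5 c < W r4 c \<and> W r5 c < W r6 c) \<or> (W r6 c < W r4 c \<and> W r6 c < W r5 c) \<Longrightarrow> \<kappa> + W r3 c = \<eta>"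
    and XM: "c \<in> C1 \<Longrightarrow> c' \<in> C1 \<Longrightarrow> (W r5 c < W r4 c \<and> W r5 c < W r6 c) \<or> (W r6 c < W r4 c \<and> W r6 c < W r5 c) \<Longrightarrow>
       m c' \<le> m c"
begin

lemma min_twice_C1: 
  assumes c: "c \<in> C1" shows "min_twice4 \<eta> (\<kappa> + W r3 c) (W r4 c) (W r5 c)" "min_twice4 \<eta> (\<kappa> + W r3 c) (W r4 c) (W r6 c)"
  using block_normed.N[OF block_normed_axioms c] XL[OF c] unfolding min_twice4_def by (smt (verit))+

lemma min_twice_C2:
  assumes c: "v \<in> C2" shows "min_twice4 (\<eta> + W p1 v) (\<kappa> + W r3 v) (W r4 v) (W r5 v)" "min_twice4 (\<eta> + W p1 v) (\<kappa> + W r3 v) (W r4 v) (W r6 v)"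
  using c2[OF c] groups[OF c] kappa_nonneg eta_pos unfolding min_twice4_def by (smt (verit))+

lemma min_twice_all:
  assumes c: "c \<in> C1 \<union> C2"
  shows "min_twice4 (\<eta> + W p1 c) (\<kappa> + W r3 c) (W r4 c) (W r5 c)" "min_twice4 (\<eta> + W p1 c) (\<kappa> + W r3 c) (W r4 c) (W r6 c)"
  using min_twice_C1 min_twice_C2 c c1(1) by auto

lemma M_nn:
  assumes c: "c \<in> C1 \<union> C2"
  shows "M p1 c \<ge> 0" "M r3 c \<ge> 0" "M r4 c \<ge> 0" "M r5 c \<ge> 0" "M r6 c \<ge> 0"
  using min_twice_all[OF c] unfolding M_simps N_def min_twice4_def by (smt (verit))+

lemma M_v3: "M p1 v3 > 0" "M r3 v3 > 0" "M r4 v3 = 0" "M r5 v3 = 0" "M r6 v3 = 0"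
  using N_C2[OF v3(1)] v3 v3z kappa_nonneg eta_pos unfolding M_simps by auto

lemma M_v0: "\<kappa> = 0 \<Longrightarrow> M r3 v0 = 0" "M p1 v0 > 0" "M r4 v0 \<ge> 0" "M r5 v0 \<ge> 0" "M r6 v0 \<ge> 0"
  using N_C2[OF v0(1)] v0 v0z kappa_nonneg eta_pos unfolding M_simps by auto

definition U :: "'c set" where
  "U = {c \<in> C1 \<union> C2. c \<noteq> v3 \<and> ((M p1 c = 0 \<and> M r3 c = 0) \<or> (M p1 c = 0 \<and> M r4 c = 0) \<or> (M r3 c = 0 \<and> M r4 c = 0))}"

definition d :: "'c \<Rightarrow> real" where "d c = min (M r5 c) (M r6 c)"

text \<open>The three lemmas supply \<open>H6\<close> ray by ray: here by a column attaining \<eta>,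
  for \<open>r3\<close> by \<open>v0\<close> or a column attaining \<kappa>, and for
  \<open>r4\<close> by the assumption \<open>XM\<close>.\<close>

lemma H6_p1:
  assumes U: "u \<in> U" "u' \<in> U" and a: "0 < M p1 u" "0 < M p1 u'" "M r5 u < M r6 u" 
    "d u < d u'" "d u < M p1 u" "d u < M p1 u'"
  shows False
proof -
  obtain h where h: "h \<in> C1" "\<eta> \<le> \<kappa> + W r3 h" "\<eta> \<le> W r4 h" using eta_attained by blast
  then have h0: "M p1 h = 0" using c1(1)[OF h(1)] unfolding M_simps N_def by auto
  have e: "M r3 u = 0" "M r3 u' = 0" "M r5 u = d u" "d u' \<le> M r5 u'" "d u' \<le> M r6 u'" "u \<noteq> v3" "u' \<noteq> v3"
    and UC: "u \<in> C1 \<union> C2" "u' \<in> C1 \<union> C2"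
    using U a unfolding U_def d_def by auto
  have hC: "h \<in> C1 \<union> C2" using h by simp
  have "dominant4 M r5 p1 r3 r6 u h u' v3"
    unfolding dominant4_def using a h0 e M_nn[OF hC] M_nn[OF UC(1)] M_nn[OF UC(2)] M_v3 by (intro conjI; linarith)
  then show False
    by (rule no_dominant_minorD[OF M_no_dominant_minor, rotated 2]) (use rows e a h0 cne[OF h(1) v3(1)] in auto)
qed

lemma H6_r3:
  assumes U: "u \<in> U" "u' \<in> U" and a: "0 < M r3 u" "0 < M r3 u'" "M r5 u < M r6 u" 
    "d u < d u'" "d u < M r3 u" "d u < M r3 u'"
  shows False
proof -
  have e: "M p1 u = 0" "M p1 u' = 0" "M r4 u = 0" "M r4 u' = 0" "M r5 u = d u" "d u' \<le> M r5 u'" "d u' \<le> M r6 u'" "u \<noteq> v3" "u' \<noteq> v3"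
    and UC: "u \<in> C1 \<union> C2" "u' \<in> C1 \<union> C2"
    using U a unfolding U_def d_def by auto
  have "M p1 v > 0" if "v \<in> C2" for v using c2(1)[OF that] N_C2[OF that] eta_pos unfolding M_simps by simp
  then have C: "u \<in> C1" "u' \<in> C1" using e UC by force+
  have ne: "u \<noteq> u'" using a by auto
  show False
  proof (cases "\<kappa> = 0")
    case True
    have "dominant4 M r5 p1 r3 r6 u u' v0 v3"
      unfolding dominant4_def using a e M_v0 True M_v3 M_nn[OF UC(1)] M_nn[OF UC(2)] by (intro conjI; linarith)
    then show False
      by (rule no_dominant_minorD[OF M_no_dominant_minor, rotated 2]) (use rows e ne cne[OF _ v3(1)] cne[OF _ v0(1)] C vne in auto)
  next
    case False
    then obtain w where w: "w \<in> C1" "\<kappa> + W r3 w \<le> \<eta>" "\<kappa> + W r3 w \<le> W r4 w"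
      using witness by blast
    then have w0: "M r3 w = 0" using c1(1)[OF w(1)] unfolding M_simps N_def by auto
    have wC: "w \<in> C1 \<union> C2" using w by simp
    have "dominant4 M r5 r4 r3 r6 u u' w v3"
      unfolding dominant4_def using a e w0 M_v3 M_nn[OF UC(1)] M_nn[OF UC(2)] M_nn[OF wC] by (intro conjI; linarith)
    then show False
      by (rule no_dominant_minorD[OF M_no_dominant_minor, rotated 2]) (use rows e ne w w0 a cne[OF _ v3(1)] C in auto)
  qed
qed

lemma H6_r4:
  assumes U: "u \<in> U" "u' \<in> U" and a: "0 < M r4 u" "0 < M r4 u'" "M r5 u < M r6 u" 
    "d u < d u'" "d u < M r4 u" "d u < M r4 u'"
  shows False
proof -
  have e: "M p1 u = 0" "M p1 u' = 0" and UC: "u \<in> C1 \<union> C2" "u' \<in> C1 \<union> C2"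
    using U a unfolding U_def d_def by auto
  have "M p1 v > 0" if "v \<in> C2" for v using c2(1)[OF that] N_C2[OF that] eta_pos unfolding M_simps by simp
  then have C: "u \<in> C1" "u' \<in> C1" using e UC by force+
  have "N u = \<eta>" "N u' = \<eta>" using e c1(1) C by (auto simp: M_simps)
  then have "W r5 u < W r4 u \<and> W r5 u < W r6 u" "m u < m u'"
    using a unfolding d_def M_simps m_def by auto
  then show False using XM[OF C] by auto
qed

lemma block_star_swap: "block_star W p1 p2 r3 r4 r6 r5 C1 C2 v3 v0 \<kappa> \<eta>"
proof -
  have c: "block_normed W p1 p2 r3 r4 r6 r5 C1 C2 v3 v0 \<kappa> \<eta>"
    using all_perms_normed[of "\<lambda>a b c. block_normed W p1 p2 r3 a b c C1 C2 v3 v0 \<kappa> \<eta>"] by blast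
  have "block W p1 p2 r3 r4 r6 r5 C1 C2 v3 v0" using c by (rule block_normed.axioms)
  then have "block.m W r4 r6 r5 c = m c" for c unfolding m_def by (simp add: block.m_def min.commute min.left_commute)
  then show ?thesis
    by (intro block_star.intro[OF c] block_star_axioms.intro) (use XL XM in auto)
qed

lemma swap_d: "block_star.d W p1 r3 r4 r6 r5 \<kappa> \<eta> = d" 
  by (simp add: block_star.d_def[OF block_star_swap] d_def min.commute fun_eq_iff)

end

section \<open>Fitting \<open>r5\<close> and \<open>r6\<close> to the star\<close>

context block_star begin

lemma H6:
  assumes i: "i \<in> {p1, r3, r4}" and U: "u \<in> U" "u' \<in> U" and a: "M i u > 0" "M i u' > 0" "M r5 u \<noteq> M r6 u"
        "d u < d u'" "d u < M i u" "d u < M i u'"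
  shows False
proof -
  note 5 = H6_p1[OF U] H6_r3[OF U] H6_r4[OF U]
  note 6 = block_star.H6_p1[OF block_star_swap U] block_star.H6_r3[OF block_star_swap U] block_star.H6_r4[OF block_star_swap U]
  show False
    using i a 5 6[unfolded swap_d] by (elim insertE; cases "M r5 u < M r6 u") auto
qed

definition off :: "real \<Rightarrow> 'c \<Rightarrow> bool" where
  "off h u \<longleftrightarrow> (M r5 u \<noteq> M r6 u \<longrightarrow> d u = h) \<and> (M r5 u = M r6 u \<longrightarrow> d u \<le> h)"

lemma star:
  "\<exists>h\<ge>0. (\<forall>u\<in>U. if \<exists>i\<in>{p1, r3, r4}. M i u > 0 then off h u else (M r5 u \<noteq> M r6 u \<longrightarrow> h \<le> d u)) \<or>
    (\<exists>i\<in>{p1, r3, r4}. (\<exists>u\<in>U. M i u > 0) \<and> 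
       (\<exists>\<tau>>0. \<forall>u\<in>U. if M i u > 0 then min_twice4 (M r5 u) (M r6 u) (h + M i u) (h + \<tau>) else off h u))"
  unfolding off_def
proof (rule star_minors[OF M_no_dominant_minor, where z = v3])
  show "\<exists>j\<in>{p1, r3, r4}. j \<noteq> i \<and> j \<noteq> k" for i k using rows by auto
  show "i = j" if "u \<in> U" "i \<in> {p1, r3, r4}" "j \<in> {p1, r3, r4}" "0 < M i u" "0 < M j u" for i j u
    using that unfolding U_def by auto
  show "finite U" by simp
  show "d u = min (M r5 u) (M r6 u)" for u by (rule d_def)
  show "r5 \<noteq> r6" "r5 \<notin> {p1, r3, r4}" "r6 \<notin> {p1, r3, r4}" using rows by auto
  have UC: "u \<in> C1 \<union> C2" if "u \<in> U" for u using that unfolding U_def by blast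
  show "M i u \<ge> 0" if "u \<in> U" "i \<in> {p1, r3, r4}" for i u using M_nn[OF UC[OF that(1)]] that(2) by blast
  show "M r5 u \<ge> 0" "M r6 u \<ge> 0" if "u \<in> U" for u using M_nn[OF UC[OF that]] by blast+
  show "v3 \<notin> U" unfolding U_def by simp
  show "M r5 v3 = 0" "M r6 v3 = 0" by (fact M_v3)+
  show "M i v3 \<ge> 0" if "i \<in> {p1, r3, r4}" for i using M_v3 that by auto
qed (rule H6)

lemma U_iff: "c \<in> C1 \<Longrightarrow> c \<in> U \<longleftrightarrow> (\<eta> = N c \<and> \<kappa> + W r3 c = N c) \<or> (\<eta> = N c \<and> W r4 c = N c) \<or> (\<kappa> + W r3 c = N c \<and> W r4 c = N c)"
  unfolding U_def M_simps using c1(1)[of c] cne(1)[OF _ v3(1)] by auto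

lemma M_C1: "c \<in> C1 \<Longrightarrow> M p1 c = \<eta> - N c" unfolding M_simps using c1(1) by simp

lemma off_iff: "off h u \<longleftrightarrow> (W r5 u - N u \<noteq> W r6 u - N u \<longrightarrow> min (W r5 u - N u) (W r6 u - N u) = h) \<and>
    (W r5 u - N u = W r6 u - N u \<longrightarrow> min (W r5 u - N u) (W r6 u - N u) \<le> h)"
  unfolding off_def d_def M_simps ..

lemma N_C1: "c \<in> C1 \<Longrightarrow> N c = min \<eta> (min (\<kappa> + W r3 c) (W r4 c))"
  unfolding N_def using c1(1) by simp

text \<open>Such a column lies on the ray \<open>p1\<close> at exact height 0. It therefore rules
  out a line leaving on that ray and forces \<open>h = 0\<close> otherwise, which is what makes
  \<epsilon>3 and \<epsilon>4 distinct in \<open>good_liftI\<close>.\<close>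

lemma group56:
  assumes v: "v \<in> C2" "W r5 v > 0 \<or> W r6 v > 0"
  shows "v \<in> U" "M r3 v = 0" "M r4 v = 0" "d v = 0" "M r5 v \<noteq> M r6 v" "M p1 v > 0"
proof -
  have k: "\<kappa> = 0" using groups[OF v(1)] v(2) by blast
  have z: "W r3 v = 0" "W r4 v = 0" "W r5 v = 0 \<or> W r6 v = 0" using c2[OF v(1)] v by auto
  show "M r3 v = 0" "M r4 v = 0" "d v = 0" "M r5 v \<noteq> M r6 v" "M p1 v > 0"
    using k z v N_C2[OF v(1)] c2[OF v(1)] eta_pos unfolding M_simps d_def by auto
  then show "v \<in> U" using v z v3 unfolding U_def by auto
qed

theorem good_lift_star: "good_lift W r3 r4 r5 r6 C1 C2"
proof -
  have F: "lead (monomial c h) 0 (if h = 0 then c else 0)" if "h \<ge> 0" for c h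
    using lead_monomial[of c 0] lead_less[OF hge_mon[of h h c], of 0] that by auto
  have zero: "lead 0 0 0" using F[of 0 0] by (simp add: lead_def zero_hahn.rep_eq)
  obtain h where h: "h \<ge> 0" and hh: "(\<forall>u\<in>U. if \<exists>i\<in>{p1, r3, r4}. M i u > 0 then off h u else (M r5 u \<noteq> M r6 u \<longrightarrow> h \<le> d u)) \<or>
    (\<exists>i\<in>{p1, r3, r4}. (\<exists>u\<in>U. M i u > 0) \<and> 
       (\<exists>\<tau>>0. \<forall>u\<in>U. if M i u > 0 then min_twice4 (M r5 u) (M r6 u) (h + M i u) (h + \<tau>) else off h u))"
    using star by blast
  from hh show ?thesis
  proof
    assume C: "\<forall>u\<in>U. if \<exists>i\<in>{p1, r3, r4}. M i u > 0 then off h u else (M r5 u \<noteq> M r6 u \<longrightarrow> h \<le> d u)"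
    have h0: "h = 0" if "v \<in> C2" "W r5 v > 0 \<or> W r6 v > 0" for v
      using C[rule_format, OF group56(1)[OF that]] group56[OF that] unfolding off_def by auto
    show ?thesis
    proof (rule good_liftI[of 0 0 "mon h" _ "monomial 2 (h + 0)"])
      show "lead (mon h) 0 (if h = 0 then 1 else 0)" "lead (monomial 2 (h + 0)) 0 (if h = 0 then 2 else 0)" using F h by auto
      show "\<exists>Z1 Z3 Z4. hahn_deg Z1 = ereal \<eta> \<and> hahn_deg Z3 = ereal (\<kappa> + W r3 k) \<and> hahn_deg Z4 = ereal (W r4 k) \<and>
        hahn_deg (Z1 + Z3 + Z4) = ereal (W r5 k) \<and>
        hahn_deg (Z1 + Z3 + Z4 + (0 * Z1 + mon h * Z3 + monomial 2 (h + 0) * Z4)) = ereal (W r6 k)" if k: "k \<in> C1" for k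
      proof -
        have "\<exists>Z3 Z4 Z1. hahn_deg Z3 = ereal (\<kappa> + W r3 k) \<and> hahn_deg Z4 = ereal (W r4 k) \<and> hahn_deg Z1 = ereal \<eta> \<and>
          hahn_deg (Z3 + Z4 + Z1) = ereal (W r5 k) \<and>
          hahn_deg (Z3 + Z4 + Z1 + mon h * Z3 + monomial 2 (h + 0) * Z4) = ereal (W r6 k)"
        proof (rule plane_lift[OF h order.refl], rule plane_condition_center[OF _ _ h, where N = "N k"])
          show "min_twice4 (\<kappa> + W r3 k) (W r4 k) \<eta> (W r5 k)" "min_twice4 (\<kappa> + W r3 k) (W r4 k) \<eta> (W r6 k)"
            using min_twice_C1[OF k] unfolding min_twice4_def by argo+
          show "N k = min (\<kappa> + W r3 k) (min (W r4 k) \<eta>)" using N_C1[OF k] by auto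
          assume "(\<kappa> + W r3 k = N k \<and> W r4 k = N k) \<or> (\<kappa> + W r3 k = N k \<and> \<eta> = N k) \<or> (W r4 k = N k \<and> \<eta> = N k)"
          then have kU: "k \<in> U" unfolding U_iff[OF k] by blast
          have e: "(\<exists>i\<in>{p1, r3, r4}. M i k > 0) \<longleftrightarrow> \<kappa> + W r3 k - N k > 0 \<or> W r4 k - N k > 0 \<or> \<eta> - N k > 0"
            using M_C1[OF k] M_simps[of k] by auto
          have f: "(M r5 k \<noteq> M r6 k \<longrightarrow> h \<le> d k) \<longleftrightarrow> (W r5 k - N k \<noteq> W r6 k - N k \<longrightarrow> h \<le> min (W r5 k - N k) (W r6 k - N k))"
            unfolding d_def M_simps ..
          show "if \<kappa> + W r3 k - N k > 0 \<or> W r4 k - N k > 0 \<or> \<eta> - N k > 0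
            then (W r5 k - N k \<noteq> W r6 k - N k \<longrightarrow> min (W r5 k - N k) (W r6 k - N k) = h) \<and>
              (W r5 k - N k = W r6 k - N k \<longrightarrow> min (W r5 k - N k) (W r6 k - N k) \<le> h)
            else (W r5 k - N k \<noteq> W r6 k - N k \<longrightarrow> h \<le> min (W r5 k - N k) (W r6 k - N k))"
            using C[rule_format, OF kU] unfolding e f off_iff .
        qed
        then obtain Z3 Z4 Z1 where "hahn_deg Z3 = ereal (\<kappa> + W r3 k) \<and> hahn_deg Z4 = ereal (W r4 k) \<and> hahn_deg Z1 = ereal \<eta> \<and>
          hahn_deg (Z3 + Z4 + Z1) = ereal (W r5 k) \<and>
          hahn_deg (Z3 + Z4 + Z1 + mon h * Z3 + monomial 2 (h + 0) * Z4) = ereal (W r6 k)" by blast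
        then show ?thesis by (intro exI[of _ Z1] exI[of _ Z3] exI[of _ Z4]) (simp add: algebra_simps)
      qed
    qed (use zero h0 in auto)
  next
    assume "\<exists>i\<in>{p1, r3, r4}. (\<exists>u\<in>U. M i u > 0) \<and> 
       (\<exists>\<tau>>0. \<forall>u\<in>U. if M i u > 0 then min_twice4 (M r5 u) (M r6 u) (h + M i u) (h + \<tau>) else off h u)"
    then obtain i \<tau> where i: "i \<in> {p1, r3, r4}" and t: "\<tau> > 0"
      and L: "\<And>u. u \<in> U \<Longrightarrow> if M i u > 0 then min_twice4 (M r5 u) (M r6 u) (h + M i u) (h + \<tau>) else off h u" by blast
    have ht: "h + \<tau> > 0" "\<tau> \<ge> 0" using h t by auto
    have F2: "lead (monomial 2 (h + \<tau>)) 0 0" using F[of "h + \<tau>" 2] ht by simp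
    from i consider "i = p1" | "i = r3" | "i = r4" by blast
    then show ?thesis
    proof cases
      case 1
      have nog: False if "v \<in> C2" "W r5 v > 0 \<or> W r6 v > 0" for v
        using L[OF group56(1)[OF that]] group56[OF that] ht h unfolding min_twice4_def 1 d_def by (auto simp: min_def split: if_splits)
      show ?thesis
      proof (rule good_liftI[of "mon h" _ 0 0 "monomial 2 (h + \<tau>)" 0])
        show "lead (mon h) 0 (if h = 0 then 1 else 0)" "lead (monomial 2 (h + \<tau>)) 0 0" using F h F2 by auto
        show "\<exists>Z1 Z3 Z4. hahn_deg Z1 = ereal \<eta> \<and> hahn_deg Z3 = ereal (\<kappa> + W r3 k) \<and> hahn_deg Z4 = ereal (W r4 k) \<and>
          hahn_deg (Z1 + Z3 + Z4) = ereal (W r5 k) \<and>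
          hahn_deg (Z1 + Z3 + Z4 + (mon h * Z1 + 0 * Z3 + monomial 2 (h + \<tau>) * Z4)) = ereal (W r6 k)" if k: "k \<in> C1" for k
        proof -
          have "\<exists>Z1 Z4 Z3. hahn_deg Z1 = ereal \<eta> \<and> hahn_deg Z4 = ereal (W r4 k) \<and> hahn_deg Z3 = ereal (\<kappa> + W r3 k) \<and> 
            hahn_deg (Z1 + Z4 + Z3) = ereal (W r5 k) \<and>
            hahn_deg (Z1 + Z4 + Z3 + mon h * Z1 + monomial 2 (h + \<tau>) * Z4) = ereal (W r6 k)"
          proof (rule plane_lift[OF h ht(2)], rule plane_condition_leg[OF _ _ h t, where N = "N k"])
            show "min_twice4 \<eta> (W r4 k) (\<kappa> + W r3 k) (W r5 k)" "min_twice4 \<eta> (W r4 k) (\<kappa> + W r3 k) (W r6 k)"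
              using min_twice_C1[OF k] unfolding min_twice4_def by argo+
            show "N k = min (\<eta>) (min (W r4 k) (\<kappa> + W r3 k))" using N_C1[OF k] by auto
            assume "(\<eta> = N k \<and> W r4 k = N k) \<or> (\<eta> = N k \<and> \<kappa> + W r3 k = N k) \<or> (W r4 k = N k \<and> \<kappa> + W r3 k = N k)"
            then have kU: "k \<in> U" unfolding U_iff[OF k] by blast
            show "if \<eta> - N k > 0 then min_twice4 (W r5 k - N k) (W r6 k - N k) (h + (\<eta> - N k)) (h + \<tau>)
              else (W r5 k - N k \<noteq> W r6 k - N k \<longrightarrow> min (W r5 k - N k) (W r6 k - N k) = h) \<and>
                (W r5 k - N k = W r6 k - N k \<longrightarrow> min (W r5 k - N k) (W r6 k - N k) \<le> h)"
              using L[OF kU] unfolding 1 M_C1[OF k] M_simps(4,5) off_iff .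
          qed
          then obtain Z1 Z4 Z3 where "hahn_deg Z1 = ereal \<eta> \<and> hahn_deg Z4 = ereal (W r4 k) \<and> hahn_deg Z3 = ereal (\<kappa> + W r3 k) \<and> 
            hahn_deg (Z1 + Z4 + Z3) = ereal (W r5 k) \<and>
            hahn_deg (Z1 + Z4 + Z3 + mon h * Z1 + monomial 2 (h + \<tau>) * Z4) = ereal (W r6 k)" by blast
          then show ?thesis by (intro exI[of _ Z1] exI[of _ Z3] exI[of _ Z4]) (simp add: algebra_simps)
        qed
      qed (use zero nog in auto)
    next
      case 2
      have h0: "h = 0" if "v \<in> C2" "W r5 v > 0 \<or> W r6 v > 0" for v
        using L[OF group56(1)[OF that]] group56[OF that] unfolding 2 off_def by auto
      show ?thesis
      proof (rule good_liftI[of 0 0 "mon h" _ "monomial 2 (h + \<tau>)" 0])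
        show "lead (mon h) 0 (if h = 0 then 1 else 0)" "lead (monomial 2 (h + \<tau>)) 0 0" using F h F2 by auto
        show "\<exists>Z1 Z3 Z4. hahn_deg Z1 = ereal \<eta> \<and> hahn_deg Z3 = ereal (\<kappa> + W r3 k) \<and> hahn_deg Z4 = ereal (W r4 k) \<and>
          hahn_deg (Z1 + Z3 + Z4) = ereal (W r5 k) \<and>
          hahn_deg (Z1 + Z3 + Z4 + (0 * Z1 + mon h * Z3 + monomial 2 (h + \<tau>) * Z4)) = ereal (W r6 k)" if k: "k \<in> C1" for k
        proof -
          have "\<exists>Z3 Z4 Z1. hahn_deg Z3 = ereal (\<kappa> + W r3 k) \<and> hahn_deg Z4 = ereal (W r4 k) \<and> hahn_deg Z1 = ereal \<eta> \<and>
            hahn_deg (Z3 + Z4 + Z1) = ereal (W r5 k) \<and>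
            hahn_deg (Z3 + Z4 + Z1 + mon h * Z3 + monomial 2 (h + \<tau>) * Z4) = ereal (W r6 k)"
          proof (rule plane_lift[OF h ht(2)], rule plane_condition_leg[OF _ _ h t, where N = "N k"])
            show "min_twice4 (\<kappa> + W r3 k) (W r4 k) \<eta> (W r5 k)" "min_twice4 (\<kappa> + W r3 k) (W r4 k) \<eta> (W r6 k)"
              using min_twice_C1[OF k] unfolding min_twice4_def by argo+
            show "N k = min (\<kappa> + W r3 k) (min (W r4 k) (\<eta>))" using N_C1[OF k] by auto
            assume "(\<kappa> + W r3 k = N k \<and> W r4 k = N k) \<or> (\<kappa> + W r3 k = N k \<and> \<eta> = N k) \<or> (W r4 k = N k \<and> \<eta> = N k)"
            then have kU: "k \<in> U" unfolding U_iff[OF k] by blast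
            show "if \<kappa> + W r3 k - N k > 0 then min_twice4 (W r5 k - N k) (W r6 k - N k) (h + (\<kappa> + W r3 k - N k)) (h + \<tau>)
              else (W r5 k - N k \<noteq> W r6 k - N k \<longrightarrow> min (W r5 k - N k) (W r6 k - N k) = h) \<and>
                (W r5 k - N k = W r6 k - N k \<longrightarrow> min (W r5 k - N k) (W r6 k - N k) \<le> h)"
              using L[OF kU] unfolding 2 M_simps(2) M_simps(4,5) off_iff .
          qed
          then obtain Z3 Z4 Z1 where "hahn_deg Z3 = ereal (\<kappa> + W r3 k) \<and> hahn_deg Z4 = ereal (W r4 k) \<and> hahn_deg Z1 = ereal \<eta> \<and>
            hahn_deg (Z3 + Z4 + Z1) = ereal (W r5 k) \<and>
            hahn_deg (Z3 + Z4 + Z1 + mon h * Z3 + monomial 2 (h + \<tau>) * Z4) = ereal (W r6 k)" by blast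
          then show ?thesis by (intro exI[of _ Z1] exI[of _ Z3] exI[of _ Z4]) (simp add: algebra_simps)
        qed
      qed (use zero h0 in auto)
    next
      case 3
      have h0: "h = 0" if "v \<in> C2" "W r5 v > 0 \<or> W r6 v > 0" for v
        using L[OF group56(1)[OF that]] group56[OF that] unfolding 3 off_def by auto
      show ?thesis
      proof (rule good_liftI[of 0 0 "monomial 2 (h + \<tau>)" 0 "mon h"])
        show "lead (mon h) 0 (if h = 0 then 1 else 0)" "lead (monomial 2 (h + \<tau>)) 0 0" using F h F2 by auto
        show "\<exists>Z1 Z3 Z4. hahn_deg Z1 = ereal \<eta> \<and> hahn_deg Z3 = ereal (\<kappa> + W r3 k) \<and> hahn_deg Z4 = ereal (W r4 k) \<and>
          hahn_deg (Z1 + Z3 + Z4) = ereal (W r5 k) \<and>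
          hahn_deg (Z1 + Z3 + Z4 + (0 * Z1 + monomial 2 (h + \<tau>) * Z3 + mon h * Z4)) = ereal (W r6 k)" if k: "k \<in> C1" for k
        proof -
          have "\<exists>Z4 Z3 Z1. hahn_deg Z4 = ereal (W r4 k) \<and> hahn_deg Z3 = ereal (\<kappa> + W r3 k) \<and> hahn_deg Z1 = ereal \<eta> \<and>
            hahn_deg (Z4 + Z3 + Z1) = ereal (W r5 k) \<and>
            hahn_deg (Z4 + Z3 + Z1 + mon h * Z4 + monomial 2 (h + \<tau>) * Z3) = ereal (W r6 k)"
          proof (rule plane_lift[OF h ht(2)], rule plane_condition_leg[OF _ _ h t, where N = "N k"])
            show "min_twice4 (W r4 k) (\<kappa> + W r3 k) \<eta> (W r5 k)" "min_twice4 (W r4 k) (\<kappa> + W r3 k) \<eta> (W r6 k)"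
              using min_twice_C1[OF k] unfolding min_twice4_def by argo+
            show "N k = min (W r4 k) (min (\<kappa> + W r3 k) (\<eta>))" using N_C1[OF k] by auto
            assume "(W r4 k = N k \<and> \<kappa> + W r3 k = N k) \<or> (W r4 k = N k \<and> \<eta> = N k) \<or> (\<kappa> + W r3 k = N k \<and> \<eta> = N k)"
            then have kU: "k \<in> U" unfolding U_iff[OF k] by blast
            show "if W r4 k - N k > 0 then min_twice4 (W r5 k - N k) (W r6 k - N k) (h + (W r4 k - N k)) (h + \<tau>)
              else (W r5 k - N k \<noteq> W r6 k - N k \<longrightarrow> min (W r5 k - N k) (W r6 k - N k) = h) \<and>
                (W r5 k - N k = W r6 k - N k \<longrightarrow> min (W r5 k - N k) (W r6 k - N k) \<le> h)"
              using L[OF kU] unfolding 3 M_simps(3) M_simps(4,5) off_iff .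
          qed
          then obtain Z4 Z3 Z1 where "hahn_deg Z4 = ereal (W r4 k) \<and> hahn_deg Z3 = ereal (\<kappa> + W r3 k) \<and> hahn_deg Z1 = ereal \<eta> \<and>
            hahn_deg (Z4 + Z3 + Z1) = ereal (W r5 k) \<and>
            hahn_deg (Z4 + Z3 + Z1 + mon h * Z4 + monomial 2 (h + \<tau>) * Z3) = ereal (W r6 k)" by blast
          then show ?thesis by (intro exI[of _ Z1] exI[of _ Z3] exI[of _ Z4]) (simp add: algebra_simps)
        qed
      qed (use zero h0 in auto)
    qed
  qed
qed

end

section \<open>The case of a caterpillar\<close>

text \<open>\<open>cL\<close> forces the coefficient vectors of \<open>r3\<close> and \<open>r4\<close> to be close to each other, and \<open>cR\<close> those of \<open>p1\<close> and \<open>r6\<close>.\<close>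

locale block_caterpillar = block_normed W p1 p2 r3 r4 r5 r6 C1 C2 v3 v0 \<kappa> \<eta>
  for W :: "'r \<Rightarrow> 'c::finite \<Rightarrow> real" and p1 p2 r3 r4 r5 r6 C1 C2 v3 v0 \<kappa> \<eta> +
  fixes cL cR :: 'c
  assumes cL: "cL \<in> C1" "W r4 cL < W r5 cL" "W r4 cL < W r6 cL" "W r4 cL < \<eta>"
    and cR: "cR \<in> C1" "W r6 cR < W r4 cR" "W r6 cR < W r5 cR" "\<eta> < \<kappa> + W r3 cR"
    and mY: "c \<in> C1 \<Longrightarrow> m c \<le> \<eta>"
begin

lemma cL_a: "\<kappa> + W r3 cL = W r4 cL"
  using block_normed.N(1)[OF block_normed_axioms cL(1)] cL by (smt (verit))

lemma cR_q: "W r6 cR = \<eta>"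
  using block_normed.N(1)[OF block_normed_axioms cR(1)] cR by (smt (verit))

lemma no_L5: "c \<in> C1 \<Longrightarrow> W r5 c < W r4 c \<Longrightarrow> W r5 c < W r6 c \<Longrightarrow> W r5 c < \<eta> \<Longrightarrow> False"
  using sharp_low_same[OF cL(1) _ _ cL(2,3), of c] eta_attained cL(4) unfolding m_def by fastforce

lemma no_L6: "c \<in> C1 \<Longrightarrow> W r6 c < W r4 c \<Longrightarrow> W r6 c < W r5 c \<Longrightarrow> W r6 c < \<eta> \<Longrightarrow> False"
proof -
  assume c: "c \<in> C1" "W r6 c < W r4 c" "W r6 c < W r5 c" "W r6 c < \<eta>"
  have p: "block_normed W p1 p2 r3 r4 r6 r5 C1 C2 v3 v0 \<kappa> \<eta>"
    using all_perms_normed(2)[of "\<lambda>a b c. block_normed W p1 p2 r3 a b c C1 C2 v3 v0 \<kappa> \<eta>"] by blast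
  obtain h where h: "h \<in> C1" "\<eta> \<le> W r4 h" "\<eta> \<le> W r5 h" "\<eta> \<le> W r6 h" using eta_attained by blast
  show False
    by (rule block_normed.sharp_low_same[OF p cL(1) c(1) h(1) cL(3,2) c(2,3)])
      (use h cL c in \<open>simp_all add: block.m_def[OF block_normed.axioms(1)[OF p]]\<close>)
qed

lemma no_R5: "c \<in> C1 \<Longrightarrow> W r5 c < W r4 c \<Longrightarrow> W r5 c < W r6 c \<Longrightarrow> \<eta> < \<kappa> + W r3 c \<Longrightarrow> False"
proof -
  assume c: "c \<in> C1" "W r5 c < W r4 c" "W r5 c < W r6 c" "\<eta> < \<kappa> + W r3 c"
  have p: "block_normed W p1 p2 r3 r5 r6 r4 C1 C2 v3 v0 \<kappa> \<eta>"
    using all_perms_normed(4)[of "\<lambda>a b c. block_normed W p1 p2 r3 a b c C1 C2 v3 v0 \<kappa> \<eta>"] by blast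
  show False
    by (rule block_normed.sharp_high_same[OF p c(1) cR(1)]) (use c cR in auto)
qed

lemma N': "c \<in> C1 \<Longrightarrow> \<not> (W r4 c = W r5 c \<and> W r5 c = W r6 c) \<Longrightarrow>
        min (W r4 c) (min (W r5 c) (W r6 c)) = min (\<kappa> + W r3 c) \<eta>"
      "c \<in> C1 \<Longrightarrow> W r4 c = W r5 c \<Longrightarrow> W r5 c = W r6 c \<Longrightarrow> W r4 c \<le> min (\<kappa> + W r3 c) \<eta>"
  using block_normed.N[OF block_normed_axioms, of c] mY[of c] unfolding m_def by (smt (verit))+

lemma min_twice_q: "c \<in> C1 \<Longrightarrow> min_twice4 (\<kappa> + W r3 c) (W r4 c) (W r6 c) \<eta>"
  using N'[of c] no_L5[of c] no_L6[of c] no_R5[of c] unfolding min_twice4_def by (smt (verit))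

lemma pair_p:
  assumes c: "c \<in> C1" "c' \<in> C1" and lt: "y < \<kappa> + W r3 c'" "y < W r4 c'" "y < W r5 c'"
    and u: "\<kappa> + W r3 c = y \<and> y < W r4 c \<and> y < W r5 c \<or> W r4 c = y \<and> y < \<kappa> + W r3 c \<and> y < W r5 c \<or>
      W r5 c = y \<and> y < \<kappa> + W r3 c \<and> y < W r4 c"
  shows False
proof -
  have y: "\<eta> \<le> y" using N'[OF c(1)] no_L6[OF c(1)] u by (smt (verit))
  have q: "\<eta> \<le> W r6 c" using N'[OF c(1)] u y by (smt (verit))
  have q': "W r6 c' = \<eta>" using N'[OF c(2)] lt y by (smt (verit))
  have ne: "c \<noteq> c'" "c \<noteq> cL" "c' \<noteq> cL" using u lt y cL by auto
  have D: "distinct [c, c', cL, v3]" "distinct [c, c', cL, v3]" 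
    using ne cne[OF _ v3(1)] c cL by auto
  note F = y q q' lt cL cL_a v3 v3z kappa_nonneg
  from u show False
  proof (elim disjE conjE)
    assume u: "\<kappa> + W r3 c = y" "y < W r4 c" "y < W r5 c"
    have "dominant4 W r3 r6 r4 r5 c c' cL v3" unfolding dominant4_def using F u by (intro conjI; linarith)
    then show False by (rule no_dominant_minorD[OF W _ D(1), rotated]) (use rows in auto)
  next
    assume u: "W r4 c = y" "y < \<kappa> + W r3 c" "y < W r5 c"
    have "dominant4 W r4 r6 r3 r5 c c' cL v3" unfolding dominant4_def using F u by (intro conjI; linarith)
    then show False by (rule no_dominant_minorD[OF W _ D(1), rotated]) (use rows in auto)
  next
    assume u: "W r5 c = y" "y < \<kappa> + W r3 c" "y < W r4 c"
    have "dominant4 W r5 r6 r3 r4 c c' cL v3" unfolding dominant4_def using F u by (intro conjI; linarith)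
    then show False by (rule no_dominant_minorD[OF W _ D(1), rotated]) (use rows in auto)
  qed
qed

text \<open>\<open>x\<close> becomes the valuation of the coefficient of \<open>p1\<close> in the
  relation between \<open>p1\<close>, \<open>r3\<close>, \<open>r4\<close>, \<open>r5\<close>. It is
  the least value that is never the unique minimum; the column attaining it turns a violation into
  one excluded by \<open>pair_p\<close>, and \<open>cR\<close> makes it exceed \<eta>.\<close>

lemma exists_x: "\<exists>x>\<eta>. \<forall>c\<in>C1. min_twice4 (\<kappa> + W r3 c) (W r4 c) (W r5 c) x"
proof -
  define f where "f c = min (\<kappa> + W r3 c) (min (W r4 c) (W r5 c))" for c
  define x where "x = Max (f ` C1)"
  have le: "f c \<le> x" if "c \<in> C1" for c unfolding x_def using that by simp
  have "x \<in> f ` C1" unfolding x_def using cols by (intro Max_in) auto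
  then obtain c' where c': "c' \<in> C1" "f c' = x" by blast
  have "\<eta> < f cR" using cR cR_q unfolding f_def by auto
  then have x: "\<eta> < x" using le[OF cR(1)] by simp
  have "min_twice4 (\<kappa> + W r3 c) (W r4 c) (W r5 c) x" if c: "c \<in> C1" for c
  proof (rule ccontr)
    assume n: "\<not> min_twice4 (\<kappa> + W r3 c) (W r4 c) (W r5 c) x"
    show False
      by (rule pair_p[OF c c'(1), of "f c"])
        (use n le[OF c] c'(2) in \<open>unfold f_def min_twice4_def; smt (verit)\<close>)+
  qed
  then show ?thesis using x by blast
qed

text \<open>\<sigma> measures how close \<open>r3\<close> and \<open>r4\<close> are; it matters only
  where the two tie and may cancel. It is again extremal, and a violating column yields a minor with
  the column attaining \<sigma>, \<open>cR\<close> and \<open>v3\<close>.\<close>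

lemma exists_sigma: "\<exists>\<sigma>>0. \<forall>c\<in>C1. \<kappa> + W r3 c = W r4 c \<longrightarrow> W r4 c \<le> \<eta> \<longrightarrow> min_twice4 (\<sigma> + W r4 c) (W r5 c) (W r6 c) \<eta>"
proof -
  define Z where "Z = {c \<in> C1. \<kappa> + W r3 c = W r4 c \<and> W r4 c \<le> \<eta>}"
  define L where "L c = min (min (W r5 c) (W r6 c)) \<eta> - W r4 c" for c
  define \<sigma> where "\<sigma> = Max (L ` Z)"
  have Z: "finite Z" "cL \<in> Z" using cL cL_a by (auto simp: Z_def)
  have le: "L c \<le> \<sigma>" if "c \<in> Z" for c unfolding \<sigma>_def using that Z by simp
  have "\<sigma> \<in> L ` Z" unfolding \<sigma>_def using Z by (intro Max_in) auto
  then obtain u' where u': "u' \<in> Z" "L u' = \<sigma>" by blast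
  have "L cL > 0" using cL by (auto simp: L_def)
  then have s0: "\<sigma> > 0" using le[OF Z(2)] by simp
  have "min_twice4 (\<sigma> + W r4 c) (W r5 c) (W r6 c) \<eta>" if c: "c \<in> Z" for c
  proof (rule ccontr)
    assume n: "\<not> min_twice4 (\<sigma> + W r4 c) (W r5 c) (W r6 c) \<eta>"
    have C: "c \<in> C1" "u' \<in> C1" using c u' by (auto simp: Z_def)
    have lt: "L c < L u'" using n le[OF c] u'(2) unfolding L_def min_twice4_def by (smt (verit))
    have e: "\<kappa> + W r3 c = W r4 c" "\<kappa> + W r3 u' = W r4 u'" "W r4 u' < \<eta>" "W r4 u' < W r5 u'" "W r4 u' < W r6 u'"
      using c u' s0 unfolding Z_def L_def by auto
    have "a = min (\<kappa> + W r3 c) \<eta>" if "a = W r4 c" for a using c that unfolding Z_def by auto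
    then have "W r4 c \<le> W r5 c \<and> W r4 c \<le> W r6 c" using N'[OF C(1)] by (smt (verit))
    then have ge: "W r4 c \<le> W r5 c" "W r4 c \<le> W r6 c" by auto
    have "cR \<noteq> c" "cR \<noteq> u'" using c u' cR unfolding Z_def by auto
    then have D: "distinct [c, u', cR, v3]" "distinct [cR, u', c, v3]"
      using lt cne[OF _ v3(1)] C cR(1) by auto
    have lt': "min (min (W r5 c) (W r6 c)) \<eta> - W r4 c < W r5 u' - W r4 u'"
      "min (min (W r5 c) (W r6 c)) \<eta> - W r4 c < W r6 u' - W r4 u'"
      "min (min (W r5 c) (W r6 c)) \<eta> - W r4 c < \<eta> - W r4 u'"
      using lt unfolding L_def by auto
    note F = e ge cR cR_q v3 v3z kappa_nonneg c1(1)[OF C(1)] c1(1)[OF C(2)] c1(1)[OF cR(1)]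
      c1(3)[OF C(1)] c1(3)[OF C(2)] c1(3)[OF cR(1)]
    consider "W r5 c < W r6 c" "W r5 c < \<eta>" | "W r6 c < W r5 c" "W r6 c < \<eta>" | "\<eta> < W r5 c" "\<eta> < W r6 c"
      using n le[OF c] unfolding L_def min_twice4_def by (smt (verit))
    then show False
    proof cases
      case 1
      then have "W r5 c - W r4 c < W r5 u' - W r4 u'" "W r5 c - W r4 c < W r6 u' - W r4 u'" "W r5 c - W r4 c < \<eta> - W r4 u'"
        using lt' by auto
      then have "dominant4 W r5 r3 p1 r6 c u' cR v3" unfolding dominant4_def using F 1 by (intro conjI; linarith)
      then show False by (rule no_dominant_minorD[OF W _ D(1), rotated]) (use rows in auto)
    next
      case 2
      then have "W r6 c - W r4 c < W r5 u' - W r4 u'" "W r6 c - W r4 c < W r6 u' - W r4 u'" "W r6 c - W r4 c < \<eta> - W r4 u'"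
        using lt' by auto
      then have "dominant4 W r6 r3 p1 r5 c u' cR v3" unfolding dominant4_def using F 2 by (intro conjI; linarith)
      then show False by (rule no_dominant_minorD[OF W _ D(1), rotated]) (use rows in auto)
    next
      case 3
      then have "\<eta> - W r4 c < W r5 u' - W r4 u'" "\<eta> - W r4 c < W r6 u' - W r4 u'" "\<eta> - W r4 c < \<eta> - W r4 u'"
        using lt' by auto
      then have "dominant4 W r6 r3 p1 r5 cR u' c v3" unfolding dominant4_def using F 3 by (intro conjI; linarith)
      then show False by (rule no_dominant_minorD[OF W _ D(2), rotated]) (use rows in auto)
    qed
  qed
  then show ?thesis using s0 unfolding Z_def by blast
qed

lemma no56: assumes v: "v \<in> C2" shows "W r5 v = 0 \<and> W r6 v = 0"
proof (rule ccontr)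
  assume "\<not> (W r5 v = 0 \<and> W r6 v = 0)"
  then have "W r5 v > 0 \<or> W r6 v > 0" using c2[OF v] by auto
  then have k: "\<kappa> = 0" and z: "W r3 v = 0" "W r5 v > 0 \<and> W r6 v = 0 \<or> W r6 v > 0 \<and> W r5 v = 0"
    using groups[OF v] c2[OF v] by auto
  have D: "distinct [cL, cR, v3, v]" using cne[OF _ v3(1)] cne[OF _ v] cL cR v3 z by auto
  note F = k eta_pos c1(3)[OF cL(1)] cL cL_a cR cR_q v3 v3z z(1) c2(1)[OF v] c1(1)[OF cL(1)] c1(1)[OF cR(1)]
  from z(2) show False
  proof
    assume g: "W r5 v > 0 \<and> W r6 v = 0"
    have "dominant4 W r3 p1 r5 r6 cL cR v3 v" unfolding dominant4_def using F g[THEN conjunct1] g[THEN conjunct2] by (intro conjI; linarith)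
    then show False by (rule no_dominant_minorD[OF W _ D, rotated]) (use rows in auto)
  next
    assume g: "W r6 v > 0 \<and> W r5 v = 0"
    have "dominant4 W r3 p1 r6 r5 cL cR v3 v" unfolding dominant4_def using F g[THEN conjunct1] g[THEN conjunct2] by (intro conjI; linarith)
    then show False by (rule no_dominant_minorD[OF W _ D, rotated]) (use rows in auto)
  qed
qed

theorem good_lift_caterpillar: "good_lift W r3 r4 r5 r6 C1 C2"
proof -
  obtain x where x: "\<eta> < x" and twp: "\<And>c. c \<in> C1 \<Longrightarrow> min_twice4 (\<kappa> + W r3 c) (W r4 c) (W r5 c) x"
    using exists_x by blast
  obtain \<sigma> where s: "\<sigma> > 0" and tws: "\<And>c. c \<in> C1 \<Longrightarrow> \<kappa> + W r3 c = W r4 c \<Longrightarrow> W r4 c \<le> \<eta> \<Longrightarrow>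
      min_twice4 (\<sigma> + W r4 c) (W r5 c) (W r6 c) \<eta>"
    using exists_sigma by blast
  define h where "h = x - \<eta>"
  have h: "h \<ge> 0" "\<sigma> \<ge> 0" "x > 0" using x s eta_pos by (auto simp: h_def)
  have one: "lead 1 0 1" using lead_monomial[of 1 0] by (simp add: mon_0)
  define \<alpha> :: complex where "\<alpha> = (if \<kappa> = 0 then 1 else 0)"
  have lk: "lead (mon \<kappa>) 0 \<alpha>"
    using lead_monomial[of 1 \<kappa>] lead_less[OF hge_mon[of \<kappa> \<kappa> 1], of 0] kappa_nonneg by (auto simp: \<alpha>_def)
  have lx: "lead (mon x) 0 0" using lead_less[OF hge_mon[of x x 1], of 0] h by simp
  have le: "lead (mon \<eta>) 0 0" using lead_less[OF hge_mon[of \<eta> \<eta> 1], of 0] eta_pos by simp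
  have ls: "lead (monomial 2 \<sigma>) 0 0" using lead_less[OF hge_mon[of \<sigma> \<sigma> 2], of 0] s by simp
  have k: "\<exists>x1 y3 y4. hahn_deg x1 = ereal 0 \<and> hahn_deg y3 = ereal (W r3 k) \<and> hahn_deg y4 = ereal (W r4 k) \<and>
        hahn_deg (y4 * (- 1) + y3 * (- mon \<kappa>) + x1 * mon x) = ereal (W r5 k) \<and>
        hahn_deg (y4 * (- 1) + y3 * (mon \<kappa> * (monomial 2 \<sigma> - 1)) + x1 * (mon x + mon \<eta>)) = ereal (W r6 k)" if kC: "k \<in> C1" for k
  proof -
    let ?p = "W r5 k" and ?a = "\<kappa> + W r3 k" and ?b = "W r4 k" and ?d = "W r6 k + h"
    \<comment> \<open>The roles change: \<open>r5\<close>, \<open>r3\<close>, \<open>r4\<close> now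
      serve as basis, and the compared rows are the cherry \<open>p1\<close>, \<open>r6\<close>,
      scaled to \<open>R = t^x x1\<close> and \<open>t^h\<close> times row \<open>r6\<close>.
      Solving for \<open>Z5\<close> expresses \<open>r5\<close> and \<open>r6\<close> through
      \<open>r4\<close>, \<open>r3\<close>, \<open>p1\<close> again.\<close>
    have "\<exists>Z5 Z3 Z4. hahn_deg Z5 = ereal ?p \<and> hahn_deg Z3 = ereal ?a \<and> hahn_deg Z4 = ereal ?b \<and>
      hahn_deg (Z5 + Z3 + Z4) = ereal x \<and> hahn_deg (Z5 + Z3 + Z4 + mon h * Z5 + monomial 2 (h + \<sigma>) * Z3) = ereal ?d"
    proof (rule plane_lift[OF h(1,2)])
      show "(x = ?d \<and> x \<le> ?p \<and> x \<le> ?a \<and> x \<le> ?b \<and> (x = ?p \<or> x = ?a \<or> x = ?b)) \<or>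
        (?b \<le> ?p \<and> ?b \<le> ?a \<and> ?b \<le> x \<and> ?b \<le> ?d \<and> (?p = ?b \<or> ?a = ?b) \<and> min_twice4 x ?d (h + ?p) (h + \<sigma> + ?a)) \<or>
        (?p = ?a \<and> ?p < ?b \<and> ?p \<le> x \<and> ?p \<le> ?d \<and> min_twice3 x ?d (h + ?p))"
        using twp[OF kC] min_twice_q[OF kC] tws[OF kC] x s unfolding h_def min_twice4_def min_twice3_def by (smt (verit))
    qed
    then obtain Z5 Z3 Z4 where Z: "hahn_deg Z5 = ereal ?p" "hahn_deg Z3 = ereal ?a" "hahn_deg Z4 = ereal ?b"
      "hahn_deg (Z5 + Z3 + Z4) = ereal x" "hahn_deg (Z5 + Z3 + Z4 + mon h * Z5 + monomial 2 (h + \<sigma>) * Z3) = ereal ?d" by blast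
    define R where "R = Z5 + Z3 + Z4"
    have m2: "monomial 2 (a + b) = mon a * monomial 2 b" for a b
      by (rule hahn_eqI) (auto simp: coeff_monomial_times monomial.rep_eq)
    have 1: "mon (- x) * R * mon x = R" using mon_mult[of "- x" x] by (simp add: mon_0 algebra_simps)
    have 2: "mon (- x) * R * mon \<eta> = mon (- h) * R"
      using mon_mult[of "- x" \<eta>] by (simp add: h_def algebra_simps)
    have 3: "mon (- \<kappa>) * Z3 * mon \<kappa> = Z3" using mon_mult[of "- \<kappa>" \<kappa>] by (simp add: mon_0 algebra_simps)
    have 4: "mon (- h) * mon h = 1" using mon_mult[of "- h" h] by (simp add: mon_0)
    have s5: "Z4 * (- 1) + mon (- \<kappa>) * Z3 * (- mon \<kappa>) + mon (- x) * R * mon x = Z5"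
      unfolding mult_minus_right 1 3 by (simp add: R_def)
    have "Z4 * (- 1) + mon (- \<kappa>) * Z3 * (mon \<kappa> * (monomial 2 \<sigma> - 1)) + mon (- x) * R * (mon x + mon \<eta>)
      = - Z4 + Z3 * (monomial 2 \<sigma> - 1) + R + mon (- h) * R"
      unfolding distrib_left 1 2 unfolding mult.assoc[symmetric] 3 by simp
    also have "\<dots> = mon (- h) * R + Z5 + monomial 2 \<sigma> * Z3" by (simp add: R_def algebra_simps)
    also have "\<dots> = mon (- h) * (R + mon h * Z5 + monomial 2 (h + \<sigma>) * Z3)"
      unfolding m2 distrib_left mult.assoc[symmetric] 4 by simp
    finally have s6: "Z4 * (- 1) + mon (- \<kappa>) * Z3 * (mon \<kappa> * (monomial 2 \<sigma> - 1)) + mon (- x) * R * (mon x + mon \<eta>)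
      = mon (- h) * (R + mon h * Z5 + monomial 2 (h + \<sigma>) * Z3)" .
    show ?thesis
      using hahn_deg_mon_mult[OF Z(4), of "- x"] hahn_deg_mon_mult[OF Z(2), of "- \<kappa>"] hahn_deg_mon_mult[OF Z(5), of "- h"] Z(1,3)
      by (intro exI[of _ "mon (- x) * R"] exI[of _ "mon (- \<kappa>) * Z3"] exI[of _ Z4]) (simp only: s5 s6, simp add: R_def)
  qed
  have L: "lead (- 1) 0 (- 1)" "lead (- mon \<kappa>) 0 (- \<alpha>)" "lead (mon \<kappa> * (monomial 2 \<sigma> - 1)) 0 (- \<alpha>)" "lead (mon x + mon \<eta>) 0 0"
    using lead_uminus[OF one] lead_uminus[OF lk] lead_mult[OF lk lead_diff[OF ls one]] lead_add[OF lx le] by simp_all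
  have g56: "\<not> (\<exists>v\<in>C2. W r5 v > 0 \<or> W r6 v > 0)" using no56 by force
  have g4: "(\<exists>v\<in>C2. W r4 v > 0 \<or> W r5 v > 0 \<or> W r6 v > 0) \<longrightarrow> - \<alpha> \<noteq> 0" using groups by (auto simp: \<alpha>_def)
  have n1: "(- 1 :: complex) \<noteq> 0" by simp
  have n5: "(- 1 :: complex) \<noteq> 5 * - \<alpha>" by (simp add: \<alpha>_def)
  show ?thesis
    unfolding good_lift_def
    by (rule exI[of _ "- 1"], rule exI[of _ "- mon \<kappa>"], rule exI[of _ "mon x"],
       rule exI[of _ "- 1"], rule exI[of _ "mon \<kappa> * (monomial 2 \<sigma> - 1)"], rule exI[of _ "mon x + mon \<eta>"],
       rule exI[of _ "- 1"], rule exI[of _ "- \<alpha>"], rule exI[of _ "- 1"], rule exI[of _ "- \<alpha>"])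
      (intro conjI ballI; (rule lx L n1 n5 k; assumption?)?; use g56 g4 in blast)
qed

end

section \<open>The choice between the star and the caterpillar\<close>

context block_normed begin

definition has_good_lift :: bool where
  "has_good_lift \<longleftrightarrow> (\<exists>a b c. {a, b, c} = {r4, r5, r6} \<and> distinct [a, b, c] \<and> good_lift W r3 a b c C1 C2)"

lemma has_good_liftI: "good_lift W r3 r4 r5 r6 C1 C2 \<Longrightarrow> has_good_lift" "good_lift W r3 r4 r6 r5 C1 C2 \<Longrightarrow> has_good_lift"
proof -
  show has_good_lift if "good_lift W r3 r4 r5 r6 C1 C2"
    unfolding has_good_lift_def by (rule exI[of _ r4], rule exI[of _ r5], rule exI[of _ r6]) (use that rows in auto)
  show has_good_lift if "good_lift W r3 r4 r6 r5 C1 C2"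
    unfolding has_good_lift_def by (rule exI[of _ r4], rule exI[of _ r6], rule exI[of _ r5]) (use that rows in \<open>auto simp: insert_commute\<close>)
qed

lemma has_good_lift_eq:
  assumes c: "block_normed W p1 p2 r3 a b c C1 C2 v3 v0 \<kappa> \<eta>" and e: "{a, b, c} = {r4, r5, r6}"
  shows "block_normed.has_good_lift W r3 a b c C1 C2 = has_good_lift"
  unfolding has_good_lift_def block_normed.has_good_lift_def[OF c] e ..

lemma block_normed_swap56: "block_normed W p1 p2 r3 r4 r6 r5 C1 C2 v3 v0 \<kappa> \<eta>"
  using all_perms_normed(2)[of "\<lambda>a b c. block_normed W p1 p2 r3 a b c C1 C2 v3 v0 \<kappa> \<eta>"] by blast

lemma swap_m: "block.m W r4 r6 r5 c = m c"
  by (simp add: block.m_def[OF block_normed.axioms(1)[OF block_normed_swap56]] m_def min.commute)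

lemma sharp_low_same': 
  assumes "u \<in> C1" "u' \<in> C1" "c \<in> C1" "W r4 u < W r5 u" "W r4 u < W r6 u"
    "(W r5 u' < W r4 u' \<and> W r5 u' < W r6 u') \<or> (W r6 u' < W r4 u' \<and> W r6 u' < W r5 u')"
    and c: "W r4 u < m c" "m u' < m c"
  shows False
  using assms(6)
proof
  assume "W r5 u' < W r4 u' \<and> W r5 u' < W r6 u'"
  then show False using sharp_low_same[OF assms(1-5)] c by (simp add: m_def)
next
  assume a: "W r6 u' < W r4 u' \<and> W r6 u' < W r5 u'"
  show False
    by (rule block_normed.sharp_low_same[OF block_normed_swap56 assms(1-3,5,4)])
      (use a c in \<open>auto simp: block.m_def[OF block_normed.axioms(1)[OF block_normed_swap56]] m_def\<close>)
qed

text \<open>By \<open>sharp_low_same'\<close> every strict minimum in \<open>r5\<close> or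
  \<open>r6\<close> lies at the top level of \<open>m\<close>. If all such columns satisfy
  \<open>\<kappa> + W r3 c = \<eta>\<close>, the star applies; otherwise one of them lies strictly
  on the side of \<open>p1\<close> and serves as \<open>cR\<close>, with \<open>u\<close> as
  \<open>cL\<close>.\<close>

lemma low_case:
  assumes u: "u \<in> C1" "W r4 u < W r5 u" "W r4 u < W r6 u" and c': "c' \<in> C1" "W r4 u < m c'"
  shows has_good_lift
proof -
  have "Max (m ` C1) \<in> m ` C1" using cols by (intro Max_in) auto
  then obtain t where t: "t \<in> C1" "m t = Max (m ` C1)" by auto
  have mt: "m c \<le> m t" if "c \<in> C1" for c unfolding t(2) using that by simp
  obtain h where h: "h \<in> C1" "\<eta> \<le> m h" using eta_attained unfolding m_def by auto
  define sh where "sh c \<longleftrightarrow> (W r5 c < W r4 c \<and> W r5 c < W r6 c) \<or> (W r6 c < W r4 c \<and> W r6 c < W r5 c)" for c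
  have XM: "m c'' \<le> m c" if "c \<in> C1" "c'' \<in> C1" "sh c" for c c''
    using sharp_low_same'[OF u(1) that(1) t(1) u(2,3) that(3)[unfolded sh_def]] mt[OF that(2)] mt[OF c'(1)] c'(2) by fastforce
  show ?thesis
  proof (cases "\<exists>c\<in>C1. sh c \<and> \<kappa> + W r3 c \<noteq> \<eta>")
    case False
    then have "block_star W p1 p2 r3 r4 r5 r6 C1 C2 v3 v0 \<kappa> \<eta>"
      by unfold_locales (use XM sh_def in blast)+
    then show ?thesis by (rule has_good_liftI(1)[OF block_star.good_lift_star])
  next
    case True
    then obtain c where c: "c \<in> C1" "sh c" "\<kappa> + W r3 c \<noteq> \<eta>" by blast
    have "m c = min (\<kappa> + W r3 c) \<eta>" using N(1)[OF c(1)] c(2,3) unfolding sh_def m_def by (smt (verit))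
    moreover have "\<eta> \<le> m c" using XM[OF c(1) h(1) c(2)] h by simp
    ultimately have cc: "m c = \<eta>" "\<eta> < \<kappa> + W r3 c" using c(3) by auto
    have mY: "m x \<le> \<eta>" if "x \<in> C1" for x using XM[OF c(1) that c(2)] cc by simp
    have ul: "W r4 u < \<eta>" using c'(2) mY[OF c'(1)] by simp
    from c(2) show ?thesis unfolding sh_def
    proof
      assume "W r6 c < W r4 c \<and> W r6 c < W r5 c"
      then have "block_caterpillar W p1 p2 r3 r4 r5 r6 C1 C2 v3 v0 \<kappa> \<eta> u c"
        by (intro block_caterpillar.intro[OF block_normed_axioms] block_caterpillar_axioms.intro) (use u ul c cc mY in auto)
      then show ?thesis by (rule has_good_liftI(1)[OF block_caterpillar.good_lift_caterpillar])
    next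
      assume "W r5 c < W r4 c \<and> W r5 c < W r6 c"
      then have "block_caterpillar W p1 p2 r3 r4 r6 r5 C1 C2 v3 v0 \<kappa> \<eta> u c"
        by (intro block_caterpillar.intro[OF block_normed_swap56] block_caterpillar_axioms.intro) 
         (use u ul c cc mY swap_m in auto)
      then show ?thesis by (rule has_good_liftI(2)[OF block_caterpillar.good_lift_caterpillar])
    qed
  qed
qed

text \<open>Without low strict minima only the side of \<open>p1\<close> matters. If
  \<open>r4\<close> has a strict minimum there, \<open>sharp_high_same\<close> forbids one in
  \<open>r5\<close> or \<open>r6\<close>, so the star suffices.\<close>

lemma high_case:
  assumes XM: "\<And>c c'. c \<in> C1 \<Longrightarrow> c' \<in> C1 \<Longrightarrow> 
      (W r5 c < W r4 c \<and> W r5 c < W r6 c) \<or> (W r6 c < W r4 c \<and> W r6 c < W r5 c) \<Longrightarrow> m c' \<le> m c"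
    and u: "(u \<in> C1 \<and> W r4 u < W r5 u \<and> W r4 u < W r6 u \<and> \<eta> < \<kappa> + W r3 u) \<or> 
      (\<forall>c\<in>C1. (W r5 c < W r4 c \<and> W r5 c < W r6 c) \<or> (W r6 c < W r4 c \<and> W r6 c < W r5 c) \<longrightarrow> \<kappa> + W r3 c = \<eta>)"
  shows has_good_lift
proof -
  obtain h where h: "h \<in> C1" "\<eta> \<le> m h" using eta_attained unfolding m_def by auto
  have "\<kappa> + W r3 c = \<eta>" if c: "c \<in> C1" and s: "(W r5 c < W r4 c \<and> W r5 c < W r6 c) \<or> (W r6 c < W r4 c \<and> W r6 c < W r5 c)" for c
  proof (rule ccontr)
    assume n: "\<kappa> + W r3 c \<noteq> \<eta>"
    then have uu: "u \<in> C1" "W r4 u < W r5 u" "W r4 u < W r6 u" "\<eta> < \<kappa> + W r3 u" using u c s by blast+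
    have "m c = min (\<kappa> + W r3 c) \<eta>" using N(1)[OF c] s n unfolding m_def by (smt (verit))
    moreover have "\<eta> \<le> m c" using XM[OF c h(1) s] h by simp
    ultimately have cc: "\<eta> < \<kappa> + W r3 c" using n by auto
    from s show False
    proof
      assume "W r5 c < W r4 c \<and> W r5 c < W r6 c"
      then show False using sharp_high_same[OF uu(1) c uu(2,3)] uu cc by simp
    next
      assume "W r6 c < W r4 c \<and> W r6 c < W r5 c"
      then show False using block_normed.sharp_high_same[OF block_normed_swap56 uu(1) c uu(3,2)] uu cc by simp
    qed
  qed
  then have "block_star W p1 p2 r3 r4 r5 r6 C1 C2 v3 v0 \<kappa> \<eta>"
    by unfold_locales (use XM in blast)+
  then show ?thesis by (rule has_good_liftI(1)[OF block_star.good_lift_star])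
qed

lemma has_good_lift_holds: has_good_lift
proof -
  define sh where "sh a b c u \<longleftrightarrow> u \<in> C1 \<and> W a u < W b u \<and> W a u < W c u" for a b c u
  have eqm: "block.m W a b c = m" if "block_normed W p1 p2 r3 a b c C1 C2 v3 v0 \<kappa> \<eta>" "{a, b, c} = {r4, r5, r6}" for a b c
  proof -
    have "block.m W a b c v = Min ((\<lambda>r. W r v) ` {a, b, c})" for v
      by (simp add: block.m_def[OF block_normed.axioms(1)[OF that(1)]])
    moreover have "m v = Min ((\<lambda>r. W r v) ` {r4, r5, r6})" for v by (simp add: m_def)
    ultimately show ?thesis using that(2) by (simp add: fun_eq_iff)
  qed
  have c1': "block_normed W p1 p2 r3 r5 r4 r6 C1 C2 v3 v0 \<kappa> \<eta>" "{r5, r4, r6} = {r4, r5, r6}" using block_normed_swaps(1) by auto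
  have c2': "block_normed W p1 p2 r3 r6 r5 r4 C1 C2 v3 v0 \<kappa> \<eta>" "{r6, r5, r4} = {r4, r5, r6}" using block_normed_swaps(2) by auto
  have low: has_good_lift if "\<exists>u c. c \<in> C1 \<and> (sh r4 r5 r6 u \<or> sh r5 r4 r6 u \<or> sh r6 r5 r4 u) \<and> m u < m c"
  proof -
    from that obtain u c where c: "c \<in> C1" "m u < m c" and s: "sh r4 r5 r6 u \<or> sh r5 r4 r6 u \<or> sh r6 r5 r4 u" by blast
    from s show has_good_lift
    proof (elim disjE)
      assume "sh r4 r5 r6 u" 
      then show has_good_lift using low_case[of u c] c unfolding sh_def by (simp add: m_def)
    next
      assume "sh r5 r4 r6 u" 
      then show has_good_lift using block_normed.low_case[OF c1'(1), of u c] c unfolding sh_def eqm[OF c1'] has_good_lift_eq[OF c1'] by (simp add: m_def)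
    next
      assume "sh r6 r5 r4 u" 
      then show has_good_lift using block_normed.low_case[OF c2'(1), of u c] c unfolding sh_def eqm[OF c2'] has_good_lift_eq[OF c2'] by (simp add: m_def)
    qed
  qed
  show has_good_lift
  proof (cases "\<exists>u c. c \<in> C1 \<and> (sh r4 r5 r6 u \<or> sh r5 r4 r6 u \<or> sh r6 r5 r4 u) \<and> m u < m c")
    case False
    then have XM: "m c' \<le> m c" if "c' \<in> C1" "sh r4 r5 r6 c \<or> sh r5 r4 r6 c \<or> sh r6 r5 r4 c" for c c'
      using that by force
    have hi: "\<eta> < \<kappa> + W r3 u" if "sh r4 r5 r6 u \<or> sh r5 r4 r6 u \<or> sh r6 r5 r4 u" "\<kappa> + W r3 u \<noteq> \<eta>" for u
    proof -
      obtain h where h: "h \<in> C1" "\<eta> \<le> m h" using eta_attained unfolding m_def by auto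
      have "\<eta> \<le> m u" using XM[OF h(1) that(1)] h by simp
      moreover have "u \<in> C1" "\<not> (W r4 u = W r5 u \<and> W r5 u = W r6 u)" using that(1) by (auto simp: sh_def)
      ultimately show ?thesis using N(1)[of u] that(2) unfolding m_def by (smt (verit))
    qed
    consider u where "sh r5 r4 r6 u" "\<kappa> + W r3 u \<noteq> \<eta>" | u where "sh r6 r5 r4 u" "\<kappa> + W r3 u \<noteq> \<eta>"
      | "\<forall>c. sh r5 r4 r6 c \<or> sh r6 r5 r4 c \<longrightarrow> \<kappa> + W r3 c = \<eta>" by blast
    then show has_good_lift
    proof cases
      case (1 u)
      then show has_good_lift using block_normed.high_case[OF c1'(1), of u] XM hi[of u] unfolding sh_def eqm[OF c1'] has_good_lift_eq[OF c1'] by blast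
    next
      case (2 u)
      then show has_good_lift using block_normed.high_case[OF c2'(1), of u] XM hi[of u] unfolding sh_def eqm[OF c2'] has_good_lift_eq[OF c2'] by blast
    next
      case 3
      then show has_good_lift using high_case XM unfolding sh_def by blast
    qed
  qed (use low in blast)
qed

end

theorem (in block) good_exists: "\<exists>a b c. {a, b, c} = {r4, r5, r6} \<and> distinct [a, b, c] \<and> good_lift W r3 a b c C1 C2"
proof -
  obtain \<kappa> \<eta> where c: "block_normed W p1 p2 r3 r4 r5 r6 C1 C2 v3 v0 \<kappa> \<eta>" using block_normed_exists by blast
  from block_normed.has_good_lift_holds[OF c] show ?thesis unfolding block_normed.has_good_lift_def[OF c] .
qed

section \<open>Lifting the matrix\<close>

lemma tropically_nonsingular_if_dominant4:
  assumes "dominant4 M r1 r2 r3 r4 c1 c2 c3 c4"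
  shows "tropically_nonsingular 4 (\<lambda>i j. M ([r1, r2, r3, r4] ! i) ([c1, c2, c3, c4] ! j))"
proof -
  define S where "S i j = M ([r1, r2, r3, r4] ! i) ([c1, c2, c3, c4] ! j)" for i j
  have sum4: "(\<Sum>i<4. f i) = f 0 + f 1 + f 2 + f (3::nat)" for f :: "nat \<Rightarrow> real"
    by (simp add: eval_nat_numeral)
  have key: "\<tau> = id \<or> (\<Sum>i<4. S i i) < (\<Sum>i<4. S i (\<tau> i))" if t: "\<tau> permutes {..<4}" for \<tau>
  proof -
    have lt: "\<tau> i = 0 \<or> \<tau> i = 1 \<or> \<tau> i = 2 \<or> \<tau> i = 3" if "i < 4" for i
      using permutes_in_image[OF t, of i] that by auto
    have ne: "\<tau> i \<noteq> \<tau> j" if "i \<noteq> j" for i j using permutes_inj[OF t] that by (auto dest: injD)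
    have n: "\<tau> 0 \<noteq> \<tau> 1" "\<tau> 0 \<noteq> \<tau> 2" "\<tau> 0 \<noteq> \<tau> 3" "\<tau> 1 \<noteq> \<tau> 2" "\<tau> 1 \<noteq> \<tau> 3" "\<tau> 2 \<noteq> \<tau> 3"
      by (simp_all add: ne)
    have m: "\<tau> 0 \<in> {0, 1, 2, 3}" "\<tau> 1 \<in> {0, 1, 2, 3}" "\<tau> 2 \<in> {0, 1, 2, 3}" "\<tau> 3 \<in> {0, 1, 2, 3}"
      using lt[of 0] lt[of 1] lt[of 2] lt[of 3] by simp_all
    have id: "\<tau> = id" if "\<tau> 0 = 0" "\<tau> 1 = 1" "\<tau> 2 = 2" "\<tau> 3 = 3"
    proof
      fix i show "\<tau> i = id i"
      proof (cases "i < 4")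
        case True
        then have "i = 0 \<or> i = 1 \<or> i = 2 \<or> i = 3" by linarith
        then show ?thesis using that by auto
      qed (use permutes_not_in[OF t] in auto)
    qed
    \<comment> \<open>Quantifying over all values instead of over permutations lets the simplifier
      enumerate the cases.\<close>
    have "\<forall>a\<in>{0, 1, 2, 3}. \<forall>b\<in>{0, 1, 2, 3}. \<forall>c\<in>{0, 1, 2, 3}. \<forall>e\<in>{0, 1, 2, 3}.
        a \<noteq> b \<longrightarrow> a \<noteq> c \<longrightarrow> a \<noteq> e \<longrightarrow> b \<noteq> c \<longrightarrow> b \<noteq> e \<longrightarrow> c \<noteq> e \<longrightarrow>
        (a = 0 \<and> b = 1 \<and> c = 2 \<and> e = 3) \<or> S 0 0 + S 1 1 + S 2 2 + S 3 3 < S 0 a + S 1 b + S 2 c + S 3 e"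
      using assms unfolding S_def dominant4_def by simp
    from this[rule_format, of "\<tau> 0" "\<tau> 1" "\<tau> 2" "\<tau> 3"]
    have "\<tau> 0 = 0 \<and> \<tau> 1 = 1 \<and> \<tau> 2 = 2 \<and> \<tau> 3 = 3 \<or>
        S 0 0 + S 1 1 + S 2 2 + S 3 3 < S 0 (\<tau> 0) + S 1 (\<tau> 1) + S 2 (\<tau> 2) + S 3 (\<tau> 3)"
      using m n by blast
    then show ?thesis using id unfolding sum4 by blast
  qed
  show ?thesis
    unfolding tropically_nonsingular_def S_def[symmetric]
  proof (rule ex1I[of _ id])
    show "id permutes {..<4} \<and> (\<forall>\<tau>. \<tau> permutes {..<4} \<longrightarrow> (\<Sum>i<4. S i (id i)) \<le> (\<Sum>i<4. S i (\<tau> i)))"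
      using key permutes_id by force
    show "\<sigma> = id" if "\<sigma> permutes {..<4} \<and> (\<forall>\<tau>. \<tau> permutes {..<4} \<longrightarrow> (\<Sum>i<4. S i (\<sigma> i)) \<le> (\<Sum>i<4. S i (\<tau> i)))" for \<sigma>
    proof -
      have "(\<Sum>i<4. S i (\<sigma> i)) \<le> (\<Sum>i<4. S i (id i))" using that permutes_id by blast
      then show ?thesis using key[of \<sigma>] that by auto
    qed
  qed
qed

lemma no_dominant_minor_if_tropical_rank:
  fixes B :: "real^'n^'m"
  assumes "tropical_rank B < 4"
  shows "no_dominant_minor (\<lambda>r c. B $ r $ c)"
  unfolding no_dominant_minor_def
proof (intro allI impI notI)
  fix r1 r2 r3 r4 c1 c2 c3 c4
  assume d: "distinct [r1, r2, r3, r4]" "distinct [c1, c2, c3, c4]"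
    and D: "dominant4 (\<lambda>r c. B $ r $ c) r1 r2 r3 r4 c1 c2 c3 c4"
  have inj: "inj_on ((!) xs) {..<4}" if "distinct xs" "length xs = 4" for xs :: "'x list"
    using that by (auto simp: inj_on_def nth_eq_iff_index_eq)
  have "has_nonsingular_submatrix B 4"
    unfolding has_nonsingular_submatrix_def
    using inj[OF d(1)] inj[OF d(2)] tropically_nonsingular_if_dominant4[OF D]
    by (intro exI[of _ "(!) [r1, r2, r3, r4]"] exI[of _ "(!) [c1, c2, c3, c4]"]) simp
  then show False using le_tropical_rank assms by fastforce
qed

text \<open>The rows \<open>p1\<close>, \<open>p2\<close> are compared on the star whose rays are
  all four lower rows; \<open>r3\<close> is the ray on which the line leaves. The conditions are
  symmetric in the other three rows, because which of them enters the relation for \<open>p2\<close>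
  is decided only by \<open>good_exists\<close>.\<close>

lemma hyperplane_tuning:
  assumes W: "no_dominant_minor W" and rows: "distinct [p1, p2, q3, q4, q5, q6]" and I: "I = {q3, q4, q5, q6}"
    and C: "C1 \<inter> C2 = {}" "z \<in> C1"
    and c1: "W p1 z = 0" "W p2 z = 0" "\<And>r. r \<in> I \<Longrightarrow> W r z > 0"
    and c2: "\<And>v. v \<in> C2 \<Longrightarrow> W p1 v > 0" "\<And>v. v \<in> C2 \<Longrightarrow> W p2 v > 0" "\<And>v r. v \<in> C2 \<Longrightarrow> r \<in> I \<Longrightarrow> W r v \<ge> 0"
      "\<And>v r s. v \<in> C2 \<Longrightarrow> r \<in> I \<Longrightarrow> s \<in> I \<Longrightarrow> W r v > 0 \<Longrightarrow> W s v > 0 \<Longrightarrow> r = s"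
    and zero: "\<And>r. r \<in> I \<Longrightarrow> \<exists>v\<in>C2. W r v = 0"
    and group: "\<exists>r\<in>I. \<exists>v\<in>C2. W r v > 0"
    and fin: "finite C2"
  shows "\<exists>h\<ge>0. \<exists>\<tau>\<ge>0. \<exists>r3\<in>I. (\<exists>v\<in>C2. W r3 v > 0) \<and> (\<forall>v\<in>C2.
     (W r3 v > 0 \<longrightarrow> min_twice4 (W p1 v) (W p2 v) (h + W r3 v) (h + \<tau>)) \<and>
     ((\<exists>r\<in>I - {r3}. W r v > 0) \<longrightarrow> min_twice3 (W p1 v) (W p2 v) h) \<and>
     ((\<forall>r\<in>I. W r v = 0) \<longrightarrow> min_twice4 (W p1 v) (W p2 v) h (h + \<tau>)))"
proof -
  define d where "d u = min (W p1 u) (W p2 u)" for u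
  have third: "\<exists>j\<in>I. j \<noteq> i \<and> j \<noteq> k" for i k using rows unfolding I by auto
  have zI: "W r u = 0" if "u \<in> C2" "r \<in> I" "s \<in> I" "r \<noteq> s" "W s u > 0" for r s u
    using c2(3)[OF that(1,2)] c2(4)[OF that(1-3)] that(4,5) by (cases "W r u = 0") auto
  have H6: False if i: "i \<in> I" and u: "u \<in> C2" "u' \<in> C2" and a: "W i u > 0" "W i u' > 0" "W p1 u \<noteq> W p2 u"
        "d u < d u'" "d u < W i u" "d u < W i u'" for i u u'
  proof -
    \<comment> \<open>A zero of row \<open>i\<close> on \<open>C2\<close> is the column that
      \<open>H6\<close> needs here.\<close>
    obtain v where v: "v \<in> C2" "W i v = 0" using zero[OF i] by blast
    obtain k where k: "k \<in> I" "k \<noteq> i" using third[of i i] by blast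
    obtain j where j: "j \<in> I" "j \<noteq> i" "W j v = 0"
    proof (cases "W k v = 0")
      case False
      then have kv: "W k v > 0" using c2(3)[OF v(1) k(1)] by simp
      obtain j where "j \<in> I" "j \<noteq> i" "j \<noteq> k" using third[of i k] by blast
      then show thesis using that zI[OF v(1) _ k(1) _ kv] by metis
    qed (use k that in blast)
    have e: "W j u = 0" "W j u' = 0" using zI[OF u(1) j(1) i j(2) a(1)] zI[OF u(2) j(1) i j(2) a(2)] by auto
    have dd: "d u \<le> W p1 u" "d u \<le> W p2 u" "d u' \<le> W p1 u'" "d u' \<le> W p2 u'" by (auto simp: d_def)
    have D: "distinct [u, v, u', z]" using a v u C by auto
    have R: "distinct [p1, i, j, p2]" "distinct [p2, i, j, p1]" using rows i j unfolding I by auto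
    note F = a(1,2,4-6) v(2) j(3) e dd c1(1,2) c1(3)[OF i] c1(3)[OF j(1)] c2(1,2)[OF v(1)] c2(1,2)[OF u(1)] c2(1,2)[OF u(2)]
    show False
    proof (cases "W p1 u < W p2 u")
      case True
      then have "W p1 u = d u" by (simp add: d_def)
      note F = F this True
      have "dominant4 W p1 i j p2 u v u' z" unfolding dominant4_def using F by (intro conjI; linarith)
      then show False by (rule no_dominant_minorD[OF W R(1) D])
    next
      case False
      then have "W p2 u = d u" "W p2 u < W p1 u" using a(3) by (auto simp: d_def)
      note F = F this
      have "dominant4 W p2 i j p1 u v u' z" unfolding dominant4_def using F by (intro conjI; linarith)
      then show False by (rule no_dominant_minorD[OF W R(2) D])
    qed
  qed
  have "\<exists>h\<ge>0. (\<forall>u\<in>C2. if \<exists>i\<in>I. W i u > 0 then (W p1 u \<noteq> W p2 u \<longrightarrow> d u = h) \<and> (W p1 u = W p2 u \<longrightarrow> d u \<le> h)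
        else (W p1 u \<noteq> W p2 u \<longrightarrow> h \<le> d u)) \<or>
    (\<exists>i\<in>I. (\<exists>u\<in>C2. W i u > 0) \<and> (\<exists>\<tau>>0. \<forall>u\<in>C2. if W i u > 0 then min_twice4 (W p1 u) (W p2 u) (h + W i u) (h + \<tau>)
        else (W p1 u \<noteq> W p2 u \<longrightarrow> d u = h) \<and> (W p1 u = W p2 u \<longrightarrow> d u \<le> h)))"
  proof (rule star_minors[OF W fin, where z = z])
    show "\<exists>j\<in>I. j \<noteq> i \<and> j \<noteq> k" for i k by (rule third)
    show "p1 \<noteq> p2" "p1 \<notin> I" "p2 \<notin> I" using rows unfolding I by auto
    show "z \<notin> C2" using C by auto
    show "W i z \<ge> 0" if "i \<in> I" for i using c1(3)[OF that] by simp
    show "W p1 u \<ge> 0" "W p2 u \<ge> 0" if "u \<in> C2" for u using c2(1,2)[OF that] by simp_all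
    show "d u = min (W p1 u) (W p2 u)" for u by (rule d_def)
    show "W p1 z = 0" "W p2 z = 0" by fact+
    show "W i u \<ge> 0" if "u \<in> C2" "i \<in> I" for i u using c2(3)[OF that] .
    show "i = j" if "u \<in> C2" "i \<in> I" "j \<in> I" "W i u > 0" "W j u > 0" for i j u using c2(4)[OF that] .
  qed (rule H6)
  then obtain h where h: "h \<ge> 0" and hh: "(\<forall>u\<in>C2. if \<exists>i\<in>I. W i u > 0 then (W p1 u \<noteq> W p2 u \<longrightarrow> d u = h) \<and> (W p1 u = W p2 u \<longrightarrow> d u \<le> h)
        else (W p1 u \<noteq> W p2 u \<longrightarrow> h \<le> d u)) \<or>
    (\<exists>i\<in>I. (\<exists>u\<in>C2. W i u > 0) \<and> (\<exists>\<tau>>0. \<forall>u\<in>C2. if W i u > 0 then min_twice4 (W p1 u) (W p2 u) (h + W i u) (h + \<tau>)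
        else (W p1 u \<noteq> W p2 u \<longrightarrow> d u = h) \<and> (W p1 u = W p2 u \<longrightarrow> d u \<le> h)))" by blast
  from hh show ?thesis
  proof
    assume c: "\<forall>u\<in>C2. if \<exists>i\<in>I. W i u > 0 then (W p1 u \<noteq> W p2 u \<longrightarrow> d u = h) \<and> (W p1 u = W p2 u \<longrightarrow> d u \<le> h)
        else (W p1 u \<noteq> W p2 u \<longrightarrow> h \<le> d u)"
    obtain r3 where r3: "r3 \<in> I" "\<exists>v\<in>C2. W r3 v > 0" using group by blast
    have t3: "min_twice3 (W p1 v) (W p2 v) h" if "v \<in> C2" "\<exists>r\<in>I. W r v > 0" for v
      using c[rule_format, OF that(1)] that(2) unfolding min_twice3_def d_def by (auto split: if_splits simp: min_def)
    have t4: "min_twice4 (W p1 v) (W p2 v) h (h + 0)" if "v \<in> C2" "\<forall>r\<in>I. W r v = 0" for v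
      using c[rule_format, OF that(1)] that(2) unfolding min_twice4_def d_def by (auto split: if_splits simp: min_def)
    have t5: "min_twice4 (W p1 v) (W p2 v) (h + W r3 v) (h + 0)" if v: "v \<in> C2" "W r3 v > 0" for v
    proof -
      have "min_twice3 (W p1 v) (W p2 v) h" using t3[OF v(1)] r3(1) v(2) by blast
      then show ?thesis using v(2) unfolding min_twice3_def min_twice4_def by (smt (verit))
    qed
    have "\<forall>v\<in>C2. (W r3 v > 0 \<longrightarrow> min_twice4 (W p1 v) (W p2 v) (h + W r3 v) (h + 0)) \<and>
     ((\<exists>r\<in>I - {r3}. W r v > 0) \<longrightarrow> min_twice3 (W p1 v) (W p2 v) h) \<and>
     ((\<forall>r\<in>I. W r v = 0) \<longrightarrow> min_twice4 (W p1 v) (W p2 v) h (h + 0))"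
      using t3 t4 t5 by blast
    then show ?thesis using h r3 order.refl[of 0] by blast
  next
    assume "\<exists>i\<in>I. (\<exists>u\<in>C2. W i u > 0) \<and> (\<exists>\<tau>>0. \<forall>u\<in>C2. if W i u > 0 then min_twice4 (W p1 u) (W p2 u) (h + W i u) (h + \<tau>)
        else (W p1 u \<noteq> W p2 u \<longrightarrow> d u = h) \<and> (W p1 u = W p2 u \<longrightarrow> d u \<le> h))"
    then obtain r3 \<tau> where r3: "r3 \<in> I" "\<exists>v\<in>C2. W r3 v > 0" and t: "\<tau> > 0"
      and c: "\<And>u. u \<in> C2 \<Longrightarrow> if W r3 u > 0 then min_twice4 (W p1 u) (W p2 u) (h + W r3 u) (h + \<tau>)
        else (W p1 u \<noteq> W p2 u \<longrightarrow> d u = h) \<and> (W p1 u = W p2 u \<longrightarrow> d u \<le> h)" by blast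
    have t3: "min_twice3 (W p1 v) (W p2 v) h" if "v \<in> C2" "\<not> W r3 v > 0" for v
      using c[OF that(1)] that(2) unfolding min_twice3_def d_def by (auto split: if_splits simp: min_def)
    have "min_twice3 (W p1 v) (W p2 v) h" if "v \<in> C2" "\<exists>r\<in>I - {r3}. W r v > 0" for v
      using t3[OF that(1)] c2(4)[OF that(1)] that(2) r3(1) by blast
    moreover have "min_twice4 (W p1 v) (W p2 v) h (h + \<tau>)" if "v \<in> C2" "\<forall>r\<in>I. W r v = 0" for v
    proof -
      have "min_twice3 (W p1 v) (W p2 v) h" using t3[OF that(1)] that(2) r3(1) by simp
      then show ?thesis using t unfolding min_twice3_def min_twice4_def by (smt (verit))
    qed
    moreover have "min_twice4 (W p1 v) (W p2 v) (h + W r3 v) (h + \<tau>)" if "v \<in> C2" "W r3 v > 0" for v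
      using c[OF that(1)] that(2) by simp
    ultimately have "\<forall>v\<in>C2. (W r3 v > 0 \<longrightarrow> min_twice4 (W p1 v) (W p2 v) (h + W r3 v) (h + \<tau>)) \<and>
     ((\<exists>r\<in>I - {r3}. W r v > 0) \<longrightarrow> min_twice3 (W p1 v) (W p2 v) h) \<and>
     ((\<forall>r\<in>I. W r v = 0) \<longrightarrow> min_twice4 (W p1 v) (W p2 v) h (h + \<tau>))" by blast
    then show ?thesis using h r3 less_imp_le[OF t] by blast
  qed
qed

definition lifts :: "('r \<Rightarrow> 'c \<Rightarrow> real) \<Rightarrow> ('r \<Rightarrow> 'c \<Rightarrow> hahn) \<Rightarrow> bool" where
  "lifts W L \<longleftrightarrow> (\<forall>r c. hahn_deg (L r c) = ereal (W r c))"

text \<open>The coefficients of the relations do not depend on the column, so the entries can be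
  found column by column and each column lies in the same three-dimensional space.\<close>

lemma lift_exists:
  fixes W :: "'r \<Rightarrow> 'c::finite \<Rightarrow> real"
  assumes W: "no_dominant_minor W" and rows: "distinct [p1, p2, q3, q4, q5, q6]" "UNIV = {p1, p2, q3, q4, q5, q6}" and I: "I = {q3, q4, q5, q6}"
    and C: "C1 \<inter> C2 = {}" "C1 \<noteq> {}" "C1 \<union> C2 = UNIV"
    and c1: "\<And>c. c \<in> C1 \<Longrightarrow> W p1 c = 0" "\<And>c. c \<in> C1 \<Longrightarrow> W p2 c = 0" "\<And>c r. c \<in> C1 \<Longrightarrow> r \<in> I \<Longrightarrow> W r c > 0"
    and c2: "\<And>v. v \<in> C2 \<Longrightarrow> W p1 v > 0" "\<And>v. v \<in> C2 \<Longrightarrow> W p2 v > 0" "\<And>v r. v \<in> C2 \<Longrightarrow> r \<in> I \<Longrightarrow> W r v \<ge> 0"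
      "\<And>v r s. v \<in> C2 \<Longrightarrow> r \<in> I \<Longrightarrow> s \<in> I \<Longrightarrow> W r v > 0 \<Longrightarrow> W s v > 0 \<Longrightarrow> r = s"
    and zero: "\<And>r. r \<in> I \<Longrightarrow> \<exists>v\<in>C2. W r v = 0"
    and group: "\<exists>r\<in>I. \<exists>v\<in>C2. W r v > 0"
  shows "\<exists>L r1 r2 r3 k1 k2 k3. lifts W L \<and> (\<forall>r c. L r c = k1 r * L r1 c + k2 r * L r2 c + k3 r * L r3 c)"
proof -
  obtain z where z: "z \<in> C1" using C by blast
  have "\<exists>h\<ge>0. \<exists>\<tau>\<ge>0. \<exists>r3\<in>I. (\<exists>v\<in>C2. W r3 v > 0) \<and> (\<forall>v\<in>C2.
     (W r3 v > 0 \<longrightarrow> min_twice4 (W p1 v) (W p2 v) (h + W r3 v) (h + \<tau>)) \<and>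
     ((\<exists>r\<in>I - {r3}. W r v > 0) \<longrightarrow> min_twice3 (W p1 v) (W p2 v) h) \<and>
     ((\<forall>r\<in>I. W r v = 0) \<longrightarrow> min_twice4 (W p1 v) (W p2 v) h (h + \<tau>)))"
    by (rule hyperplane_tuning[OF W rows(1) I C(1) z c1(1,2)[OF z] c1(3)[OF z] c2 zero group finite])
  then obtain h \<tau> r3 v3 where h: "h \<ge> 0" "\<tau> \<ge> 0" and r3: "r3 \<in> I" and v3: "v3 \<in> C2" "W r3 v3 > 0"
    and tune': "\<forall>v\<in>C2. (W r3 v > 0 \<longrightarrow> min_twice4 (W p1 v) (W p2 v) (h + W r3 v) (h + \<tau>)) \<and>
     ((\<exists>r\<in>I - {r3}. W r v > 0) \<longrightarrow> min_twice3 (W p1 v) (W p2 v) h) \<and>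
     ((\<forall>r\<in>I. W r v = 0) \<longrightarrow> min_twice4 (W p1 v) (W p2 v) h (h + \<tau>))"
    by (elim exE bexE conjE)
  have tune: "W r3 v > 0 \<Longrightarrow> min_twice4 (W p1 v) (W p2 v) (h + W r3 v) (h + \<tau>)"
      "\<And>r. r \<in> I \<Longrightarrow> r \<noteq> r3 \<Longrightarrow> W r v > 0 \<Longrightarrow> min_twice3 (W p1 v) (W p2 v) h"
      "(\<forall>r\<in>I. W r v = 0) \<Longrightarrow> min_twice4 (W p1 v) (W p2 v) h (h + \<tau>)" if "v \<in> C2" for v
    using bspec[OF tune' that] by blast+
  obtain v0 where v0: "v0 \<in> C2" "W r3 v0 = 0" using zero[OF r3] by blast
  obtain r4 r5 r6 where r: "I = {r3, r4, r5, r6}" "distinct [r3, r4, r5, r6]"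
  proof -
    have "r3 = q3 \<or> r3 = q4 \<or> r3 = q5 \<or> r3 = q6" using r3 I by auto
    then show thesis using that[of q4 q5 q6] that[of q3 q5 q6] that[of q3 q4 q6] that[of q3 q4 q5] rows(1) I
      by (elim disjE) (auto simp: insert_commute)
  qed
  have pI: "p1 \<notin> I" "p2 \<notin> I" "p1 \<noteq> p2" using rows I by auto
  have z2: "W r v = 0 \<or> W s v = 0" if "v \<in> C2" "r \<in> I" "s \<in> I" "r \<noteq> s" for v r s
    using c2(3)[OF that(1,2)] c2(3)[OF that(1,3)] c2(4)[OF that(1-3)] that(4) by (cases "W r v = 0"; cases "W s v = 0") auto
  have "block W p1 p2 r3 r4 r5 r6 C1 C2 v3 v0"
    by unfold_locales (use r pI W C c1 c2(1-3) z2 v3 v0 in auto)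
  from block.good_exists[OF this] obtain a b c where abc: "{a, b, c} = {r4, r5, r6}" "distinct [a, b, c]"
    and g: "good_lift W r3 a b c C1 C2" by blast
  have r': "I = {r3, a, b, c}" "distinct [r3, a, b, c]" using abc r by auto
  from g obtain k al be k' al' be' k0 a0 k1 a1 where
    ld: "lead k 0 k0" "lead al 0 a0" "lead be 0 0" "lead k' 0 k1" "lead al' 0 a1" "lead be' 0 0"
    and nz: "k0 \<noteq> 0" "k1 \<noteq> 0" "k0 \<noteq> 5 * a0" "k1 \<noteq> 5 * a1"
    and ga: "(\<exists>v\<in>C2. W a v > 0 \<or> W b v > 0 \<or> W c v > 0) \<longrightarrow> a0 \<noteq> 0 \<and> a1 \<noteq> 0"
    and gb: "(\<exists>v\<in>C2. W b v > 0 \<or> W c v > 0) \<longrightarrow> k0 * a1 \<noteq> k1 * a0"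
    and gl: "\<forall>v\<in>C1. \<exists>x1 y3 y4. hahn_deg x1 = ereal 0 \<and> hahn_deg y3 = ereal (W r3 v) \<and> hahn_deg y4 = ereal (W a v) \<and>
        hahn_deg (y4 * k + y3 * al + x1 * be) = ereal (W b v) \<and> hahn_deg (y4 * k' + y3 * al' + x1 * be') = ereal (W c v)"
    unfolding good_lift_def by (elim exE conjE)
  have col: "\<exists>x1 y3 y4. hahn_deg x1 = ereal (W p1 v) \<and>
      hahn_deg (x1 + mon h * y3 + monomial 5 (h + \<tau>) * y4) = ereal (W p2 v) \<and>
      hahn_deg y3 = ereal (W r3 v) \<and> hahn_deg y4 = ereal (W a v) \<and>
      hahn_deg (y4 * k + y3 * al + x1 * be) = ereal (W b v) \<and> hahn_deg (y4 * k' + y3 * al' + x1 * be') = ereal (W c v)" for v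
  proof -
    have "v \<in> C1 \<or> v \<in> C2" using C by blast
    then show ?thesis
    proof
      assume v: "v \<in> C1"
      obtain x1 y3 y4 where x: "hahn_deg x1 = ereal 0" "hahn_deg y3 = ereal (W r3 v)" "hahn_deg y4 = ereal (W a v)"
        "hahn_deg (y4 * k + y3 * al + x1 * be) = ereal (W b v)" "hahn_deg (y4 * k' + y3 * al' + x1 * be') = ereal (W c v)"
        using bspec[OF gl v] by blast
      \<comment> \<open>The terms of \<open>r3\<close> and \<open>a\<close> have positive valuation,
        so row \<open>p2\<close> has the same leading term as row \<open>p1\<close>.\<close>
      have pos: "W r3 v > 0" "W a v > 0" using c1(3)[OF v] r' by auto
      have "hge y3 (W r3 v)" "hge y4 (W a v)" using x(2,3) unfolding hahn_deg_lead lead_def by auto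
      then have "lead (mon h * y3) 0 0" "lead (monomial 5 (h + \<tau>) * y4) 0 0"
        using pos h lead_less[OF hge_mult[OF hge_mon[OF order.refl], of y3 "W r3 v" 1 h], of 0]
          lead_less[OF hge_mult[OF hge_mon[OF order.refl], of y4 "W a v" 5 "h + \<tau>"], of 0] by auto
      moreover obtain e where e: "lead x1 0 e" "e \<noteq> 0" using x(1) unfolding hahn_deg_lead by blast
      ultimately have "lead (x1 + mon h * y3 + monomial 5 (h + \<tau>) * y4) 0 (e + 0 + 0)"
        by (intro lead_add)
      then have "hahn_deg (x1 + mon h * y3 + monomial 5 (h + \<tau>) * y4) = ereal 0"
        unfolding hahn_deg_lead using e(2) by auto
      then show ?thesis unfolding c1(1,2)[OF v] using x by blast
    next
      assume v: "v \<in> C2"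
      have nn: "W r3 v \<ge> 0" "W a v \<ge> 0" "W b v \<ge> 0" "W c v \<ge> 0" using c2(3)[OF v] r' by auto
      have one: "W r3 v = 0 \<or> W a v = 0" "W r3 v = 0 \<or> W b v = 0" "W r3 v = 0 \<or> W c v = 0" 
        "W a v = 0 \<or> W b v = 0" "W a v = 0 \<or> W c v = 0" "W b v = 0 \<or> W c v = 0" using z2[OF v] r' by auto
      have ldh: "hge k 0" "hge k' 0" "hge al 0" "hge al' 0" "hge be 0" "hge be' 0"
        and ldc: "coeff k 0 = k0" "coeff k' 0 = k1" "coeff al 0 = a0" "coeff al' 0 = a1"
        using ld by (auto simp: lead_def)
      consider "W b v > 0" | "W c v > 0" | "W b v = 0" "W c v = 0" using nn by linarith
      then show ?thesis
      proof cases
        case 1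
        have t: "min_twice3 (W p1 v) (W p2 v) h" using tune(2)[OF v, of b] 1 r' by auto
        have "k0 * a1 \<noteq> k1 * a0" "a0 \<noteq> 0" using ga gb v 1 by blast+
        from hyperplane_lift'[OF h c2(1,2)[OF v] 1 ld nz(1) this(2,1) nz(3) t]
        have "\<exists>x1 y3 y4. hahn_deg x1 = ereal (W p1 v) \<and>
          hahn_deg (x1 + mon h * y3 + monomial 5 (h + \<tau>) * y4) = ereal (W p2 v) \<and>
          hahn_deg y3 = ereal 0 \<and> hahn_deg y4 = ereal 0 \<and>
          hahn_deg (y4 * k + y3 * al + x1 * be) = ereal (W b v) \<and> hahn_deg (y4 * k' + y3 * al' + x1 * be') = ereal 0" .
        moreover have "W r3 v = 0" "W a v = 0" "W c v = 0" using one 1 by auto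
        ultimately show ?thesis by simp
      next
        case 2
        have t: "min_twice3 (W p1 v) (W p2 v) h" using tune(2)[OF v, of c] 2 r' by auto
        have "k0 * a1 \<noteq> k1 * a0" "a1 \<noteq> 0" using ga gb v 2 by blast+
        note this(1)[symmetric] this(2)
        from hyperplane_lift'[OF h c2(1,2)[OF v] 2 ld(4-6) ld(1-3) nz(2) this(2,1) nz(4) t]
        have "\<exists>x1 y3 y4. hahn_deg x1 = ereal (W p1 v) \<and>
          hahn_deg (x1 + mon h * y3 + monomial 5 (h + \<tau>) * y4) = ereal (W p2 v) \<and>
          hahn_deg y3 = ereal 0 \<and> hahn_deg y4 = ereal 0 \<and>
          hahn_deg (y4 * k + y3 * al + x1 * be) = ereal 0 \<and> hahn_deg (y4 * k' + y3 * al' + x1 * be') = ereal (W c v)" by blast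
        moreover have "W r3 v = 0" "W a v = 0" "W b v = 0" using one 2 by auto
        ultimately show ?thesis by simp
      next
        case 3
        have F: "(W r3 v > 0 \<and> W a v = 0) \<or> (W r3 v = 0 \<and> W a v > 0 \<and> coeff al 0 \<noteq> 0 \<and> coeff al' 0 \<noteq> 0) \<or> (W r3 v = 0 \<and> W a v = 0)"
        proof (cases "W a v = 0")
          case True
          then show ?thesis using nn(1) by auto
        next
          case False
          then have "W a v > 0" "W r3 v = 0" using nn(2) one(1) by auto
          moreover have "a0 \<noteq> 0 \<and> a1 \<noteq> 0" using ga v \<open>W a v > 0\<close> by blast
          ultimately show ?thesis unfolding ldc by simp
        qed
        have t: "min_twice4 (W p1 v) (W p2 v) (h + W r3 v) (h + \<tau> + W a v)"
        proof -
          consider "W r3 v > 0" "W a v = 0" | "W r3 v = 0" "W a v > 0" | "W r3 v = 0" "W a v = 0" using F by blast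
          then show ?thesis
          proof cases
            case 1 then show ?thesis using tune(1)[OF v] by simp
          next
            case 2 
            then have "min_twice3 (W p1 v) (W p2 v) h" using tune(2)[OF v, of a] r' by auto
            then show ?thesis using 2 h unfolding min_twice3_def min_twice4_def by auto
          next
            case a: 3 
            then have "\<forall>r\<in>I. W r v = 0" using r' 3 by auto
            then show ?thesis using tune(3)[OF v] a by simp
          qed
        qed
        show ?thesis
          using hyperplane_lift[OF h c2(1,2)[OF v] F ldh(1) _ _ ldh(2) _ _ ldh(3-6) t] nz 3 unfolding ldc by simp
      qed
    qed
  qed
  then obtain X Y3 Y4 where XY: "\<And>v. hahn_deg (X v) = ereal (W p1 v) \<and>
      hahn_deg (X v + mon h * Y3 v + monomial 5 (h + \<tau>) * Y4 v) = ereal (W p2 v) \<and>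
      hahn_deg (Y3 v) = ereal (W r3 v) \<and> hahn_deg (Y4 v) = ereal (W a v) \<and>
      hahn_deg (Y4 v * k + Y3 v * al + X v * be) = ereal (W b v) \<and> hahn_deg (Y4 v * k' + Y3 v * al' + X v * be') = ereal (W c v)"
    by metis
  define k1 where "k1 r = (if r = p1 \<or> r = p2 then 1 else if r = b then be else if r = c then be' else 0)" for r
  define k2 where "k2 r = (if r = p2 then mon h else if r = r3 then 1 else if r = b then al else if r = c then al' else 0)" for r
  define k3 where "k3 r = (if r = p2 then monomial 5 (h + \<tau>) else if r = a then 1 else if r = b then k else if r = c then k' else 0)" for r
  define L where "L r v = k1 r * X v + k2 r * Y3 v + k3 r * Y4 v" for r v
  have ne: "distinct [p1, p2, r3, a, b, c]" using r' pI by auto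
  have U: "r = p1 \<or> r = p2 \<or> r = r3 \<or> r = a \<or> r = b \<or> r = c" for r
    using rows(2) r'(1) I by auto
  have Ls: "L p1 v = X v" "L r3 v = Y3 v" "L a v = Y4 v" for v
    unfolding L_def k1_def k2_def k3_def using ne by auto
  have "hahn_deg (L r v) = ereal (W r v)" for r v
    using U[of r] XY[of v] ne by (elim disjE) (auto simp: L_def k1_def k2_def k3_def algebra_simps)
  then have "lifts W L" unfolding lifts_def by blast
  moreover have "L r v = k1 r * L p1 v + k2 r * L r3 v + k3 r * L a v" for r v
    using L_def[of r v] by (simp only: Ls)
  ultimately show ?thesis by blast
qed

section \<open>Back to the matrix with six rows\<close>

lemma rank_le_3:
  fixes A :: "'a::field^'n^'m"
  assumes "\<And>r c. A $ r $ c = k1 r * A $ r1 $ c + k2 r * A $ r2 $ c + k3 r * A $ r3 $ c"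
  shows "rank A \<le> 3"
proof -
  let ?B = "{row r1 A, row r2 A, row r3 A}"
  have "rows A \<subseteq> vec.span ?B"
  proof
    fix x assume "x \<in> rows A"
    then obtain r where "x = row r A" unfolding rows_def by blast
    then have "x = k1 r *s row r1 A + k2 r *s row r2 A + k3 r *s row r3 A"
      by (simp add: vec_eq_iff row_def assms[of r])
    moreover have "k1 r *s row r1 A + k2 r *s row r2 A + k3 r *s row r3 A \<in> vec.span ?B"
      by (intro vec.span_add vec.span_scale vec.span_base) simp_all
    ultimately show "x \<in> vec.span ?B" by simp
  qed
  then have "rank A \<le> card ?B" unfolding row_rank_def_gen by (intro vec.dim_le_card) auto
  also have "\<dots> \<le> 3" by (simp add: card_insert_if)
  finally show ?thesis .
qed

lemma six_distinct: "distinct [1, 2, 3, 4, 5, 6 :: 6]"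
  by simp

theorem theorem3p3:
  shows "\<nexists>W :: real^'n^6.
     tropical_rank W = 3 \<and>
     kapranov_rank W > 3 \<and>
     (\<forall>u. \<exists>v. pattern W $ u $ v = 0) \<and>
     (\<forall>v. column_support (pattern W) v \<in>
        {{1, 2}, {4, 5, 6}, {3, 4, 6}, {3, 5, 6}, {3, 4, 5}, {3, 4, 5, 6}}) \<and>
     (\<exists>v. column_support (pattern W) v = {1, 2}) \<and>
     (\<exists>v. column_support (pattern W) v \<in> {{4, 5, 6}, {3, 4, 6}, {3, 5, 6}, {3, 4, 5}})"
proof
  assume "\<exists>W :: real^'n^6.
     tropical_rank W = 3 \<and>
     kapranov_rank W > 3 \<and>
     (\<forall>u. \<exists>v. pattern W $ u $ v = 0) \<and>
     (\<forall>v. column_support (pattern W) v \<in>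
        {{1, 2}, {4, 5, 6}, {3, 4, 6}, {3, 5, 6}, {3, 4, 5}, {3, 4, 5, 6}}) \<and>
     (\<exists>v. column_support (pattern W) v = {1, 2}) \<and>
     (\<exists>v. column_support (pattern W) v \<in> {{4, 5, 6}, {3, 4, 6}, {3, 5, 6}, {3, 4, 5}})"
  then obtain W :: "real^'n^6" where tr: "tropical_rank W = 3" and kr: "kapranov_rank W > 3"
    and row0: "\<And>u. \<exists>v. pattern W $ u $ v = 0"
    and supp: "\<And>v. column_support (pattern W) v \<in> {{1, 2}, {4, 5, 6}, {3, 4, 6}, {3, 5, 6}, {3, 4, 5}, {3, 4, 5, 6}}"
    and s12: "\<exists>v. column_support (pattern W) v = {1, 2}"
    and s3: "\<exists>v. column_support (pattern W) v \<in> {{4, 5, 6}, {3, 4, 6}, {3, 5, 6}, {3, 4, 5}}"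
    by blast
  define mn where "mn v = Min (range (\<lambda>i. W $ i $ v))" for v
  \<comment> \<open>The summand 0 is a trivial row shift and gives \<open>w\<close> the shape of
    \<open>no_dominant_minor_shift\<close>.\<close>
  define w where "w r v = W $ r $ v + 0 - mn v" for r v
  define S where "S v = column_support (pattern W) v" for v
  have S: "r \<in> S v \<longleftrightarrow> w r v = 0" for r v
    by (auto simp: S_def column_support_def pattern_def w_def mn_def)
  have nn: "w r v \<ge> 0" for r v unfolding w_def mn_def by simp
  have pos: "r \<notin> S v \<Longrightarrow> w r v > 0" for r v using nn[of r v] S[of r v] by force
  have ns: "no_dominant_minor w"
    unfolding w_def[abs_def] by (rule no_dominant_minor_shift[OF no_dominant_minor_if_tropical_rank]) (use tr in simp)
  define C1 where "C1 = {v. S v = {1, 2}}"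
  define C2 where "C2 = {v. S v \<noteq> {1, 2}}"
  have S2: "S v \<in> {{4, 5, 6}, {3, 4, 6}, {3, 5, 6}, {3, 4, 5}, {3, 4, 5, 6}}" if "v \<in> C2" for v
    using supp[of v] that by (auto simp: C2_def S_def)
  have "\<exists>L r1 r2 r3 k1 k2 k3. lifts w L \<and> (\<forall>r c. L r c = k1 r * L r1 c + k2 r * L r2 c + k3 r * L r3 c)"
  proof (rule lift_exists[OF ns six_distinct UNIV_6 refl])
    show "C1 \<inter> C2 = {}" "C1 \<union> C2 = UNIV" by (auto simp: C1_def C2_def)
    show "C1 \<noteq> {}" using s12 by (auto simp: C1_def S_def)
    show "w 1 c = 0" "w 2 c = 0" if "c \<in> C1" for c using that S[of _ c] by (auto simp: C1_def)
    show "w r c > 0" if "c \<in> C1" "r \<in> {3, 4, 5, 6}" for c r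
      using that by (intro pos) (auto simp: C1_def)
    show "w 1 v > 0" "w 2 v > 0" if "v \<in> C2" for v
      using S2[OF that] by (intro pos; auto)+
    show "w r v \<ge> 0" for r v by (rule nn)
    show "r = s" if v: "v \<in> C2" "r \<in> {3, 4, 5, 6}" "s \<in> {3, 4, 5, 6}" "w r v > 0" "w s v > 0" for r s v
    proof -
      have "r \<notin> S v" "s \<notin> S v" using v S by force+
      then show ?thesis using S2[OF v(1)] v(2,3) by auto
    qed
    show "\<exists>v\<in>C2. w r v = 0" if "r \<in> {3, 4, 5, 6}" for r
    proof -
      obtain v where "pattern W $ r $ v = 0" using row0 by blast
      then have "r \<in> S v" by (simp add: S_def column_support_def)
      then show ?thesis using that S[of r v] by (intro bexI[of _ v]) (auto simp: C2_def)
    qed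
    show "\<exists>r\<in>{3, 4, 5, 6}. \<exists>v\<in>C2. w r v > 0"
    proof -
      obtain v where v: "S v \<in> {{4, 5, 6}, {3, 4, 6}, {3, 5, 6}, {3, 4, 5}}" using s3 by (auto simp: S_def)
      have "1 \<notin> S v" using v by auto
      then have "v \<in> C2" by (auto simp: C2_def)
      moreover have "3 \<notin> S v \<or> 4 \<notin> S v \<or> 5 \<notin> S v \<or> 6 \<notin> S v" using v by auto
      ultimately show ?thesis using pos by blast
    qed
  qed
  then obtain L r1 r2 r3 k1 k2 k3 where L: "lifts w L"
    and eq: "\<And>r c. L r c = k1 r * L r1 c + k2 r * L r2 c + k3 r * L r3 c" by blast
  \<comment> \<open>Scaling the columns restores the subtracted minima and preserves the linear
    relations between the rows.\<close>
  define A :: "hahn^'n^6" where "A = (\<chi> r c. mon (mn c) * L r c)"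
  have "is_lift W A"
    unfolding is_lift_def A_def
  proof (intro allI)
    fix i j
    have "hahn_deg (mon (mn j) * L i j) = ereal (mn j + w i j)"
      by (rule hahn_deg_mon_mult) (use L in \<open>simp add: lifts_def\<close>)
    then show "hahn_deg ((\<chi> r c. mon (mn c) * L r c) $ i $ j) = ereal (W $ i $ j)" by (simp add: w_def)
  qed
  moreover have "rank A \<le> 3"
  proof (rule rank_le_3)
    fix r c
    show "A $ r $ c = k1 r * A $ r1 $ c + k2 r * A $ r2 $ c + k3 r * A $ r3 $ c"
      unfolding A_def using eq[of r c] by (simp add: algebra_simps)
  qed
  ultimately show False using kapranov_rank_le[of W A] kr by simp
qed

end
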